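(* Let $R$ be a commutative semiring and let $(\mathbf H,\oplus,0,\otimes,1,\mathrm{scal})$ be a semiadditive category $(\mathbf H,\oplus,0)$ with a symmetric monoidal structure $(\otimes,1)$ distributive over it, and with a semiring isomorphism $\mathrm{scal}:R\to\mathbf H(1,1)$. Let $\mathbf{FTP}^R$ be the coloured PROP of functional Tensor-Plus diagrams over $R$, and $[\![-]\!]$ its semantics in $\mathbf H$. Then for all objects $\mathcal X,\mathcal Y$ of $\mathbf{FTP}^R$ and every morphism $f\in\mathbf H([\![\mathcal X]\!],[\![\mathcal Y]\!])$, there exists a diagram $d\in\mathbf{FTP}^R(\mathcal X,\mathcal Y)$ such that $[\![d]\!]=f$.
   Context: **Target category.** $(\mathbf H,\oplus,0)$ is semiadditive: it has finite biproducts $\oplus$ with zero object $0$, injections $\iota_\ell,\iota_r$, projections $\pi_\ell,\pi_r$, diagonal $\Delta:H\to H\oplus H$, codiagonal $\nabla:H\oplus H\to H$, zero morphisms $\mathbf{zero}$, and the induced commutative-monoid enrichment $f+g=\nabla\circ(f\oplus g)\circ\Delta$. $(\mathbf H,\otimes,1)$ is symmetric monoidal and distributive over $\oplus$: the canonical maps $H\otimes(K\oplus L)\to(H\otimes K)\oplus(H\otimes L)$ and $H\otimes 0\to 0$ are isomorphisms. The hom-set $\mathbf H(1,1)$ is a commutative semiring under $+,\mathbf{zero},\circ,\mathrm{id}$. For $s\in R$ and $f:H\to K$, put $s\cdot f:=\lambda^\otimes\circ(\mathrm{scal}(s)\otimes f)\circ(\lambda^\otimes)^{-1}$, where $\lambda^\otimes:1\otimes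 H\to H$ is the left unitor. **The product $|$.** $H\mid K:=(H\otimes K)\oplus(H\oplus K)$ and $f\mid g:=(f\otimes g)\oplus(f\oplus g)$. This is a symmetric monoidal product with unit $0$. Its unitors $0\mid H\to H$ and $H\mid 0\to H$ are the projections onto the summand $H$ (the other summands are zero objects). Its symmetry is $\sigma^|=\sigma^\otimes\oplus\sigma^\oplus$. Its associator $(H\mid K)\mid L\to H\mid(K\mid L)$ is obtained by expanding both sides by distributivity into seven summands, $H\otimes K\otimes L$ (suitably bracketed), $H\otimes K$, $H\otimes L$, $K\otimes L$, $H$, $K$, $L$, and matching corresponding summands by $\alpha^\otimes$ on the triple tensor and identities elsewhere. $m^|$ denotes the unique canonical isomorphism between two bracketings (with units) for $|$. **Colours and objects.** Colours are generated by $A,B::=\mathbf 0\mid\mathbf 1\mid(A\oplus B)\mid(A\otimes B)$. Objects of the PROP are finite lists $A_1\parallel\dots\parallel A_n$ of colours; $\parallel$ is strictly associative, with the empty list $\varnothing$ as strict unit. $\approx$ is the smallest equivalence relation on colours that is a congruence for $\oplus$ and $\otimes$ and contains $A\oplus\mathbf 0\approx A\approx\mathbf 0\oplus A$, $A\otimes\mathbf 1\approx A\approx\mathbf 1\otimes A$, $(A\oplus B)\oplus C\approx A\oplus(B\oplus C)$, $(A\otimes B)\otimes C\approx A\otimes(B\otimes C)$. **Diagrams.** $\mathbf{FTP}^R$ is the coloured PROP (strict symmetric monoidal category) freely generated, for all colours $A,B$, by: Tensor $A\parallel B\to A\otimes B$, Plus $A\parallel B\to A\oplus B$, Contraction $A\parallel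 A\to A$, Null $\varnothing\to A$, the reversed (mirrored) version of each of these, Adapter $A\to A'$ whenever $A\approx A'$, and Scalar $[s]_A:A\to A$ for $s\in R$. Identities and swaps $A\parallel B\to B\parallel A$ are part of the PROP structure. **Semantics.** On colours, $[\![A]\!]$ is the object of $\mathbf H$ defined recursively by: $[\![\mathbf 0]\!]=0$, $[\![\mathbf 1]\!]=1$, $[\![A\oplus B]\!]=[\![A]\!]\oplus[\![B]\!]$, $[\![A\otimes B]\!]=[\![A]\!]\otimes[\![B]\!]$. On objects: $[\![\varnothing]\!]=0$, a list consisting of a single colour $A$ is interpreted as the object $[\![A]\!]$ of $\mathbf H$ assigned to the colour $A$ by this recursion on colours, and $[\![\mathcal X\parallel B]\!]=[\![\mathcal X]\!]\mid[\![B]\!]$. On generators: - identity $\mapsto\mathrm{id}$; swap $\mapsto\sigma^|$; $[s]_A\mapsto s\cdot\mathrm{id}$; - Plus $\mapsto\pi_r:[\![A]\!]\mid[\![B]\!]\to[\![A]\!]\oplus[\![B]\!]$, mirrored Plus $\mapsto\iota_r$; - Tensor $\mapsto\pi_\ell:[\![A]\!]\mid[\![B]\!]\to[\![A]\!]\otimes[\![B]\!]$, mirrored Tensor $\mapsto\iota_\ell$; - Contraction $\mapsto\nabla\circ\pi_r$, mirrored Contraction $\mapsto\iota_r\circ\Delta$; - Null and mirrored Null $\mapsto\mathbf{zero}$; - Adapter $A\to A'$ $\mapsto$ the canonical isomorphism $[\![A]\!]\to[\![A']\!]$ built from associators and unitors of $\otimes$ and $\oplus$ and their inverses (it is unique).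 Composition: $[\![e\circ d]\!]=[\![e]\!]\circ[\![d]\!]$ and $[\![d\parallel e]\!]=m^|\circ([\![d]\!]\mid[\![e]\!])\circ m^|$. *)

theory Defs
  imports "HOL-Algebra.QuotRing"
begin

section \<open>Categories\<close>

record ('o, 'm) category =
  Obj :: "'o set"
  Arr :: "'m set"
  Dom :: "'m \<Rightarrow> 'o"
  Cod :: "'m \<Rightarrow> 'o"
  ident :: "'o \<Rightarrow> 'm"
  compose :: "'m \<Rightarrow> 'm \<Rightarrow> 'm" (infixr "\<cdot>\<index>" 55)

definition Hom :: "('o, 'm, 'x) category_scheme \<Rightarrow> 'o \<Rightarrow> 'o \<Rightarrow> 'm set" where
  "Hom C A B = {f \<in> Arr C. Dom C f = A \<and> Cod C f = B}"

locale category =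
  fixes C :: "('o, 'm, 'x) category_scheme" (structure)
  assumes Dom_in_Obj: "f \<in> Arr C \<Longrightarrow> Dom C f \<in> Obj C"
    and Cod_in_Obj: "f \<in> Arr C \<Longrightarrow> Cod C f \<in> Obj C"
    and ident_in_Hom: "A \<in> Obj C \<Longrightarrow> ident C A \<in> Hom C A A"
    and compose_in_Hom: "\<lbrakk>f \<in> Hom C A B; g \<in> Hom C B D\<rbrakk> \<Longrightarrow> g \<cdot> f \<in> Hom C A D"
    and ident_left: "f \<in> Hom C A B \<Longrightarrow> ident C B \<cdot> f = f"
    and ident_right: "f \<in> Hom C A B \<Longrightarrow> f \<cdot> ident C A = f"
    and compose_assoc:
      "\<lbrakk>f \<in> Hom C A B; g \<in> Hom C B D; h \<in> Hom C D E\<rbrakk> \<Longrightarrow> (h \<cdot> g) \<cdot> f = h \<cdot> (g \<cdot> f)"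

context
  fixes C :: "('o, 'm, 'x) category_scheme" (structure)
begin

definition inverse_arrows :: "'m \<Rightarrow> 'm \<Rightarrow> bool" where
  "inverse_arrows f g \<longleftrightarrow>
     f \<in> Arr C \<and> g \<in> Hom C (Cod C f) (Dom C f) \<and>
     g \<cdot> f = ident C (Dom C f) \<and> f \<cdot> g = ident C (Cod C f)"

definition isomorphism :: "'m \<Rightarrow> bool" where
  "isomorphism f \<longleftrightarrow> (\<exists>g. inverse_arrows f g)"

definition inv_arrow :: "'m \<Rightarrow> 'm" where
  "inv_arrow f = (THE g. inverse_arrows f g)"

end


section \<open>Semiadditive categories\<close>

record ('o, 'm) biproduct_category = "('o, 'm) category" +
  zeroO :: 'o
  biprod :: "'o \<Rightarrow> 'o \<Rightarrow> 'o" (infixr "\<boxplus>\<index>" 65)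
  injl :: "'o \<Rightarrow> 'o \<Rightarrow> 'm"
  injr :: "'o \<Rightarrow> 'o \<Rightarrow> 'm"
  prjl :: "'o \<Rightarrow> 'o \<Rightarrow> 'm"
  prjr :: "'o \<Rightarrow> 'o \<Rightarrow> 'm"

context
  fixes C :: "('o, 'm, 'x) biproduct_category_scheme" (structure)
begin

definition to_zero :: "'o \<Rightarrow> 'm" where
  "to_zero A = (THE f. f \<in> Hom C A (zeroO C))"

definition from_zero :: "'o \<Rightarrow> 'm" where
  "from_zero A = (THE f. f \<in> Hom C (zeroO C) A)"

definition zero_arrow :: "'o \<Rightarrow> 'o \<Rightarrow> 'm" where
  "zero_arrow A B = from_zero B \<cdot> to_zero A"

definition pairing :: "'m \<Rightarrow> 'm \<Rightarrow> 'm" where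
  "pairing f g = (THE h. h \<in> Hom C (Dom C f) (Cod C f \<boxplus> Cod C g) \<and>
     prjl C (Cod C f) (Cod C g) \<cdot> h = f \<and> prjr C (Cod C f) (Cod C g) \<cdot> h = g)"

definition copairing :: "'m \<Rightarrow> 'm \<Rightarrow> 'm" where
  "copairing f g = (THE h. h \<in> Hom C (Dom C f \<boxplus> Dom C g) (Cod C f) \<and>
     h \<cdot> injl C (Dom C f) (Dom C g) = f \<and> h \<cdot> injr C (Dom C f) (Dom C g) = g)"

definition biprod_arrow :: "'m \<Rightarrow> 'm \<Rightarrow> 'm" where
  "biprod_arrow f g =
     pairing (f \<cdot> prjl C (Dom C f) (Dom C g)) (g \<cdot> prjr C (Dom C f) (Dom C g))"

definition diagonal :: "'o \<Rightarrow> 'm" where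
  "diagonal A = pairing (ident C A) (ident C A)"

definition codiagonal :: "'o \<Rightarrow> 'm" where
  "codiagonal A = copairing (ident C A) (ident C A)"

definition add_arrow :: "'m \<Rightarrow> 'm \<Rightarrow> 'm" where
  "add_arrow f g = codiagonal (Cod C f) \<cdot> biprod_arrow f g \<cdot> diagonal (Dom C f)"

definition biprod_assoc :: "'o \<Rightarrow> 'o \<Rightarrow> 'o \<Rightarrow> 'm" where
  "biprod_assoc A B D =
     pairing (prjl C A B \<cdot> prjl C (A \<boxplus> B) D)
       (pairing (prjr C A B \<cdot> prjl C (A \<boxplus> B) D) (prjr C (A \<boxplus> B) D))"

definition biprod_lunit :: "'o \<Rightarrow> 'm" where
  "biprod_lunit A = prjr C (zeroO C) A"

definition biprod_runit :: "'o \<Rightarrow> 'm" where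
  "biprod_runit A = prjl C A (zeroO C)"

definition biprod_symm :: "'o \<Rightarrow> 'o \<Rightarrow> 'm" where
  "biprod_symm A B = pairing (prjr C A B) (prjl C A B)"

end

locale semiadditive_category = category C
  for C :: "('o, 'm, 'x) biproduct_category_scheme" (structure) +
  assumes zeroO_in_Obj: "zeroO C \<in> Obj C"
    and terminal: "A \<in> Obj C \<Longrightarrow> \<exists>!f. f \<in> Hom C A (zeroO C)"
    and initial: "A \<in> Obj C \<Longrightarrow> \<exists>!f. f \<in> Hom C (zeroO C) A"
    and biprod_in_Obj: "\<lbrakk>A \<in> Obj C; B \<in> Obj C\<rbrakk> \<Longrightarrow> A \<boxplus> B \<in> Obj C"
    and injl_in_Hom: "\<lbrakk>A \<in> Obj C; B \<in> Obj C\<rbrakk> \<Longrightarrow> injl C A B \<in> Hom C A (A \<boxplus> B)"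
    and injr_in_Hom: "\<lbrakk>A \<in> Obj C; B \<in> Obj C\<rbrakk> \<Longrightarrow> injr C A B \<in> Hom C B (A \<boxplus> B)"
    and prjl_in_Hom: "\<lbrakk>A \<in> Obj C; B \<in> Obj C\<rbrakk> \<Longrightarrow> prjl C A B \<in> Hom C (A \<boxplus> B) A"
    and prjr_in_Hom: "\<lbrakk>A \<in> Obj C; B \<in> Obj C\<rbrakk> \<Longrightarrow> prjr C A B \<in> Hom C (A \<boxplus> B) B"
    and product: "\<lbrakk>f \<in> Hom C X A; g \<in> Hom C X B\<rbrakk> \<Longrightarrow>
      \<exists>!h. h \<in> Hom C X (A \<boxplus> B) \<and> prjl C A B \<cdot> h = f \<and> prjr C A B \<cdot> h = g"
    and coproduct: "\<lbrakk>f \<in> Hom C A X; g \<in> Hom C B X\<rbrakk> \<Longrightarrow>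
      \<exists>!h. h \<in> Hom C (A \<boxplus> B) X \<and> h \<cdot> injl C A B = f \<and> h \<cdot> injr C A B = g"
    and prjl_injl: "\<lbrakk>A \<in> Obj C; B \<in> Obj C\<rbrakk> \<Longrightarrow> prjl C A B \<cdot> injl C A B = ident C A"
    and prjr_injr: "\<lbrakk>A \<in> Obj C; B \<in> Obj C\<rbrakk> \<Longrightarrow> prjr C A B \<cdot> injr C A B = ident C B"
    and prjl_injr: "\<lbrakk>A \<in> Obj C; B \<in> Obj C\<rbrakk> \<Longrightarrow> prjl C A B \<cdot> injr C A B = zero_arrow C B A"
    and prjr_injl: "\<lbrakk>A \<in> Obj C; B \<in> Obj C\<rbrakk> \<Longrightarrow> prjr C A B \<cdot> injl C A B = zero_arrow C A B"


section \<open>Distributive symmetric monoidal structures\<close>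

record ('o, 'm) bimonoidal_category = "('o, 'm) biproduct_category" +
  unitO :: 'o
  tensor :: "'o \<Rightarrow> 'o \<Rightarrow> 'o" (infixr "\<boxtimes>\<index>" 70)
  tensor_arrow :: "'m \<Rightarrow> 'm \<Rightarrow> 'm"
  tensor_assoc :: "'o \<Rightarrow> 'o \<Rightarrow> 'o \<Rightarrow> 'm"
  tensor_lunit :: "'o \<Rightarrow> 'm"
  tensor_runit :: "'o \<Rightarrow> 'm"
  tensor_symm :: "'o \<Rightarrow> 'o \<Rightarrow> 'm"

locale symmetric_monoidal_category = category C
  for C :: "('o, 'm, 'x) bimonoidal_category_scheme" (structure) +
  assumes unitO_in_Obj: "unitO C \<in> Obj C"
    and tensor_in_Obj: "\<lbrakk>A \<in> Obj C; B \<in> Obj C\<rbrakk> \<Longrightarrow> A \<boxtimes> B \<in> Obj C"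
    and tensor_arrow_in_Hom: "\<lbrakk>f \<in> Hom C A A'; g \<in> Hom C B B'\<rbrakk> \<Longrightarrow>
      tensor_arrow C f g \<in> Hom C (A \<boxtimes> B) (A' \<boxtimes> B')"
    and tensor_ident: "\<lbrakk>A \<in> Obj C; B \<in> Obj C\<rbrakk> \<Longrightarrow>
      tensor_arrow C (ident C A) (ident C B) = ident C (A \<boxtimes> B)"
    and tensor_compose:
      "\<lbrakk>f \<in> Hom C A A'; f' \<in> Hom C A' A''; g \<in> Hom C B B'; g' \<in> Hom C B' B''\<rbrakk> \<Longrightarrow>
      tensor_arrow C (f' \<cdot> f) (g' \<cdot> g) = tensor_arrow C f' g' \<cdot> tensor_arrow C f g"
    and tensor_assoc_in_Hom: "\<lbrakk>A \<in> Obj C; B \<in> Obj C; D \<in> Obj C\<rbrakk> \<Longrightarrow>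
      tensor_assoc C A B D \<in> Hom C ((A \<boxtimes> B) \<boxtimes> D) (A \<boxtimes> (B \<boxtimes> D))"
    and tensor_assoc_iso: "\<lbrakk>A \<in> Obj C; B \<in> Obj C; D \<in> Obj C\<rbrakk> \<Longrightarrow>
      isomorphism C (tensor_assoc C A B D)"
    and tensor_assoc_natural: "\<lbrakk>f \<in> Hom C A A'; g \<in> Hom C B B'; h \<in> Hom C D D'\<rbrakk> \<Longrightarrow>
      tensor_assoc C A' B' D' \<cdot> tensor_arrow C (tensor_arrow C f g) h =
      tensor_arrow C f (tensor_arrow C g h) \<cdot> tensor_assoc C A B D"
    and tensor_lunit_in_Hom: "A \<in> Obj C \<Longrightarrow> tensor_lunit C A \<in> Hom C (unitO C \<boxtimes> A) A"
    and tensor_lunit_iso: "A \<in> Obj C \<Longrightarrow> isomorphism C (tensor_lunit C A)"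
    and tensor_lunit_natural: "f \<in> Hom C A A' \<Longrightarrow>
      tensor_lunit C A' \<cdot> tensor_arrow C (ident C (unitO C)) f = f \<cdot> tensor_lunit C A"
    and tensor_runit_in_Hom: "A \<in> Obj C \<Longrightarrow> tensor_runit C A \<in> Hom C (A \<boxtimes> unitO C) A"
    and tensor_runit_iso: "A \<in> Obj C \<Longrightarrow> isomorphism C (tensor_runit C A)"
    and tensor_runit_natural: "f \<in> Hom C A A' \<Longrightarrow>
      tensor_runit C A' \<cdot> tensor_arrow C f (ident C (unitO C)) = f \<cdot> tensor_runit C A"
    and tensor_symm_in_Hom: "\<lbrakk>A \<in> Obj C; B \<in> Obj C\<rbrakk> \<Longrightarrow>
      tensor_symm C A B \<in> Hom C (A \<boxtimes> B) (B \<boxtimes> A)"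
    and tensor_symm_natural: "\<lbrakk>f \<in> Hom C A A'; g \<in> Hom C B B'\<rbrakk> \<Longrightarrow>
      tensor_symm C A' B' \<cdot> tensor_arrow C f g = tensor_arrow C g f \<cdot> tensor_symm C A B"
    and tensor_symm_inverse: "\<lbrakk>A \<in> Obj C; B \<in> Obj C\<rbrakk> \<Longrightarrow>
      tensor_symm C B A \<cdot> tensor_symm C A B = ident C (A \<boxtimes> B)"
    and pentagon: "\<lbrakk>A \<in> Obj C; B \<in> Obj C; D \<in> Obj C; E \<in> Obj C\<rbrakk> \<Longrightarrow>
      tensor_arrow C (ident C A) (tensor_assoc C B D E) \<cdot> tensor_assoc C A (B \<boxtimes> D) E \<cdot>
        tensor_arrow C (tensor_assoc C A B D) (ident C E) =
      tensor_assoc C A B (D \<boxtimes> E) \<cdot> tensor_assoc C (A \<boxtimes> B) D E"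
    and triangle: "\<lbrakk>A \<in> Obj C; B \<in> Obj C\<rbrakk> \<Longrightarrow>
      tensor_arrow C (ident C A) (tensor_lunit C B) \<cdot> tensor_assoc C A (unitO C) B =
      tensor_arrow C (tensor_runit C A) (ident C B)"
    and hexagon: "\<lbrakk>A \<in> Obj C; B \<in> Obj C; D \<in> Obj C\<rbrakk> \<Longrightarrow>
      tensor_assoc C B D A \<cdot> tensor_symm C A (B \<boxtimes> D) \<cdot> tensor_assoc C A B D =
      tensor_arrow C (ident C B) (tensor_symm C A D) \<cdot> tensor_assoc C B A D \<cdot>
        tensor_arrow C (tensor_symm C A B) (ident C D)"

locale distributive_semiadditive_category =
  semiadditive_category C + symmetric_monoidal_category C
  for C :: "('o, 'm, 'x) bimonoidal_category_scheme" (structure) +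
  assumes distributive_biprod: "\<lbrakk>A \<in> Obj C; B \<in> Obj C; D \<in> Obj C\<rbrakk> \<Longrightarrow>
      isomorphism C (pairing C (tensor_arrow C (ident C A) (prjl C B D))
                               (tensor_arrow C (ident C A) (prjr C B D)))"
    and distributive_zero: "A \<in> Obj C \<Longrightarrow> isomorphism C (to_zero C (A \<boxtimes> zeroO C))"

definition endo_semiring :: "('o, 'm, 'x) bimonoidal_category_scheme \<Rightarrow> 'm ring" where
  "endo_semiring C =
     \<lparr>carrier = Hom C (unitO C) (unitO C), mult = compose C, one = ident C (unitO C),
      zero = zero_arrow C (unitO C) (unitO C), add = add_arrow C\<rparr>"

text \<open>Unlike for rings, preservation of zero is not part of the library notion of a homomorphism.\<close>

definition semiring_iso :: "('a, 'x) ring_scheme \<Rightarrow> ('b, 'y) ring_scheme \<Rightarrow> ('a \<Rightarrow> 'b) set" where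
  "semiring_iso R S = {h \<in> ring_iso R S. h \<zero>\<^bsub>R\<^esub> = \<zero>\<^bsub>S\<^esub>}"

definition scalar_mult ::
  "('o, 'm, 'x) bimonoidal_category_scheme \<Rightarrow> ('r \<Rightarrow> 'm) \<Rightarrow> 'r \<Rightarrow> 'm \<Rightarrow> 'm" where
  "scalar_mult C scal s f =
     compose C (tensor_lunit C (Cod C f))
       (compose C (tensor_arrow C (scal s) f) (inv_arrow C (tensor_lunit C (Dom C f))))"


section \<open>The monoidal product combining tensor and biproduct\<close>

context
  fixes C :: "('o, 'm, 'x) bimonoidal_category_scheme" (structure)
begin

definition par :: "'o \<Rightarrow> 'o \<Rightarrow> 'o" where
  "par H K = (H \<boxtimes> K) \<boxplus> (H \<boxplus> K)"

definition par_arrow :: "'m \<Rightarrow> 'm \<Rightarrow> 'm" where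
  "par_arrow f g = biprod_arrow C (tensor_arrow C f g) (biprod_arrow C f g)"

definition par_lunit :: "'o \<Rightarrow> 'm" where
  "par_lunit H = prjr C (zeroO C) H \<cdot> prjr C (zeroO C \<boxtimes> H) (zeroO C \<boxplus> H)"

definition par_runit :: "'o \<Rightarrow> 'm" where
  "par_runit H = prjl C H (zeroO C) \<cdot> prjr C (H \<boxtimes> zeroO C) (H \<boxplus> zeroO C)"

definition par_symm :: "'o \<Rightarrow> 'o \<Rightarrow> 'm" where
  "par_symm H K = biprod_arrow C (tensor_symm C H K) (biprod_symm C H K)"

text \<open>
  The seven components of the expansions of \<open>(H | K) | L\<close> and \<open>H | (K | L)\<close>, in the order
  \<open>HKL, HK, HL, KL, H, K, L\<close>. Each component tensors a projection out of one argument with the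
  identity of the other one, as in the canonical distributivity maps.
\<close>

definition expand_left :: "'o \<Rightarrow> 'o \<Rightarrow> 'o \<Rightarrow> 'm" where
  "expand_left H K L =
    (let t = prjl C (par H K \<boxtimes> L) (par H K \<boxplus> L);
         s = prjr C (par H K \<boxtimes> L) (par H K \<boxplus> L);
         p = prjl C (par H K) L \<cdot> s;
         qHK = prjl C (H \<boxtimes> K) (H \<boxplus> K);
         qH = prjl C H K \<cdot> prjr C (H \<boxtimes> K) (H \<boxplus> K);
         qK = prjr C H K \<cdot> prjr C (H \<boxtimes> K) (H \<boxplus> K)
     in pairing C (tensor_arrow C qHK (ident C L) \<cdot> t)
       (pairing C (qHK \<cdot> p)
       (pairing C (tensor_arrow C qH (ident C L) \<cdot> t)
       (pairing C (tensor_arrow C qK (ident C L) \<cdot> t)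
       (pairing C (qH \<cdot> p)
       (pairing C (qK \<cdot> p)
          (prjr C (par H K) L \<cdot> s)))))))"

definition expand_right :: "'o \<Rightarrow> 'o \<Rightarrow> 'o \<Rightarrow> 'm" where
  "expand_right H K L =
    (let t = prjl C (H \<boxtimes> par K L) (H \<boxplus> par K L);
         s = prjr C (H \<boxtimes> par K L) (H \<boxplus> par K L);
         p = prjr C H (par K L) \<cdot> s;
         qKL = prjl C (K \<boxtimes> L) (K \<boxplus> L);
         qK = prjl C K L \<cdot> prjr C (K \<boxtimes> L) (K \<boxplus> L);
         qL = prjr C K L \<cdot> prjr C (K \<boxtimes> L) (K \<boxplus> L)
     in pairing C (tensor_arrow C (ident C H) qKL \<cdot> t)
       (pairing C (tensor_arrow C (ident C H) qK \<cdot> t)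
       (pairing C (tensor_arrow C (ident C H) qL \<cdot> t)
       (pairing C (qKL \<cdot> p)
       (pairing C (prjl C H (par K L) \<cdot> s)
       (pairing C (qK \<cdot> p)
          (qL \<cdot> p)))))))"

definition par_assoc :: "'o \<Rightarrow> 'o \<Rightarrow> 'o \<Rightarrow> 'm" where
  "par_assoc H K L =
     inv_arrow C (expand_right H K L) \<cdot>
     biprod_arrow C (tensor_assoc C H K L)
       (ident C ((H \<boxtimes> K) \<boxplus> (H \<boxtimes> L) \<boxplus> (K \<boxtimes> L) \<boxplus> H \<boxplus> K \<boxplus> L)) \<cdot>
     expand_left H K L"

end


section \<open>Colours and diagrams\<close>

datatype colour = Zero | One | Oplus colour colour | Otimes colour colour

inductive colour_equiv :: "colour \<Rightarrow> colour \<Rightarrow> bool" (infix "\<approx>" 50) where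
  refl: "A \<approx> A"
| sym: "A \<approx> B \<Longrightarrow> B \<approx> A"
| trans: "\<lbrakk>A \<approx> B; B \<approx> D\<rbrakk> \<Longrightarrow> A \<approx> D"
| oplus: "\<lbrakk>A \<approx> A'; B \<approx> B'\<rbrakk> \<Longrightarrow> Oplus A B \<approx> Oplus A' B'"
| otimes: "\<lbrakk>A \<approx> A'; B \<approx> B'\<rbrakk> \<Longrightarrow> Otimes A B \<approx> Otimes A' B'"
| oplus_runit: "Oplus A Zero \<approx> A"
| oplus_lunit: "Oplus Zero A \<approx> A"
| otimes_runit: "Otimes A One \<approx> A"
| otimes_lunit: "Otimes One A \<approx> A"
| oplus_assoc: "Oplus (Oplus A B) D \<approx> Oplus A (Oplus B D)"
| otimes_assoc: "Otimes (Otimes A B) D \<approx> Otimes A (Otimes B D)"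

text \<open>
  Terms denoting diagrams; \<open>Comp e d\<close> is \<open>e\<close> after \<open>d\<close>, \<open>Par\<close> is juxtaposition, and the
  suffix \<open>M\<close> marks the mirrored generators.
\<close>

datatype 'r diagram =
    Wires "colour list"
  | Swap colour colour
  | Tensor colour colour
  | TensorM colour colour
  | Plus colour colour
  | PlusM colour colour
  | Contr colour
  | ContrM colour
  | Null colour
  | NullM colour
  | Adapter colour colour
  | Scalar 'r colour
  | Comp "'r diagram" "'r diagram"
  | Par "'r diagram" "'r diagram"

primrec src :: "'r diagram \<Rightarrow> colour list" where
  "src (Wires X) = X"
| "src (Swap A B) = [A, B]"
| "src (Tensor A B) = [A, B]"
| "src (TensorM A B) = [Otimes A B]"
| "src (Plus A B) = [A, B]"
| "src (PlusM A B) = [Oplus A B]"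
| "src (Contr A) = [A, A]"
| "src (ContrM A) = [A]"
| "src (Null A) = []"
| "src (NullM A) = [A]"
| "src (Adapter A B) = [A]"
| "src (Scalar s A) = [A]"
| "src (Comp e d) = src d"
| "src (Par d e) = src d @ src e"

primrec tgt :: "'r diagram \<Rightarrow> colour list" where
  "tgt (Wires X) = X"
| "tgt (Swap A B) = [B, A]"
| "tgt (Tensor A B) = [Otimes A B]"
| "tgt (TensorM A B) = [A, B]"
| "tgt (Plus A B) = [Oplus A B]"
| "tgt (PlusM A B) = [A, B]"
| "tgt (Contr A) = [A]"
| "tgt (ContrM A) = [A, A]"
| "tgt (Null A) = [A]"
| "tgt (NullM A) = []"
| "tgt (Adapter A B) = [B]"
| "tgt (Scalar s A) = [A]"
| "tgt (Comp e d) = tgt e"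
| "tgt (Par d e) = tgt d @ tgt e"

primrec wf_diagram :: "('r, 'x) ring_scheme \<Rightarrow> 'r diagram \<Rightarrow> bool" where
  "wf_diagram R (Wires X) = True"
| "wf_diagram R (Swap A B) = True"
| "wf_diagram R (Tensor A B) = True"
| "wf_diagram R (TensorM A B) = True"
| "wf_diagram R (Plus A B) = True"
| "wf_diagram R (PlusM A B) = True"
| "wf_diagram R (Contr A) = True"
| "wf_diagram R (ContrM A) = True"
| "wf_diagram R (Null A) = True"
| "wf_diagram R (NullM A) = True"
| "wf_diagram R (Adapter A B) = (A \<approx> B)"
| "wf_diagram R (Scalar s A) = (s \<in> carrier R)"
| "wf_diagram R (Comp e d) = (wf_diagram R e \<and> wf_diagram R d \<and> src e = tgt d)"
| "wf_diagram R (Par d e) = (wf_diagram R d \<and> wf_diagram R e)"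

text \<open>
  Swaps of lists of wires, composed from swaps of two wires so that the hexagon identities of a
  symmetric strict monoidal category hold by construction.
\<close>

primrec wire_swap :: "colour \<Rightarrow> colour list \<Rightarrow> 'r diagram" where
  "wire_swap A [] = Wires [A]"
| "wire_swap A (B # Y) = Comp (Par (Wires [B]) (wire_swap A Y)) (Par (Swap A B) (Wires Y))"

primrec block_swap :: "colour list \<Rightarrow> colour list \<Rightarrow> 'r diagram" where
  "block_swap [] Y = Wires Y"
| "block_swap (A # X) Y = Comp (Par (wire_swap A Y) (Wires X)) (Par (Wires [A]) (block_swap X Y))"

text \<open>The congruence generated by the axioms of a symmetric strict monoidal category.\<close>

inductive prop_equiv :: "('r, 'x) ring_scheme \<Rightarrow> 'r diagram \<Rightarrow> 'r diagram \<Rightarrow> bool"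
  for R :: "('r, 'x) ring_scheme" where
  refl: "wf_diagram R d \<Longrightarrow> prop_equiv R d d"
| sym: "prop_equiv R d e \<Longrightarrow> prop_equiv R e d"
| trans: "\<lbrakk>prop_equiv R c d; prop_equiv R d e\<rbrakk> \<Longrightarrow> prop_equiv R c e"
| comp_cong: "\<lbrakk>prop_equiv R e e'; prop_equiv R d d'; src e = tgt d\<rbrakk> \<Longrightarrow>
    prop_equiv R (Comp e d) (Comp e' d')"
| par_cong: "\<lbrakk>prop_equiv R d d'; prop_equiv R e e'\<rbrakk> \<Longrightarrow> prop_equiv R (Par d e) (Par d' e')"
| comp_ident_left: "wf_diagram R d \<Longrightarrow> prop_equiv R (Comp (Wires (tgt d)) d) d"
| comp_ident_right: "wf_diagram R d \<Longrightarrow> prop_equiv R (Comp d (Wires (src d))) d"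
| comp_assoc:
    "\<lbrakk>wf_diagram R c; wf_diagram R d; wf_diagram R e; tgt c = src d; tgt d = src e\<rbrakk> \<Longrightarrow>
    prop_equiv R (Comp (Comp e d) c) (Comp e (Comp d c))"
| par_unit_left: "wf_diagram R d \<Longrightarrow> prop_equiv R (Par (Wires []) d) d"
| par_unit_right: "wf_diagram R d \<Longrightarrow> prop_equiv R (Par d (Wires [])) d"
| par_assoc: "\<lbrakk>wf_diagram R c; wf_diagram R d; wf_diagram R e\<rbrakk> \<Longrightarrow>
    prop_equiv R (Par (Par c d) e) (Par c (Par d e))"
| par_ident: "prop_equiv R (Par (Wires X) (Wires Y)) (Wires (X @ Y))"
| interchange:
    "\<lbrakk>wf_diagram R d; wf_diagram R e; wf_diagram R d'; wf_diagram R e';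
      tgt d = src e; tgt d' = src e'\<rbrakk> \<Longrightarrow>
    prop_equiv R (Par (Comp e d) (Comp e' d')) (Comp (Par e e') (Par d d'))"
| swap_inverse: "prop_equiv R (Comp (Swap B A) (Swap A B)) (Wires [A, B])"
| swap_natural: "\<lbrakk>wf_diagram R d; wf_diagram R e\<rbrakk> \<Longrightarrow>
    prop_equiv R (Comp (block_swap (tgt d) (tgt e)) (Par d e))
                 (Comp (Par e d) (block_swap (src d) (src e)))"

definition FTP :: "('r, 'x) ring_scheme \<Rightarrow> colour list \<Rightarrow> colour list \<Rightarrow> 'r diagram set set" where
  "FTP R X Y =
     {d. wf_diagram R d \<and> src d = X \<and> tgt d = Y} // {(d, e). prop_equiv R d e}"


section \<open>Semantics\<close>

context
  fixes C :: "('o, 'm, 'x) bimonoidal_category_scheme" (structure)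
begin

primrec colour_sem :: "colour \<Rightarrow> 'o" where
  "colour_sem Zero = zeroO C"
| "colour_sem One = unitO C"
| "colour_sem (Oplus A B) = colour_sem A \<boxplus> colour_sem B"
| "colour_sem (Otimes A B) = colour_sem A \<boxtimes> colour_sem B"

fun obj_sem :: "colour list \<Rightarrow> 'o" where
  "obj_sem [] = zeroO C"
| "obj_sem (A # X) = foldl (\<lambda>H B. par C H (colour_sem B)) (colour_sem A) X"

text \<open>The isomorphisms built from associators and unitors along a proof of \<open>A \<approx> B\<close>.\<close>

inductive canonical_iso :: "colour \<Rightarrow> colour \<Rightarrow> 'm \<Rightarrow> bool" where
  refl: "canonical_iso A A (ident C (colour_sem A))"
| sym: "canonical_iso A B f \<Longrightarrow> canonical_iso B A (inv_arrow C f)"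
| trans: "\<lbrakk>canonical_iso A B f; canonical_iso B D g\<rbrakk> \<Longrightarrow> canonical_iso A D (g \<cdot> f)"
| oplus: "\<lbrakk>canonical_iso A A' f; canonical_iso B B' g\<rbrakk> \<Longrightarrow>
    canonical_iso (Oplus A B) (Oplus A' B') (biprod_arrow C f g)"
| otimes: "\<lbrakk>canonical_iso A A' f; canonical_iso B B' g\<rbrakk> \<Longrightarrow>
    canonical_iso (Otimes A B) (Otimes A' B') (tensor_arrow C f g)"
| oplus_runit: "canonical_iso (Oplus A Zero) A (biprod_runit C (colour_sem A))"
| oplus_lunit: "canonical_iso (Oplus Zero A) A (biprod_lunit C (colour_sem A))"
| otimes_runit: "canonical_iso (Otimes A One) A (tensor_runit C (colour_sem A))"
| otimes_lunit: "canonical_iso (Otimes One A) A (tensor_lunit C (colour_sem A))"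
| oplus_assoc: "canonical_iso (Oplus (Oplus A B) D) (Oplus A (Oplus B D))
    (biprod_assoc C (colour_sem A) (colour_sem B) (colour_sem D))"
| otimes_assoc: "canonical_iso (Otimes (Otimes A B) D) (Otimes A (Otimes B D))
    (tensor_assoc C (colour_sem A) (colour_sem B) (colour_sem D))"

text \<open>By coherence at most one arrow satisfies the predicate, so the choice is immaterial.\<close>

definition adapter_sem :: "colour \<Rightarrow> colour \<Rightarrow> 'm" where
  "adapter_sem A B = (SOME f. canonical_iso A B f)"

text \<open>The canonical isomorphism from \<open>obj_sem X | obj_sem Y\<close> to \<open>obj_sem (X @ Y)\<close>.\<close>

fun join :: "colour list \<Rightarrow> colour list \<Rightarrow> 'm" where
  "join X Y =
    (if X = [] then par_lunit C (obj_sem Y)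
     else if Y = [] then par_runit C (obj_sem X)
     else if butlast Y = [] then ident C (obj_sem (X @ Y))
     else par_arrow C (join X (butlast Y)) (ident C (colour_sem (last Y))) \<cdot>
       inv_arrow C (par_assoc C (obj_sem X) (obj_sem (butlast Y)) (colour_sem (last Y))))"

declare join.simps [simp del]

end

context
  fixes C :: "('o, 'm, 'x) bimonoidal_category_scheme" (structure)
    and scal :: "'r \<Rightarrow> 'm"
begin

primrec term_sem :: "'r diagram \<Rightarrow> 'm" where
  "term_sem (Wires X) = ident C (obj_sem C X)"
| "term_sem (Swap A B) = par_symm C (colour_sem C A) (colour_sem C B)"
| "term_sem (Tensor A B) =
     prjl C (colour_sem C A \<boxtimes> colour_sem C B) (colour_sem C A \<boxplus> colour_sem C B)"
| "term_sem (TensorM A B) =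
     injl C (colour_sem C A \<boxtimes> colour_sem C B) (colour_sem C A \<boxplus> colour_sem C B)"
| "term_sem (Plus A B) =
     prjr C (colour_sem C A \<boxtimes> colour_sem C B) (colour_sem C A \<boxplus> colour_sem C B)"
| "term_sem (PlusM A B) =
     injr C (colour_sem C A \<boxtimes> colour_sem C B) (colour_sem C A \<boxplus> colour_sem C B)"
| "term_sem (Contr A) =
     codiagonal C (colour_sem C A) \<cdot> prjr C (colour_sem C A \<boxtimes> colour_sem C A) (colour_sem C A \<boxplus> colour_sem C A)"
| "term_sem (ContrM A) =
     injr C (colour_sem C A \<boxtimes> colour_sem C A) (colour_sem C A \<boxplus> colour_sem C A) \<cdot> diagonal C (colour_sem C A)"
| "term_sem (Null A) = zero_arrow C (zeroO C) (colour_sem C A)"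
| "term_sem (NullM A) = zero_arrow C (colour_sem C A) (zeroO C)"
| "term_sem (Adapter A B) = adapter_sem C A B"
| "term_sem (Scalar s A) = scalar_mult C scal s (ident C (colour_sem C A))"
| "term_sem (Comp e d) = term_sem e \<cdot> term_sem d"
| "term_sem (Par d e) =
     join C (tgt d) (tgt e) \<cdot> par_arrow C (term_sem d) (term_sem e) \<cdot>
     inv_arrow C (join C (src d) (src e))"

text \<open>The common semantics of all terms denoting a diagram.\<close>

definition diagram_sem :: "'r diagram set \<Rightarrow> 'm" where
  "diagram_sem D = the_elem (term_sem ` D)"

end

end

theory Submission
  imports Defs
begin

text \<open>
  Every object denoted by a colour is a finite biproduct of copies of the unit: its identity is a sum
  of composites \<open>H \<rightarrow> 1 \<rightarrow> H\<close>. All injections, projections, sums, tensors and scalars of arrows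
  between single colours are denoted by diagrams, hence so is every arrow between them, and an object
  \<open>A\<^sub>1 \<parallel> \<dots> \<parallel> A\<^sub>n\<close> is identified with a single colour by copying all wires and applying Tensor to one
  copy and Plus to the other.

  Since a diagram is a class of terms, its semantics is meaningful only if the axioms of a PROP hold in
  \<open>H\<close>. Arrows out of an object denoted by a list of wires are determined by their effect on points,
  and these can be chosen as lists of partial points of the wires, on which associators, symmetries and
  the isomorphisms \<open>join\<close> act by rebracketing, exchange and concatenation.
\<close>

section \<open>Arrows and isomorphisms\<close>

text \<open>Fullness between single colours is matrix calculus. With the identities of both ends
  written as sums of \<open>p \<cdot> q\<close>, an arrow \<open>f\<close> becomes a sum of terms
  \<open>p \<cdot> (q \<cdot> f \<cdot> p') \<cdot> q'\<close>, whose entries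
  \<open>q \<cdot> f \<cdot> p'\<close> lie in H(1,1) and so come from scalars of the semiring. What
  remains is that the \<open>p\<close> and \<open>q\<close> can be chosen among arrows denoted by
  diagrams. The passage to several wires involves no new isomorphism:
  \<open>Oplus (Otimes A B) (Oplus A B)\<close> and the list \<open>[A, B]\<close> denote literally
  the same object, and the point is to find diagrams in both directions that denote its identity.
  The obstacle in soundness is coherence of \<open>par\<close>, whose associator is defined through
  seven-fold expansions and an inverse. Its laws are proved at objects whose identity decomposes
  through 1, which include every \<open>obj_sem C X\<close>. There an equation need only be checked
  on pure tensors of points, and an inverse need only be guessed and tested on them.\<close>

lemma Hom_iff [simp]: "f \<in> Hom C A B \<longleftrightarrow> f \<in> Arr C \<and> Dom C f = A \<and> Cod C f = B"
  by (simp add: Hom_def)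

context category
begin

lemma Dom_Obj [simp]: "f \<in> Arr C \<Longrightarrow> Dom C f \<in> Obj C"
  by (rule Dom_in_Obj)

lemma Cod_Obj [simp]: "f \<in> Arr C \<Longrightarrow> Cod C f \<in> Obj C"
  by (rule Cod_in_Obj)

lemma ident_arr [simp]:
  assumes "A \<in> Obj C"
  shows "ident C A \<in> Arr C" "Dom C (ident C A) = A" "Cod C (ident C A) = A"
  using ident_in_Hom[OF assms] by simp_all

lemma comp_arr [simp]:
  assumes "f \<in> Arr C" "g \<in> Arr C" "Dom C g = Cod C f"
  shows "g \<cdot> f \<in> Arr C" "Dom C (g \<cdot> f) = Dom C f" "Cod C (g \<cdot> f) = Cod C g"
  using compose_in_Hom[of f "Dom C f" "Cod C f" g "Cod C g"] assms by simp_all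

lemma comp_assoc [simp]:
  assumes "f \<in> Arr C" "g \<in> Arr C" "h \<in> Arr C" "Dom C g = Cod C f" "Dom C h = Cod C g"
  shows "(h \<cdot> g) \<cdot> f = h \<cdot> g \<cdot> f"
  using compose_assoc[of f "Dom C f" "Cod C f" g "Cod C g" h "Cod C h"] assms by simp

lemma ident_comp [simp]: "f \<in> Arr C \<Longrightarrow> Cod C f = B \<Longrightarrow> ident C B \<cdot> f = f"
  using ident_left[of f "Dom C f" B] by simp

lemma comp_ident [simp]: "f \<in> Arr C \<Longrightarrow> Dom C f = A \<Longrightarrow> f \<cdot> ident C A = f"
  using ident_right[of f A "Cod C f"] by simp

lemma inverse_arrows_unique:
  assumes "inverse_arrows C f g" "inverse_arrows C f h"
  shows "g = h"
proof -
  have "g = g \<cdot> f \<cdot> h" using assms by (simp add: inverse_arrows_def)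
  also have "\<dots> = (g \<cdot> f) \<cdot> h"
    by (rule comp_assoc[symmetric]) (use assms in \<open>simp_all add: inverse_arrows_def\<close>)
  also have "\<dots> = h" using assms by (simp add: inverse_arrows_def del: comp_assoc)
  finally show ?thesis .
qed

lemma inverse_arrows_inv_arrow:
  "isomorphism C f \<Longrightarrow> inverse_arrows C f (inv_arrow C f)"
  unfolding isomorphism_def inv_arrow_def
  by (metis inverse_arrows_unique theI)

lemma isomorphism_arr: "isomorphism C f \<Longrightarrow> f \<in> Arr C"
  by (auto simp: isomorphism_def inverse_arrows_def)

lemma inv_arrow_arr [simp]:
  assumes "isomorphism C f"
  shows "inv_arrow C f \<in> Arr C" "Dom C (inv_arrow C f) = Cod C f" "Cod C (inv_arrow C f) = Dom C f"
  using inverse_arrows_inv_arrow[OF assms] by (simp_all add: inverse_arrows_def)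

lemma inv_arrow_comp [simp]:
  assumes "isomorphism C f"
  shows "inv_arrow C f \<cdot> f = ident C (Dom C f)" "f \<cdot> inv_arrow C f = ident C (Cod C f)"
  using inverse_arrows_inv_arrow[OF assms] by (simp_all add: inverse_arrows_def)

lemma inv_arrow_comp_comp [simp]:
  assumes "isomorphism C f" "g \<in> Arr C"
  shows "Cod C g = Dom C f \<Longrightarrow> inv_arrow C f \<cdot> f \<cdot> g = g"
    and "Cod C g = Cod C f \<Longrightarrow> f \<cdot> inv_arrow C f \<cdot> g = g"
  using assms isomorphism_arr[OF assms(1)]
  by (simp_all flip: comp_assoc)

lemma isomorphismI:
  assumes "f \<in> Arr C" "g \<in> Arr C" "Dom C g = Cod C f" "Cod C g = Dom C f"
    and "g \<cdot> f = ident C (Dom C f)" "f \<cdot> g = ident C (Cod C f)"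
  shows "isomorphism C f" "inv_arrow C f = g"
proof -
  have inv: "inverse_arrows C f g" using assms by (simp add: inverse_arrows_def)
  then show "isomorphism C f" by (auto simp: isomorphism_def)
  then show "inv_arrow C f = g"
    using inv inverse_arrows_inv_arrow inverse_arrows_unique by blast
qed

lemma iso_ident [simp]:
  assumes "A \<in> Obj C"
  shows "isomorphism C (ident C A)" "inv_arrow C (ident C A) = ident C A"
  by (rule isomorphismI[of _ "ident C A"]; use assms in simp)+

lemma iso_inv [simp]:
  assumes "isomorphism C f"
  shows "isomorphism C (inv_arrow C f)"
  by (rule isomorphismI[of _ f]; use assms isomorphism_arr in simp)

lemma iso_comp [simp]:
  assumes "isomorphism C f" "isomorphism C g" "Dom C g = Cod C f"
  shows "isomorphism C (g \<cdot> f)"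
  by (rule isomorphismI[of _ "inv_arrow C f \<cdot> inv_arrow C g"];
      use assms isomorphism_arr in simp)

lemma iso_epi:
  assumes "f \<cdot> h = g \<cdot> h" "isomorphism C h" "f \<in> Arr C" "g \<in> Arr C"
    "Dom C f = Cod C h" "Dom C g = Cod C h"
  shows "f = g"
proof -
  have "(f \<cdot> h) \<cdot> inv_arrow C h = (g \<cdot> h) \<cdot> inv_arrow C h" using assms by simp
  then show ?thesis using assms(2-) isomorphism_arr[of h] by simp
qed

lemma iso_mono:
  assumes "h \<cdot> f = h \<cdot> g" "isomorphism C h" "f \<in> Arr C" "g \<in> Arr C"
    "Cod C f = Dom C h" "Cod C g = Dom C h"
  shows "f = g"
proof -
  have "inv_arrow C h \<cdot> h \<cdot> f = inv_arrow C h \<cdot> h \<cdot> g" using assms by simp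
  then show ?thesis using assms(2-) by simp
qed

end

section \<open>Biproducts and addition of arrows\<close>

context semiadditive_category
begin

lemma zeroO_Obj [simp]: "zeroO C \<in> Obj C"
  by (rule zeroO_in_Obj)

lemma to_zero_arr [simp]:
  assumes "A \<in> Obj C"
  shows "to_zero C A \<in> Arr C" "Dom C (to_zero C A) = A" "Cod C (to_zero C A) = zeroO C"
  using theI'[OF terminal[OF assms]] by (simp_all add: to_zero_def)

lemma from_zero_arr [simp]:
  assumes "A \<in> Obj C"
  shows "from_zero C A \<in> Arr C" "Cod C (from_zero C A) = A" "Dom C (from_zero C A) = zeroO C"
  using theI'[OF initial[OF assms]] by (simp_all add: from_zero_def)

lemma eq_to_zero:
  assumes "f \<in> Arr C" "g \<in> Arr C" "Dom C f = Dom C g" "Cod C f = zeroO C" "Cod C g = zeroO C"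
  shows "f = g"
  using assms terminal[of "Dom C f"] by auto

lemma eq_from_zero:
  assumes "f \<in> Arr C" "g \<in> Arr C" "Cod C f = Cod C g" "Dom C f = zeroO C" "Dom C g = zeroO C"
  shows "f = g"
  using assms initial[of "Cod C f"] by auto

lemma zero_arrow_arr [simp]:
  assumes "A \<in> Obj C" "B \<in> Obj C"
  shows "zero_arrow C A B \<in> Arr C" "Dom C (zero_arrow C A B) = A" "Cod C (zero_arrow C A B) = B"
  using assms by (simp_all add: zero_arrow_def)

lemma zero_arrow_comp [simp]:
  assumes "f \<in> Arr C" "Cod C f = A" "B \<in> Obj C"
  shows "zero_arrow C A B \<cdot> f = zero_arrow C (Dom C f) B"
proof -
  have "A \<in> Obj C" using assms by auto
  moreover have "to_zero C A \<cdot> f = to_zero C (Dom C f)"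
    using assms calculation by (intro eq_to_zero) auto
  ultimately show ?thesis using assms by (simp add: zero_arrow_def)
qed

lemma comp_zero_arrow [simp]:
  assumes "f \<in> Arr C" "Dom C f = B" "A \<in> Obj C"
  shows "f \<cdot> zero_arrow C A B = zero_arrow C A (Cod C f)"
proof -
  have "B \<in> Obj C" using assms by auto
  moreover have "f \<cdot> from_zero C B = from_zero C (Cod C f)"
    using assms calculation by (intro eq_from_zero) auto
  ultimately show ?thesis using assms by (simp add: zero_arrow_def flip: comp_assoc)
qed

lemma zero_arrow_zeroO [simp]: "zero_arrow C (zeroO C) (zeroO C) = ident C (zeroO C)"
  by (rule eq_to_zero) auto

lemma biprod_Obj [simp]: "A \<in> Obj C \<Longrightarrow> B \<in> Obj C \<Longrightarrow> A \<boxplus> B \<in> Obj C"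
  by (rule biprod_in_Obj)

lemma biprod_maps_arr [simp]:
  assumes "A \<in> Obj C" "B \<in> Obj C"
  shows "injl C A B \<in> Arr C" "Dom C (injl C A B) = A" "Cod C (injl C A B) = A \<boxplus> B"
    "injr C A B \<in> Arr C" "Dom C (injr C A B) = B" "Cod C (injr C A B) = A \<boxplus> B"
    "prjl C A B \<in> Arr C" "Dom C (prjl C A B) = A \<boxplus> B" "Cod C (prjl C A B) = A"
    "prjr C A B \<in> Arr C" "Dom C (prjr C A B) = A \<boxplus> B" "Cod C (prjr C A B) = B"
  using injl_in_Hom[OF assms] injr_in_Hom[OF assms] prjl_in_Hom[OF assms] prjr_in_Hom[OF assms]
  by simp_all

declare prjl_injl [simp] prjr_injr [simp] prjl_injr [simp] prjr_injl [simp]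

lemma prj_inj_comp [simp]:
  assumes "A \<in> Obj C" "B \<in> Obj C" "f \<in> Arr C"
  shows "Cod C f = A \<Longrightarrow> prjl C A B \<cdot> injl C A B \<cdot> f = f"
    "Cod C f = B \<Longrightarrow> prjr C A B \<cdot> injr C A B \<cdot> f = f"
    "Cod C f = B \<Longrightarrow> prjl C A B \<cdot> injr C A B \<cdot> f = zero_arrow C (Dom C f) A"
    "Cod C f = A \<Longrightarrow> prjr C A B \<cdot> injl C A B \<cdot> f = zero_arrow C (Dom C f) B"
  using assms by (simp_all flip: comp_assoc)

lemma pairing_spec:
  assumes "f \<in> Arr C" "g \<in> Arr C" "Dom C f = Dom C g"
  shows "pairing C f g \<in> Hom C (Dom C f) (Cod C f \<boxplus> Cod C g) \<and>
     prjl C (Cod C f) (Cod C g) \<cdot> pairing C f g = f \<and> prjr C (Cod C f) (Cod C g) \<cdot> pairing C f g = g"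
  unfolding pairing_def
  by (rule theI'[OF product]) (use assms in simp_all)

lemma pairing_arr [simp]:
  assumes "f \<in> Arr C" "g \<in> Arr C" "Dom C f = Dom C g"
  shows "pairing C f g \<in> Arr C" "Dom C (pairing C f g) = Dom C g"
    "Cod C (pairing C f g) = Cod C f \<boxplus> Cod C g"
  using pairing_spec[OF assms] assms(3) by simp_all

lemma prj_pairing [simp]:
  assumes "f \<in> Arr C" "g \<in> Arr C" "Dom C f = Dom C g" "Cod C f = A" "Cod C g = B"
  shows "prjl C A B \<cdot> pairing C f g = f" "prjr C A B \<cdot> pairing C f g = g"
  using pairing_spec[OF assms(1-3)] assms(4,5) by simp_all

lemma pairing_eqI:
  assumes "f \<in> Arr C" "g \<in> Arr C" "Dom C f = Dom C g" "Cod C f = A \<boxplus> B" "Cod C g = A \<boxplus> B"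
    and "A \<in> Obj C" "B \<in> Obj C"
    and "prjl C A B \<cdot> f = prjl C A B \<cdot> g" "prjr C A B \<cdot> f = prjr C A B \<cdot> g"
  shows "f = g"
  using product[of "prjl C A B \<cdot> g" "Dom C g" A "prjr C A B \<cdot> g" B] assms by auto

lemma pairing_comp [simp]:
  assumes "f \<in> Arr C" "g \<in> Arr C" "Dom C f = Dom C g" "h \<in> Arr C" "Cod C h = Dom C g"
  shows "pairing C f g \<cdot> h = pairing C (f \<cdot> h) (g \<cdot> h)"
  by (rule pairing_eqI[of _ _ "Cod C f" "Cod C g"]) (use assms in \<open>simp_all flip: comp_assoc\<close>)

lemma pairing_prj [simp]:
  "A \<in> Obj C \<Longrightarrow> B \<in> Obj C \<Longrightarrow> pairing C (prjl C A B) (prjr C A B) = ident C (A \<boxplus> B)"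
  by (rule pairing_eqI[of _ _ A B]) simp_all

lemma pairing_zero [simp]:
  assumes "X \<in> Obj C" "A \<in> Obj C" "B \<in> Obj C"
  shows "pairing C (zero_arrow C X A) (zero_arrow C X B) = zero_arrow C X (A \<boxplus> B)"
  by (rule pairing_eqI[of _ _ A B]) (use assms in simp_all)

text \<open>Passes between the coproduct and the product side of a biproduct: an injected arrow is a
  tuple with a zero entry.\<close>

lemma inj_comp_pairing:
  assumes "A \<in> Obj C" "B \<in> Obj C" "f \<in> Arr C"
  shows "Cod C f = A \<Longrightarrow> injl C A B \<cdot> f = pairing C f (zero_arrow C (Dom C f) B)"
    "Cod C f = B \<Longrightarrow> injr C A B \<cdot> f = pairing C (zero_arrow C (Dom C f) A) f"
  by (rule pairing_eqI[of _ _ A B]; use assms in simp)+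

lemma copairing_spec:
  assumes "f \<in> Arr C" "g \<in> Arr C" "Cod C f = Cod C g"
  shows "copairing C f g \<in> Hom C (Dom C f \<boxplus> Dom C g) (Cod C f) \<and>
     copairing C f g \<cdot> injl C (Dom C f) (Dom C g) = f \<and> copairing C f g \<cdot> injr C (Dom C f) (Dom C g) = g"
  unfolding copairing_def
  by (rule theI'[OF coproduct]) (use assms in simp_all)

lemma copairing_arr [simp]:
  assumes "f \<in> Arr C" "g \<in> Arr C" "Cod C f = Cod C g"
  shows "copairing C f g \<in> Arr C" "Cod C (copairing C f g) = Cod C g"
    "Dom C (copairing C f g) = Dom C f \<boxplus> Dom C g"
  using copairing_spec[OF assms] assms(3) by simp_all

lemma copairing_inj [simp]:
  assumes "f \<in> Arr C" "g \<in> Arr C" "Cod C f = Cod C g" "Dom C f = A" "Dom C g = B"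
  shows "copairing C f g \<cdot> injl C A B = f" "copairing C f g \<cdot> injr C A B = g"
  using copairing_spec[OF assms(1-3)] assms(4,5) by simp_all

lemma copairing_inj_comp [simp]:
  assumes "f \<in> Arr C" "g \<in> Arr C" "Cod C f = Cod C g" "Dom C f = A" "Dom C g = B" "h \<in> Arr C"
  shows "Cod C h = A \<Longrightarrow> copairing C f g \<cdot> injl C A B \<cdot> h = f \<cdot> h"
    "Cod C h = B \<Longrightarrow> copairing C f g \<cdot> injr C A B \<cdot> h = g \<cdot> h"
  using assms by (auto simp flip: comp_assoc)

lemma copairing_eqI:
  assumes "f \<in> Arr C" "g \<in> Arr C" "Cod C f = Cod C g" "Dom C f = A \<boxplus> B" "Dom C g = A \<boxplus> B"
    and "A \<in> Obj C" "B \<in> Obj C"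
    and "f \<cdot> injl C A B = g \<cdot> injl C A B" "f \<cdot> injr C A B = g \<cdot> injr C A B"
  shows "f = g"
  using coproduct[of "g \<cdot> injl C A B" A "Cod C g" "g \<cdot> injr C A B" B] assms by auto

lemma biprod_arrow_arr [simp]:
  assumes "f \<in> Arr C" "g \<in> Arr C"
  shows "biprod_arrow C f g \<in> Arr C" "Dom C (biprod_arrow C f g) = Dom C f \<boxplus> Dom C g"
    "Cod C (biprod_arrow C f g) = Cod C f \<boxplus> Cod C g"
  using assms by (simp_all add: biprod_arrow_def)

lemma prj_biprod_arrow [simp]:
  assumes "f \<in> Arr C" "g \<in> Arr C" "Cod C f = A" "Cod C g = B"
  shows "prjl C A B \<cdot> biprod_arrow C f g = f \<cdot> prjl C (Dom C f) (Dom C g)"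
    "prjr C A B \<cdot> biprod_arrow C f g = g \<cdot> prjr C (Dom C f) (Dom C g)"
  using assms by (simp_all add: biprod_arrow_def)

lemma prj_biprod_arrow_comp [simp]:
  assumes "f \<in> Arr C" "g \<in> Arr C" "Cod C f = A" "Cod C g = B"
    "h \<in> Arr C" "Cod C h = Dom C f \<boxplus> Dom C g"
  shows "prjl C A B \<cdot> biprod_arrow C f g \<cdot> h = f \<cdot> prjl C (Dom C f) (Dom C g) \<cdot> h"
    "prjr C A B \<cdot> biprod_arrow C f g \<cdot> h = g \<cdot> prjr C (Dom C f) (Dom C g) \<cdot> h"
  using assms by (auto simp: biprod_arrow_def)

lemma biprod_arrow_pairing [simp]:
  assumes "f \<in> Arr C" "g \<in> Arr C" "h \<in> Arr C" "k \<in> Arr C" "Dom C h = Dom C k"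
    "Cod C h = Dom C f" "Cod C k = Dom C g"
  shows "biprod_arrow C f g \<cdot> pairing C h k = pairing C (f \<cdot> h) (g \<cdot> k)"
  using assms by (simp add: biprod_arrow_def)

lemma biprod_arrow_inj [simp]:
  assumes "f \<in> Arr C" "g \<in> Arr C" "Dom C f = A" "Dom C g = B"
  shows "biprod_arrow C f g \<cdot> injl C A B = injl C (Cod C f) (Cod C g) \<cdot> f"
    "biprod_arrow C f g \<cdot> injr C A B = injr C (Cod C f) (Cod C g) \<cdot> g"
  by (rule pairing_eqI[of _ _ "Cod C f" "Cod C g"]; use assms in auto)+

lemma biprod_arrow_inj_comp [simp]:
  assumes "f \<in> Arr C" "g \<in> Arr C" "Dom C f = A" "Dom C g = B" "h \<in> Arr C"
  shows "Cod C h = A \<Longrightarrow>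
      biprod_arrow C f g \<cdot> injl C A B \<cdot> h = injl C (Cod C f) (Cod C g) \<cdot> f \<cdot> h"
    "Cod C h = B \<Longrightarrow>
      biprod_arrow C f g \<cdot> injr C A B \<cdot> h = injr C (Cod C f) (Cod C g) \<cdot> g \<cdot> h"
proof -
  have "A \<in> Obj C" "B \<in> Obj C" using assms by auto
  then show "Cod C h = A \<Longrightarrow>
      biprod_arrow C f g \<cdot> injl C A B \<cdot> h = injl C (Cod C f) (Cod C g) \<cdot> f \<cdot> h"
    "Cod C h = B \<Longrightarrow>
      biprod_arrow C f g \<cdot> injr C A B \<cdot> h = injr C (Cod C f) (Cod C g) \<cdot> g \<cdot> h"
    using assms by (simp_all flip: comp_assoc)
qed

lemma biprod_arrow_comp:
  assumes "f \<in> Arr C" "f' \<in> Arr C" "g \<in> Arr C" "g' \<in> Arr C" "Dom C f' = Cod C f" "Dom C g' = Cod C g"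
  shows "biprod_arrow C f' g' \<cdot> biprod_arrow C f g = biprod_arrow C (f' \<cdot> f) (g' \<cdot> g)"
  by (rule pairing_eqI[of _ _ "Cod C f'" "Cod C g'"]) (use assms in simp_all)

lemma biprod_arrow_ident [simp]:
  "A \<in> Obj C \<Longrightarrow> B \<in> Obj C \<Longrightarrow> biprod_arrow C (ident C A) (ident C B) = ident C (A \<boxplus> B)"
  by (simp add: biprod_arrow_def)

lemma iso_biprod_arrow [simp]:
  assumes "isomorphism C f" "isomorphism C g"
  shows "isomorphism C (biprod_arrow C f g)"
  by (rule isomorphismI[of _ "biprod_arrow C (inv_arrow C f) (inv_arrow C g)"];
      use assms isomorphism_arr in \<open>simp add: biprod_arrow_comp\<close>)

lemma diagonal_arr [simp]:
  assumes "A \<in> Obj C"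
  shows "diagonal C A \<in> Arr C" "Dom C (diagonal C A) = A" "Cod C (diagonal C A) = A \<boxplus> A"
  using assms by (simp_all add: diagonal_def)

lemma codiagonal_arr [simp]:
  assumes "A \<in> Obj C"
  shows "codiagonal C A \<in> Arr C" "Dom C (codiagonal C A) = A \<boxplus> A" "Cod C (codiagonal C A) = A"
  using assms by (simp_all add: codiagonal_def)

lemma codiagonal_inj [simp]:
  assumes "A \<in> Obj C"
  shows "codiagonal C A \<cdot> injl C A A = ident C A" "codiagonal C A \<cdot> injr C A A = ident C A"
  using assms by (simp_all add: codiagonal_def)

lemma codiagonal_inj_comp [simp]:
  assumes "A \<in> Obj C" "f \<in> Arr C" "Cod C f = A"
  shows "codiagonal C A \<cdot> injl C A A \<cdot> f = f" "codiagonal C A \<cdot> injr C A A \<cdot> f = f"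
  using assms by (simp_all add: codiagonal_def)

section \<open>Addition of arrows\<close>

lemma add_arrow_pairing:
  assumes "f \<in> Arr C" "g \<in> Arr C" "Dom C f = Dom C g" "Cod C f = Cod C g"
  shows "add_arrow C f g = codiagonal C (Cod C g) \<cdot> pairing C f g"
  using assms by (simp add: add_arrow_def diagonal_def)

lemma add_arrow_arr [simp]:
  assumes "f \<in> Arr C" "g \<in> Arr C" "Dom C f = Dom C g" "Cod C f = Cod C g"
  shows "add_arrow C f g \<in> Arr C" "Dom C (add_arrow C f g) = Dom C g"
    "Cod C (add_arrow C f g) = Cod C g"
  using assms by (simp_all add: add_arrow_pairing)

text \<open>Both sides restrict to \<open>f\<close> along each injection.\<close>

lemma codiagonal_natural:
  assumes "f \<in> Arr C"
  shows "codiagonal C (Cod C f) \<cdot> biprod_arrow C f f = f \<cdot> codiagonal C (Dom C f)"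
  by (rule copairing_eqI[of _ _ "Dom C f" "Dom C f"]) (use assms in simp_all)

text \<open>Postcomposition passes through the codiagonal by naturality; precomposition simply
  enters the pairing.\<close>

lemma comp_add_arrow:
  assumes "f \<in> Arr C" "g \<in> Arr C" "Dom C f = Dom C g" "Cod C f = Cod C g" "h \<in> Arr C" "Dom C h = Cod C g"
  shows "h \<cdot> add_arrow C f g = add_arrow C (h \<cdot> f) (h \<cdot> g)"
proof -
  have "h \<cdot> add_arrow C f g = (h \<cdot> codiagonal C (Dom C h)) \<cdot> pairing C f g"
    using assms by (simp add: add_arrow_pairing)
  also have "\<dots> = (codiagonal C (Cod C h) \<cdot> biprod_arrow C h h) \<cdot> pairing C f g"
    using assms by (simp only: codiagonal_natural)
  also have "\<dots> = add_arrow C (h \<cdot> f) (h \<cdot> g)"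
    using assms by (simp add: add_arrow_pairing)
  finally show ?thesis .
qed

lemma add_arrow_comp:
  assumes "f \<in> Arr C" "g \<in> Arr C" "Dom C f = Dom C g" "Cod C f = Cod C g" "h \<in> Arr C" "Cod C h = Dom C g"
  shows "add_arrow C f g \<cdot> h = add_arrow C (f \<cdot> h) (g \<cdot> h)"
  using assms by (simp add: add_arrow_pairing)

lemma add_zero_arrow [simp]:
  assumes "f \<in> Arr C" "Dom C f = A" "Cod C f = B"
  shows "add_arrow C f (zero_arrow C A B) = f" "add_arrow C (zero_arrow C A B) f = f"
proof -
  have "A \<in> Obj C" "B \<in> Obj C" using assms by auto
  then show "add_arrow C f (zero_arrow C A B) = f" "add_arrow C (zero_arrow C A B) f = f"
    using assms inj_comp_pairing[of B B f, symmetric] by (simp_all add: add_arrow_pairing)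
qed

text \<open>After either projection one of the two summands vanishes. This is the seed of all
  decompositions of identities through 1.\<close>

lemma biprod_resolution:
  assumes "A \<in> Obj C" "B \<in> Obj C"
  shows "ident C (A \<boxplus> B) = add_arrow C (injl C A B \<cdot> prjl C A B) (injr C A B \<cdot> prjr C A B)"
  by (rule pairing_eqI[of _ _ A B]) (use assms in \<open>simp_all add: comp_add_arrow\<close>)

end

section \<open>Tensor products and points\<close>

context symmetric_monoidal_category
begin

lemma unitO_Obj [simp]: "unitO C \<in> Obj C"
  by (rule unitO_in_Obj)

lemma tensor_Obj [simp]: "A \<in> Obj C \<Longrightarrow> B \<in> Obj C \<Longrightarrow> A \<boxtimes> B \<in> Obj C"
  by (rule tensor_in_Obj)

lemma tensor_arrow_arr [simp]:
  assumes "f \<in> Arr C" "g \<in> Arr C"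
  shows "tensor_arrow C f g \<in> Arr C" "Dom C (tensor_arrow C f g) = Dom C f \<boxtimes> Dom C g"
    "Cod C (tensor_arrow C f g) = Cod C f \<boxtimes> Cod C g"
  using tensor_arrow_in_Hom[of f "Dom C f" "Cod C f" g "Dom C g" "Cod C g"] assms by simp_all

declare tensor_ident [simp]

lemma tensor_arrow_comp [simp]:
  assumes "f \<in> Arr C" "f' \<in> Arr C" "g \<in> Arr C" "g' \<in> Arr C" "Dom C f' = Cod C f" "Dom C g' = Cod C g"
  shows "tensor_arrow C f' g' \<cdot> tensor_arrow C f g = tensor_arrow C (f' \<cdot> f) (g' \<cdot> g)"
  using tensor_compose[of f "Dom C f" "Cod C f" f' "Cod C f'" g "Dom C g" "Cod C g" g' "Cod C g'"] assms
  by simp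

lemma tensor_arrow_comp_comp [simp]:
  assumes "f \<in> Arr C" "f' \<in> Arr C" "g \<in> Arr C" "g' \<in> Arr C" "Dom C f' = Cod C f" "Dom C g' = Cod C g"
    "h \<in> Arr C" "Cod C h = Dom C f \<boxtimes> Dom C g"
  shows "tensor_arrow C f' g' \<cdot> tensor_arrow C f g \<cdot> h = tensor_arrow C (f' \<cdot> f) (g' \<cdot> g) \<cdot> h"
  using assms by (simp flip: comp_assoc)

lemma iso_tensor_arrow [simp]:
  assumes "isomorphism C f" "isomorphism C g"
  shows "isomorphism C (tensor_arrow C f g)"
  by (rule isomorphismI[of _ "tensor_arrow C (inv_arrow C f) (inv_arrow C g)"];
      use assms isomorphism_arr in simp)

declare tensor_assoc_iso [simp] tensor_lunit_iso [simp] tensor_runit_iso [simp]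

lemma tensor_maps_arr [simp]:
  assumes "A \<in> Obj C"
  shows "tensor_lunit C A \<in> Arr C" "Dom C (tensor_lunit C A) = unitO C \<boxtimes> A" "Cod C (tensor_lunit C A) = A"
    "tensor_runit C A \<in> Arr C" "Dom C (tensor_runit C A) = A \<boxtimes> unitO C" "Cod C (tensor_runit C A) = A"
  using tensor_lunit_in_Hom[OF assms] tensor_runit_in_Hom[OF assms] by simp_all

lemma tensor_symm_arr [simp]:
  assumes "A \<in> Obj C" "B \<in> Obj C"
  shows "tensor_symm C A B \<in> Arr C" "Dom C (tensor_symm C A B) = A \<boxtimes> B"
    "Cod C (tensor_symm C A B) = B \<boxtimes> A"
  using tensor_symm_in_Hom[OF assms] by simp_all

lemma tensor_assoc_arr [simp]:
  assumes "A \<in> Obj C" "B \<in> Obj C" "D \<in> Obj C"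
  shows "tensor_assoc C A B D \<in> Arr C" "Dom C (tensor_assoc C A B D) = (A \<boxtimes> B) \<boxtimes> D"
    "Cod C (tensor_assoc C A B D) = A \<boxtimes> B \<boxtimes> D"
  using tensor_assoc_in_Hom[OF assms] by simp_all

lemma lunit_natural:
  "f \<in> Arr C \<Longrightarrow> tensor_lunit C (Cod C f) \<cdot> tensor_arrow C (ident C (unitO C)) f = f \<cdot> tensor_lunit C (Dom C f)"
  by (rule tensor_lunit_natural) simp

lemma runit_natural:
  "f \<in> Arr C \<Longrightarrow> tensor_runit C (Cod C f) \<cdot> tensor_arrow C f (ident C (unitO C)) = f \<cdot> tensor_runit C (Dom C f)"
  by (rule tensor_runit_natural) simp

lemma assoc_natural:
  "f \<in> Arr C \<Longrightarrow> g \<in> Arr C \<Longrightarrow> h \<in> Arr C \<Longrightarrow>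
    tensor_assoc C (Cod C f) (Cod C g) (Cod C h) \<cdot> tensor_arrow C (tensor_arrow C f g) h =
    tensor_arrow C f (tensor_arrow C g h) \<cdot> tensor_assoc C (Dom C f) (Dom C g) (Dom C h)"
  by (rule tensor_assoc_natural) simp_all

lemma symm_natural:
  "f \<in> Arr C \<Longrightarrow> g \<in> Arr C \<Longrightarrow>
    tensor_symm C (Cod C f) (Cod C g) \<cdot> tensor_arrow C f g =
    tensor_arrow C g f \<cdot> tensor_symm C (Dom C f) (Dom C g)"
  by (rule tensor_symm_natural) simp_all

section \<open>Coherence at the tensor unit\<close>

lemma tensor_unit_cancel:
  assumes "tensor_arrow C (ident C (unitO C)) f = tensor_arrow C (ident C (unitO C)) g"
    "f \<in> Arr C" "g \<in> Arr C" "Dom C f = Dom C g" "Cod C f = Cod C g"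
  shows "f = g"
  by (rule iso_epi[of f "tensor_lunit C (Dom C f)"])
    (use assms lunit_natural[of f] lunit_natural[of g] in simp_all)

lemma tensor_unit_cancel_right:
  assumes "tensor_arrow C f (ident C (unitO C)) = tensor_arrow C g (ident C (unitO C))"
    "f \<in> Arr C" "g \<in> Arr C" "Dom C f = Dom C g" "Cod C f = Cod C g"
  shows "f = g"
  by (rule iso_epi[of f "tensor_runit C (Dom C f)"])
    (use assms runit_natural[of f] runit_natural[of g] in simp_all)

text \<open>Kelly's argument that pentagon and triangle imply this law: tensoring with 1 on the left
  is faithful by naturality of the unitor, and the tensored equation is read off the pentagon at
  \<open>1, 1, A, B\<close>.\<close>

lemma lunit_assoc:
  assumes A: "A \<in> Obj C" and B: "B \<in> Obj C"
  shows "tensor_lunit C (A \<boxtimes> B) \<cdot> tensor_assoc C (unitO C) A B = tensor_arrow C (tensor_lunit C A) (ident C B)"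
proof -
  let ?I = "unitO C"
  let ?i = "ident C ?I"
  \<comment> \<open>The first two arrows on the long side of that pentagon; they are invertible and
    get cancelled at the end.\<close>
  let ?h = "tensor_assoc C ?I (?I \<boxtimes> A) B \<cdot> tensor_arrow C (tensor_assoc C ?I ?I A) (ident C B)"
  have "tensor_arrow C ?i (tensor_lunit C (A \<boxtimes> B) \<cdot> tensor_assoc C ?I A B) \<cdot> ?h =
      tensor_arrow C ?i (tensor_lunit C (A \<boxtimes> B)) \<cdot>
        (tensor_arrow C ?i (tensor_assoc C ?I A B) \<cdot> ?h)"
    using A B by simp
  also have "\<dots> = (tensor_arrow C ?i (tensor_lunit C (A \<boxtimes> B)) \<cdot> tensor_assoc C ?I ?I (A \<boxtimes> B)) \<cdot>
      tensor_assoc C (?I \<boxtimes> ?I) A B"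
    using A B pentagon[of ?I ?I A B] by simp
  also have "\<dots> = tensor_arrow C (tensor_runit C ?I) (tensor_arrow C (ident C A) (ident C B)) \<cdot>
      tensor_assoc C (?I \<boxtimes> ?I) A B"
    using A B triangle[of ?I "A \<boxtimes> B"] by simp
  also have "\<dots> = tensor_assoc C ?I A B \<cdot>
      tensor_arrow C (tensor_arrow C (tensor_runit C ?I) (ident C A)) (ident C B)"
    using A B assoc_natural[of "tensor_runit C ?I" "ident C A" "ident C B"] by simp
  also have "\<dots> = tensor_assoc C ?I A B \<cdot>
      tensor_arrow C (tensor_arrow C ?i (tensor_lunit C A) \<cdot> tensor_assoc C ?I ?I A) (ident C B)"
    using A by (simp only: triangle[of ?I A] unitO_Obj)
  also have "\<dots> = (tensor_assoc C ?I A B \<cdot>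
      tensor_arrow C (tensor_arrow C ?i (tensor_lunit C A)) (ident C B)) \<cdot>
      tensor_arrow C (tensor_assoc C ?I ?I A) (ident C B)"
    using A B by simp
  also have "\<dots> = tensor_arrow C ?i (tensor_arrow C (tensor_lunit C A) (ident C B)) \<cdot> ?h"
    using A B assoc_natural[of ?i "tensor_lunit C A" "ident C B"] by simp
  finally show ?thesis
    by (rule tensor_unit_cancel[OF iso_epi[of _ ?h]]) (use A B in simp_all)
qed

text \<open>Naturality of the left unitor at itself gives \<open>\<lambda>\<close> at
  \<open>1 \<otimes> 1\<close> as \<open>1 \<otimes> \<lambda>\<close>. Then
  \<open>lunit_assoc\<close> and the triangle compute the same arrow, once with each unitor.\<close>

lemma lunit_eq_runit: "tensor_lunit C (unitO C) = tensor_runit C (unitO C)"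
proof (rule tensor_unit_cancel_right)
  let ?I = "unitO C"
  let ?i = "ident C ?I"
  have "tensor_lunit C (?I \<boxtimes> ?I) = tensor_arrow C ?i (tensor_lunit C ?I)"
    by (rule iso_mono[of "tensor_lunit C ?I"]) (use lunit_natural[of "tensor_lunit C ?I"] in simp_all)
  then show "tensor_arrow C (tensor_lunit C ?I) ?i = tensor_arrow C (tensor_runit C ?I) ?i"
    using lunit_assoc[of ?I ?I] triangle[of ?I ?I] by simp
qed simp_all

text \<open>A scalar may enter either factor of \<open>1 \<otimes> 1\<close>. The second form
  depends on the two unitors agreeing at 1.\<close>

lemma lunit_endo:
  assumes "k \<in> Arr C" "Dom C k = unitO C" "Cod C k = unitO C"
  shows "tensor_lunit C (unitO C) \<cdot> tensor_arrow C (ident C (unitO C)) k = k \<cdot> tensor_lunit C (unitO C)"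
    "tensor_lunit C (unitO C) \<cdot> tensor_arrow C k (ident C (unitO C)) = k \<cdot> tensor_lunit C (unitO C)"
  using assms lunit_natural[of k] runit_natural[of k] by (simp_all add: lunit_eq_runit)

text \<open>
  Writing \<open>k\<close> for the scalar of the symmetry of the unit, the hexagon at the unit says \<open>k = k \<cdot> k\<close>.
\<close>

lemma symm_unit: "tensor_symm C (unitO C) (unitO C) = ident C (unitO C \<boxtimes> unitO C)"
proof -
  let ?I = "unitO C"
  let ?i = "ident C ?I"
  let ?l = "tensor_lunit C ?I"
  let ?s = "tensor_symm C ?I ?I"
  let ?a = "tensor_assoc C ?I ?I ?I"
  define k where "k = ?l \<cdot> ?s \<cdot> inv_arrow C ?l"
  have k: "k \<in> Arr C" "Dom C k = ?I" "Cod C k = ?I" by (simp_all add: k_def)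
  have ss: "?s \<cdot> ?s = ident C (?I \<boxtimes> ?I)" by (rule tensor_symm_inverse) simp_all
  have ssc: "?s \<cdot> ?s \<cdot> g = g" if "g \<in> Arr C" "Cod C g = ?I \<boxtimes> ?I" for g
    using that by (simp add: ss flip: comp_assoc)
  have iso_s: "isomorphism C ?s" by (rule isomorphismI[of _ ?s]) (simp_all add: ss)
  have iso_k: "isomorphism C k" by (simp add: k_def iso_s)
  have ls: "?l \<cdot> ?s = k \<cdot> ?l" by (simp add: k_def)
  have la: "tensor_arrow C ?i ?l \<cdot> ?a = tensor_arrow C ?l ?i"
    using triangle[of ?I ?I] by (simp add: lunit_eq_runit)
  have lac: "tensor_arrow C ?i ?l \<cdot> ?a \<cdot> g = tensor_arrow C ?l ?i \<cdot> g"
    if "g \<in> Arr C" "Cod C g = (?I \<boxtimes> ?I) \<boxtimes> ?I" for g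
    using that by (simp add: la flip: comp_assoc)
  have nat: "tensor_arrow C ?l ?i \<cdot> tensor_symm C ?I (?I \<boxtimes> ?I) = ?s \<cdot> tensor_arrow C ?i ?l"
    using symm_natural[of ?i ?l] by simp
  \<comment> \<open>The side of the hexagon with a single symmetry, collapsed to 1 by unitors: one
    factor \<open>k\<close> appears.\<close>
  have "?l \<cdot> tensor_arrow C ?i ?l \<cdot> ?a \<cdot> tensor_symm C ?I (?I \<boxtimes> ?I) \<cdot> ?a =
      ?l \<cdot> (tensor_arrow C ?l ?i \<cdot> tensor_symm C ?I (?I \<boxtimes> ?I)) \<cdot> ?a"
    by (simp add: lac)
  also have "\<dots> = (?l \<cdot> ?s) \<cdot> tensor_arrow C ?i ?l \<cdot> ?a" by (simp add: nat)
  also have "\<dots> = k \<cdot> ?l \<cdot> tensor_arrow C ?l ?i" using k by (simp add: ls la)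
  finally have 1: "?l \<cdot> tensor_arrow C ?i ?l \<cdot> ?a \<cdot> tensor_symm C ?I (?I \<boxtimes> ?I) \<cdot> ?a =
    k \<cdot> ?l \<cdot> tensor_arrow C ?l ?i" .
  \<comment> \<open>The other side of the hexagon: each of its two symmetries contributes a factor
    \<open>k\<close>.\<close>
  have "?l \<cdot> tensor_arrow C ?i ?l \<cdot> tensor_arrow C ?i ?s \<cdot> ?a \<cdot> tensor_arrow C ?s ?i =
      ?l \<cdot> tensor_arrow C ?i (k \<cdot> ?l) \<cdot> ?a \<cdot> tensor_arrow C ?s ?i"
    by (simp add: ls)
  also have "\<dots> = (?l \<cdot> tensor_arrow C ?i k) \<cdot> (tensor_arrow C ?i ?l \<cdot> ?a \<cdot> tensor_arrow C ?s ?i)"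
    using k by simp
  also have "\<dots> = (k \<cdot> ?l) \<cdot> tensor_arrow C (k \<cdot> ?l) ?i"
    using k by (simp only: lunit_endo lac) (simp add: lac ls)
  also have "\<dots> = k \<cdot> (?l \<cdot> tensor_arrow C k ?i) \<cdot> tensor_arrow C ?l ?i" using k by simp
  also have "\<dots> = k \<cdot> k \<cdot> ?l \<cdot> tensor_arrow C ?l ?i" using k by (simp only: lunit_endo) simp
  finally have "k \<cdot> ?l \<cdot> tensor_arrow C ?l ?i = k \<cdot> k \<cdot> ?l \<cdot> tensor_arrow C ?l ?i"
    using 1 hexagon[of ?I ?I ?I] by simp
  then have kl: "?l \<cdot> tensor_arrow C ?l ?i = k \<cdot> ?l \<cdot> tensor_arrow C ?l ?i"
    by (rule iso_mono) (use k iso_k in simp_all)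
  have k1: "ident C ?I = k"
    by (rule iso_epi[of _ "?l \<cdot> tensor_arrow C ?l ?i"]) (use k kl in simp_all)
  have "?l \<cdot> ?s = ?l \<cdot> ident C (?I \<boxtimes> ?I)" using ls by (simp flip: k1)
  then show ?thesis by (rule iso_mono) simp_all
qed

section \<open>Tensor products of points\<close>

definition point_tensor :: "'m \<Rightarrow> 'm \<Rightarrow> 'm" (infixr "\<star>" 71) where
  "a \<star> b = tensor_arrow C a b \<cdot> inv_arrow C (tensor_lunit C (unitO C))"

abbreviation Pt :: "'o \<Rightarrow> 'm set" where
  "Pt A \<equiv> Hom C (unitO C) A"

lemma point_tensor_arr [simp]:
  assumes "a \<in> Arr C" "b \<in> Arr C" "Dom C a = unitO C" "Dom C b = unitO C"
  shows "a \<star> b \<in> Arr C" "Dom C (a \<star> b) = unitO C" "Cod C (a \<star> b) = Cod C a \<boxtimes> Cod C b"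
  using assms by (simp_all add: point_tensor_def)

lemma tensor_arrow_point [simp]:
  assumes "a \<in> Arr C" "b \<in> Arr C" "Dom C a = unitO C" "Dom C b = unitO C"
    "f \<in> Arr C" "g \<in> Arr C" "Dom C f = Cod C a" "Dom C g = Cod C b"
  shows "tensor_arrow C f g \<cdot> (a \<star> b) = (f \<cdot> a) \<star> (g \<cdot> b)"
  using assms by (simp add: point_tensor_def)

text \<open>Naturality moves the symmetry to \<open>1 \<otimes> 1\<close>, where it is trivial by
  \<open>symm_unit\<close>.\<close>

lemma tensor_symm_point [simp]:
  assumes "a \<in> Pt A" "b \<in> Pt B"
  shows "tensor_symm C A B \<cdot> (a \<star> b) = b \<star> a"
proof -
  have "A \<in> Obj C" "B \<in> Obj C" using assms by auto
  then have "tensor_symm C A B \<cdot> (a \<star> b) = (tensor_symm C A B \<cdot> tensor_arrow C a b) \<cdot>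
      inv_arrow C (tensor_lunit C (unitO C))"
    using assms by (simp add: point_tensor_def)
  then show ?thesis
    using assms symm_natural[of a b] by (simp add: point_tensor_def symm_unit)
qed

text \<open>Naturality moves the associator to three copies of 1. There the triangle, with equal
  unitors, turns the inverse unitor on the left factor into the one on the right factor.\<close>

lemma tensor_assoc_point [simp]:
  assumes "a \<in> Pt A" "b \<in> Pt B" "d \<in> Pt D"
  shows "tensor_assoc C A B D \<cdot> ((a \<star> b) \<star> d) = a \<star> b \<star> d"
proof -
  let ?I = "unitO C"
  let ?i = "ident C ?I"
  let ?l = "tensor_lunit C ?I"
  let ?v = "inv_arrow C ?l"
  let ?a = "tensor_assoc C ?I ?I ?I"
  have objs: "A \<in> Obj C" "B \<in> Obj C" "D \<in> Obj C" using assms by auto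
  have "tensor_arrow C ?i ?l \<cdot> ?a \<cdot> tensor_arrow C ?v ?i =
      (tensor_arrow C ?i ?l \<cdot> ?a) \<cdot> tensor_arrow C ?v ?i" by simp
  also have "\<dots> = ident C (?I \<boxtimes> ?I)"
    by (simp add: triangle[of ?I ?I] flip: lunit_eq_runit)
  finally have "tensor_arrow C ?i ?v \<cdot> tensor_arrow C ?i ?l \<cdot> ?a \<cdot> tensor_arrow C ?v ?i =
    tensor_arrow C ?i ?v" by simp
  then have a: "?a \<cdot> tensor_arrow C ?v ?i = tensor_arrow C ?i ?v" by simp
  have split: "tensor_arrow C (f \<cdot> ?v) d = tensor_arrow C f d \<cdot> tensor_arrow C ?v ?i"
    "tensor_arrow C a (g \<cdot> ?v) = tensor_arrow C a g \<cdot> tensor_arrow C ?i ?v"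
    if "f \<in> Arr C" "Dom C f = ?I \<boxtimes> ?I" "g \<in> Arr C" "Dom C g = ?I \<boxtimes> ?I" for f g
    using that assms by simp_all
  have "tensor_assoc C A B D \<cdot> ((a \<star> b) \<star> d) =
      (tensor_assoc C A B D \<cdot> tensor_arrow C (tensor_arrow C a b) d) \<cdot> tensor_arrow C ?v ?i \<cdot> ?v"
    using assms objs by (simp add: point_tensor_def)
  also have "\<dots> = tensor_arrow C a (tensor_arrow C b d) \<cdot> (?a \<cdot> tensor_arrow C ?v ?i) \<cdot> ?v"
    using assms assoc_natural[of a b d] by simp
  also have "\<dots> = a \<star> b \<star> d"
    using assms by (simp add: a point_tensor_def)
  finally show ?thesis .
qed

end

context distributive_semiadditive_category
begin

section \<open>Bilinearity of the tensor\<close>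

lemma tensor_zeroO_right:
  assumes "A \<in> Obj C"
  shows "ident C (A \<boxtimes> zeroO C) = zero_arrow C (A \<boxtimes> zeroO C) (A \<boxtimes> zeroO C)"
proof -
  have iso: "isomorphism C (to_zero C (A \<boxtimes> zeroO C))"
    by (rule distributive_zero[OF assms])
  have "inv_arrow C (to_zero C (A \<boxtimes> zeroO C)) = from_zero C (A \<boxtimes> zeroO C)"
    by (rule eq_from_zero) (use assms iso in simp_all)
  with inv_arrow_comp(1)[OF iso] assms show ?thesis by (simp add: zero_arrow_def)
qed

text \<open>The arrow factors through \<open>Dom C f \<boxtimes> zeroO C\<close>, whose identity is
  already a zero arrow.\<close>

lemma tensor_zero_arrow_right [simp]:
  assumes "f \<in> Arr C" "A \<in> Obj C" "B \<in> Obj C"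
  shows "tensor_arrow C f (zero_arrow C A B) = zero_arrow C (Dom C f \<boxtimes> A) (Cod C f \<boxtimes> B)"
proof -
  have "tensor_arrow C f (zero_arrow C A B) =
      tensor_arrow C f (zero_arrow C (zeroO C) B) \<cdot> ident C (Dom C f \<boxtimes> zeroO C) \<cdot>
      tensor_arrow C (ident C (Dom C f)) (zero_arrow C A (zeroO C))"
    using assms by simp
  also have "\<dots> = zero_arrow C (Dom C f \<boxtimes> A) (Cod C f \<boxtimes> B)"
    unfolding tensor_zeroO_right[OF Dom_Obj[OF assms(1)]] using assms
    by (simp del: comp_ident ident_comp)
  finally show ?thesis .
qed

text \<open>Distributivity lifts the resolution of \<open>B \<boxplus> B\<close> to
  \<open>A \<boxtimes> (B \<boxplus> B)\<close>. Inserting it between the tensored codiagonal and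
  the tensored pairing splits the arrow into the two summands.\<close>

lemma tensor_add_arrow_right:
  assumes "f \<in> Arr C" "g \<in> Arr C" "h \<in> Arr C" "Dom C g = Dom C h" "Cod C g = Cod C h"
  shows "tensor_arrow C f (add_arrow C g h) = add_arrow C (tensor_arrow C f g) (tensor_arrow C f h)"
proof -
  let ?A = "Cod C f" and ?B = "Cod C h"
  have objs: "?A \<in> Obj C" "?B \<in> Obj C" using assms by simp_all
  let ?d = "pairing C (tensor_arrow C (ident C ?A) (prjl C ?B ?B)) (tensor_arrow C (ident C ?A) (prjr C ?B ?B))"
  have iso: "isomorphism C ?d" by (rule distributive_biprod) (use objs in simp_all)
  let ?e = "add_arrow C (tensor_arrow C (ident C ?A) (injl C ?B ?B \<cdot> prjl C ?B ?B))
    (tensor_arrow C (ident C ?A) (injr C ?B ?B \<cdot> prjr C ?B ?B))"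
  \<comment> \<open>The distributivity isomorphism is monic, and after it the two tensored
    projections decide equality.\<close>
  have e: "?e = ident C (?A \<boxtimes> (?B \<boxplus> ?B))"
    by (rule iso_mono[OF _ iso]) (use objs in \<open>simp_all add: comp_add_arrow add_arrow_comp\<close>,
      rule pairing_eqI[of _ _ "?A \<boxtimes> ?B" "?A \<boxtimes> ?B"], use objs in \<open>simp_all add: comp_add_arrow\<close>)
  have "tensor_arrow C f (add_arrow C g h) = tensor_arrow C (ident C ?A) (codiagonal C ?B) \<cdot>
      ?e \<cdot> tensor_arrow C f (pairing C g h)"
    unfolding e using assms by (simp add: add_arrow_pairing)
  also have "\<dots> = add_arrow C (tensor_arrow C f g) (tensor_arrow C f h)"
    using assms by (simp add: comp_add_arrow add_arrow_comp)
  finally show ?thesis .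
qed

text \<open>Conjugation by the symmetry carries statements about the right factor over to the left
  factor.\<close>

lemma tensor_arrow_flip:
  assumes "f \<in> Arr C" "g \<in> Arr C"
  shows "tensor_arrow C f g = tensor_symm C (Cod C g) (Cod C f) \<cdot> tensor_arrow C g f \<cdot>
    tensor_symm C (Dom C f) (Dom C g)"
proof -
  have "tensor_arrow C f g = tensor_arrow C f g \<cdot> tensor_symm C (Dom C g) (Dom C f) \<cdot> tensor_symm C (Dom C f) (Dom C g)"
    using assms tensor_symm_inverse by simp
  also have "\<dots> = (tensor_arrow C f g \<cdot> tensor_symm C (Dom C g) (Dom C f)) \<cdot> tensor_symm C (Dom C f) (Dom C g)"
    using assms by simp
  also have "\<dots> = (tensor_symm C (Cod C g) (Cod C f) \<cdot> tensor_arrow C g f) \<cdot> tensor_symm C (Dom C f) (Dom C g)"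
    using assms by (simp only: symm_natural)
  also have "\<dots> = tensor_symm C (Cod C g) (Cod C f) \<cdot> tensor_arrow C g f \<cdot> tensor_symm C (Dom C f) (Dom C g)"
    using assms by simp
  finally show ?thesis .
qed

lemma tensor_zero_arrow_left [simp]:
  assumes "f \<in> Arr C" "A \<in> Obj C" "B \<in> Obj C"
  shows "tensor_arrow C (zero_arrow C A B) f = zero_arrow C (A \<boxtimes> Dom C f) (B \<boxtimes> Cod C f)"
  by (subst tensor_arrow_flip) (use assms in simp_all)

lemma tensor_add_arrow_left:
  assumes "f \<in> Arr C" "g \<in> Arr C" "h \<in> Arr C" "Dom C g = Dom C h" "Cod C g = Cod C h"
  shows "tensor_arrow C (add_arrow C g h) f = add_arrow C (tensor_arrow C g f) (tensor_arrow C h f)"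
proof -
  let ?s = "tensor_symm C (Dom C h) (Dom C f)" and ?t = "tensor_symm C (Cod C f) (Cod C h)"
  have "tensor_arrow C (add_arrow C g h) f = ?t \<cdot> add_arrow C (tensor_arrow C f g) (tensor_arrow C f h) \<cdot> ?s"
    using assms by (subst tensor_arrow_flip) (simp_all add: tensor_add_arrow_right)
  also have "\<dots> = add_arrow C (?t \<cdot> tensor_arrow C f g \<cdot> ?s) (?t \<cdot> tensor_arrow C f h \<cdot> ?s)"
    using assms by (simp add: comp_add_arrow add_arrow_comp)
  also have "\<dots> = add_arrow C (tensor_arrow C g f) (tensor_arrow C h f)"
    using assms tensor_arrow_flip[of g f] tensor_arrow_flip[of h f] by simp
  finally show ?thesis .
qed

lemma point_tensor_zero [simp]:
  assumes "a \<in> Arr C" "Dom C a = unitO C" "B \<in> Obj C"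
  shows "a \<star> zero_arrow C (unitO C) B = zero_arrow C (unitO C) (Cod C a \<boxtimes> B)"
    "zero_arrow C (unitO C) B \<star> a = zero_arrow C (unitO C) (B \<boxtimes> Cod C a)"
  using assms by (simp_all add: point_tensor_def)

lemma point_tensor_add:
  assumes "a \<in> Pt A" "b \<in> Pt B" "b' \<in> Pt B"
  shows "a \<star> add_arrow C b b' = add_arrow C (a \<star> b) (a \<star> b')"
    "add_arrow C b b' \<star> a = add_arrow C (b \<star> a) (b' \<star> a)"
  using assms by (simp_all add: point_tensor_def tensor_add_arrow_right tensor_add_arrow_left add_arrow_comp)

end

section \<open>Resolutions of identities\<close>

context distributive_semiadditive_category
begin

text \<open>Finite sums of composites as an inductive closure, so that claims about sums become rule
  inductions over zero, one composite and addition, without indices or an order of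
  summation.\<close>

inductive_set arrow_span :: "'o \<Rightarrow> 'o \<Rightarrow> 'm set \<Rightarrow> 'm set \<Rightarrow> 'm set"
  for L H :: 'o and P Q :: "'m set" where
  zero: "zero_arrow C L H \<in> arrow_span L H P Q"
| comp: "p \<in> P \<Longrightarrow> q \<in> Q \<Longrightarrow> p \<cdot> q \<in> arrow_span L H P Q"
| add: "u \<in> arrow_span L H P Q \<Longrightarrow> v \<in> arrow_span L H P Q \<Longrightarrow> add_arrow C u v \<in> arrow_span L H P Q"

lemma arrow_span_mono:
  assumes "u \<in> arrow_span L H P Q" "P \<subseteq> P'" "Q \<subseteq> Q'"
  shows "u \<in> arrow_span L H P' Q'"
  using assms by induction (auto intro: arrow_span.intros)

lemma arrow_span_Hom:
  assumes "u \<in> arrow_span L H P Q" "L \<in> Obj C" "H \<in> Obj C" "P \<subseteq> Pt H" "Q \<subseteq> Hom C L (unitO C)"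
  shows "u \<in> Arr C" "Dom C u = L" "Cod C u = H"
proof -
  have "u \<in> Hom C L H"
    using assms(1)
  proof induction
    case (comp p q)
    then show ?case using subsetD[OF assms(4), of p] subsetD[OF assms(5), of q] by simp
  qed (use assms(2,3) in simp_all)
  then show "u \<in> Arr C" "Dom C u = L" "Cod C u = H" by simp_all
qed

text \<open>The analogue of a dual basis of a finitely generated projective module: \<open>P\<close>
  and \<open>Q\<close> supply the vectors and covectors of a sum that equals the identity, and no
  orthogonality is demanded.\<close>

definition resolves :: "'o \<Rightarrow> 'm set \<Rightarrow> 'm set \<Rightarrow> bool" where
  "resolves H P Q \<longleftrightarrow> H \<in> Obj C \<and> P \<subseteq> Pt H \<and> Q \<subseteq> Hom C H (unitO C) \<and>
    ident C H \<in> arrow_span H H P Q"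

lemma resolves_mono:
  assumes "resolves H P Q" "P \<subseteq> P'" "Q \<subseteq> Q'" "P' \<subseteq> Pt H" "Q' \<subseteq> Hom C H (unitO C)"
  shows "resolves H P' Q'"
  using assms arrow_span_mono unfolding resolves_def by blast

text \<open>Write \<open>f\<close> as \<open>f \<cdot> id\<close> and expand the identity: each
  summand meets \<open>f\<close> through some \<open>p\<close> in \<open>P\<close>.\<close>

lemma resolves_epi:
  assumes "resolves H P Q" "f \<in> Hom C H Z" "g \<in> Hom C H Z" "\<And>p. p \<in> P \<Longrightarrow> f \<cdot> p = g \<cdot> p"
  shows "f = g"
proof -
  have H: "H \<in> Obj C" "P \<subseteq> Pt H" "Q \<subseteq> Hom C H (unitO C)" and id: "ident C H \<in> arrow_span H H P Q"
    using assms(1) by (auto simp: resolves_def)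
  have "f \<cdot> u = g \<cdot> u" if "u \<in> arrow_span H H P Q" for u
    using that
  proof induction
    case zero
    show ?case using assms(2,3) H by simp
  next
    case (comp p q)
    then have "(f \<cdot> p) \<cdot> q = (g \<cdot> p) \<cdot> q" using assms(4) by simp
    moreover have "p \<in> Pt H" "q \<in> Hom C H (unitO C)" using comp H by auto
    ultimately show ?case using assms(2,3) by simp
  next
    case (add u v)
    then show ?case using assms(2,3) H arrow_span_Hom[OF add(1)] arrow_span_Hom[OF add(2)]
      by (simp add: comp_add_arrow)
  qed
  from this[OF id] show ?thesis using assms(2,3) by simp
qed

lemma resolves_zeroO: "resolves (zeroO C) {} {}"
  using arrow_span.zero[of "zeroO C" "zeroO C"] by (simp add: resolves_def)

lemma resolves_unitO: "resolves (unitO C) {ident C (unitO C)} {ident C (unitO C)}"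
  using arrow_span.comp[of "ident C (unitO C)" "{ident C (unitO C)}" "ident C (unitO C)" "{ident C (unitO C)}"]
  by (simp add: resolves_def)

text \<open>Transports a resolution along arrows; used to carry the resolutions of two summands into
  their biproduct.\<close>

lemma arrow_span_sandwich:
  assumes "u \<in> arrow_span L H P Q" "L \<in> Obj C" "H \<in> Obj C" "P \<subseteq> Pt H" "Q \<subseteq> Hom C L (unitO C)"
    and "h \<in> Hom C H H'" "k \<in> Hom C L' L"
  shows "h \<cdot> u \<cdot> k \<in> arrow_span L' H' ((\<lambda>p. h \<cdot> p) ` P) ((\<lambda>q. q \<cdot> k) ` Q)"
  using assms(1)
proof induction
  case zero
  show ?case using assms(2-) arrow_span.zero[of L' H'] by auto
next
  case (comp p q)
  then have "h \<cdot> (p \<cdot> q) \<cdot> k = (h \<cdot> p) \<cdot> (q \<cdot> k)"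
    using assms(2-) comp_arr comp_assoc by (auto simp: subset_iff)
  then show ?case using comp by (auto intro: arrow_span.comp)
next
  case (add u v)
  have "h \<cdot> add_arrow C u v \<cdot> k = add_arrow C (h \<cdot> u \<cdot> k) (h \<cdot> v \<cdot> k)"
    using arrow_span_Hom[OF add(1) assms(2-5)] arrow_span_Hom[OF add(2) assms(2-5)] assms(6,7)
    by (simp add: comp_add_arrow add_arrow_comp)
  then show ?case using add by (auto intro: arrow_span.add)
qed

lemma resolves_biprod:
  assumes "resolves H P Q" "resolves K P' Q'"
  shows "resolves (H \<boxplus> K)
    ((\<lambda>p. injl C H K \<cdot> p) ` P \<union> (\<lambda>p. injr C H K \<cdot> p) ` P')
    ((\<lambda>q. q \<cdot> prjl C H K) ` Q \<union> (\<lambda>q. q \<cdot> prjr C H K) ` Q')" (is "resolves _ ?P ?Q")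
proof -
  have H: "H \<in> Obj C" "P \<subseteq> Pt H" "Q \<subseteq> Hom C H (unitO C)" "ident C H \<in> arrow_span H H P Q"
    and K: "K \<in> Obj C" "P' \<subseteq> Pt K" "Q' \<subseteq> Hom C K (unitO C)" "ident C K \<in> arrow_span K K P' Q'"
    using assms by (auto simp: resolves_def)
  have "injl C H K \<cdot> ident C H \<cdot> prjl C H K \<in> arrow_span (H \<boxplus> K) (H \<boxplus> K) ?P ?Q"
    using H K by (intro arrow_span_mono[OF arrow_span_sandwich[OF H(4)]]) auto
  moreover have "injr C H K \<cdot> ident C K \<cdot> prjr C H K \<in> arrow_span (H \<boxplus> K) (H \<boxplus> K) ?P ?Q"
    using H K by (intro arrow_span_mono[OF arrow_span_sandwich[OF K(4)]]) auto
  ultimately have "ident C (H \<boxplus> K) \<in> arrow_span (H \<boxplus> K) (H \<boxplus> K) ?P ?Q"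
    using H(1) K(1) by (simp add: biprod_resolution arrow_span.add)
  then show ?thesis using H(1-3) K(1-3) by (auto simp: resolves_def)
qed

text \<open>Bilinearity expands the tensor of two identities, leaving \<open>1 \<otimes> 1\<close>
  in the middle of each term. The contraction \<open>w\<close> and its companion \<open>w'\<close>
  are parameters because two choices occur: the unitor, for pure tensors of points, and arrows
  denoted by diagrams, for fullness.\<close>

lemma resolves_tensor:
  assumes "resolves H P Q" "resolves K P' Q'"
    and w: "w \<in> Hom C (unitO C \<boxtimes> unitO C) (unitO C)" "w' \<in> Hom C (unitO C) (unitO C \<boxtimes> unitO C)"
      "w' \<cdot> w = ident C (unitO C \<boxtimes> unitO C)"
  shows "resolves (H \<boxtimes> K)
    {tensor_arrow C p p' \<cdot> w' | p p'. p \<in> P \<and> p' \<in> P'}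
    {w \<cdot> tensor_arrow C q q' | q q'. q \<in> Q \<and> q' \<in> Q'}" (is "resolves _ ?P ?Q")
proof -
  have H: "H \<in> Obj C" "P \<subseteq> Pt H" "Q \<subseteq> Hom C H (unitO C)" "ident C H \<in> arrow_span H H P Q"
    and K: "K \<in> Obj C" "P' \<subseteq> Pt K" "Q' \<subseteq> Hom C K (unitO C)" "ident C K \<in> arrow_span K K P' Q'"
    using assms by (auto simp: resolves_def)
  let ?S = "arrow_span (H \<boxtimes> K) (H \<boxtimes> K) ?P ?Q"
  have pq: "tensor_arrow C (p \<cdot> q) v \<in> ?S" if "p \<in> P" "q \<in> Q" and v: "v \<in> arrow_span K K P' Q'" for p q v
    using v
  proof induction
    case zero
    then show ?case using that H K arrow_span.zero[of "H \<boxtimes> K" "H \<boxtimes> K"] by (auto simp: subset_iff)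
  next
    case (comp p' q')
    have *: "p \<in> Pt H" "q \<in> Hom C H (unitO C)" "p' \<in> Pt K" "q' \<in> Hom C K (unitO C)"
      using that comp H K by auto
    \<comment> \<open>Inserting \<open>w' \<cdot> w\<close> in the middle makes the term factor
      through 1.\<close>
    have "tensor_arrow C (p \<cdot> q) (p' \<cdot> q') = tensor_arrow C p p' \<cdot> (w' \<cdot> w) \<cdot> tensor_arrow C q q'"
      unfolding w(3) using * by simp
    also have "\<dots> = (tensor_arrow C p p' \<cdot> w') \<cdot> (w \<cdot> tensor_arrow C q q')"
      using * w(1,2) by simp
    finally show ?case using that(1,2) comp by (auto intro!: arrow_span.comp)
  next
    case (add u v)
    then show ?case
      using that H K arrow_span_Hom[OF add(1)] arrow_span_Hom[OF add(2)]
      by (subst tensor_add_arrow_right) (auto intro: arrow_span.add simp: subset_iff)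
  qed
  have "tensor_arrow C u (ident C K) \<in> ?S" if u: "u \<in> arrow_span H H P Q" for u
    using u
  proof induction
    case zero
    then show ?case using H K arrow_span.zero[of "H \<boxtimes> K" "H \<boxtimes> K"] by auto
  next
    case (comp p q)
    then show ?case using pq K by blast
  next
    case (add u v)
    then show ?case
      using H K arrow_span_Hom[OF add(1)] arrow_span_Hom[OF add(2)]
      by (subst tensor_add_arrow_left) (auto intro: arrow_span.add)
  qed
  from this[OF H(4)] have "ident C (H \<boxtimes> K) \<in> ?S" using H(1) K(1) by simp
  moreover have "tensor_arrow C p p' \<cdot> w' \<in> Pt (H \<boxtimes> K)" if "p \<in> P" "p' \<in> P'" for p p'
    using subsetD[OF H(2) that(1)] subsetD[OF K(2) that(2)] w(2) by simp
  moreover have "w \<cdot> tensor_arrow C q q' \<in> Hom C (H \<boxtimes> K) (unitO C)" if "q \<in> Q" "q' \<in> Q'" for q q'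
    using subsetD[OF H(3) that(1)] subsetD[OF K(3) that(2)] w(1) by simp
  moreover have "H \<boxtimes> K \<in> Obj C" using H(1) K(1) by simp
  ultimately show ?thesis unfolding resolves_def by blast
qed

text \<open>With the largest possible sets, having a resolution becomes a property of the object
  alone.\<close>

abbreviation generated :: "'o \<Rightarrow> bool" where
  "generated H \<equiv> resolves H (Pt H) (Hom C H (unitO C))"

lemma generatedI: "resolves H P Q \<Longrightarrow> generated H"
  unfolding resolves_def using arrow_span_mono by blast

lemma generated_Obj: "generated H \<Longrightarrow> H \<in> Obj C"
  by (simp add: resolves_def)

section \<open>Partial points\<close>

text \<open>
  Since \<open>1 \<oplus> (H | K)\<close> is \<open>(1 \<oplus> H) \<otimes> (1 \<oplus> K)\<close>, the points of \<open>H | K\<close> are described by pairs of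
  partial points, where \<open>None\<close> stands for the point of the extra summand \<open>1\<close>.
\<close>

abbreviation act :: "'m \<Rightarrow> 'm option \<Rightarrow> 'm option" where
  "act f \<equiv> map_option (compose C f)"

definition PPt :: "'o \<Rightarrow> 'm option set" where
  "PPt H = insert None (Some ` Pt H)"

lemma PPt_simps [simp]: "None \<in> PPt H" "Some p \<in> PPt H \<longleftrightarrow> p \<in> Arr C \<and> Dom C p = unitO C \<and> Cod C p = H"
  by (auto simp: PPt_def)

fun par_point :: "'o \<Rightarrow> 'o \<Rightarrow> 'm option \<Rightarrow> 'm option \<Rightarrow> 'm option" where
  "par_point H K None None = None"
| "par_point H K (Some a) None = Some (injr C (H \<boxtimes> K) (H \<boxplus> K) \<cdot> injl C H K \<cdot> a)"
| "par_point H K None (Some b) = Some (injr C (H \<boxtimes> K) (H \<boxplus> K) \<cdot> injr C H K \<cdot> b)"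
| "par_point H K (Some a) (Some b) = Some (injl C (H \<boxtimes> K) (H \<boxplus> K) \<cdot> (a \<star> b))"

lemma par_Obj [simp]: "H \<in> Obj C \<Longrightarrow> K \<in> Obj C \<Longrightarrow> par C H K \<in> Obj C"
  by (simp add: par_def)

lemma par_point_PPt [simp]:
  assumes "H \<in> Obj C" "K \<in> Obj C" "x \<in> PPt H" "y \<in> PPt K"
  shows "par_point H K x y \<in> PPt (par C H K)"
  using assms by (cases x; cases y) (simp_all add: par_def)

lemma act_PPt [simp]: "f \<in> Arr C \<Longrightarrow> x \<in> PPt (Dom C f) \<Longrightarrow> act f x \<in> PPt (Cod C f)"
  by (cases x) simp_all

lemma act_comp [simp]:
  "f \<in> Arr C \<Longrightarrow> g \<in> Arr C \<Longrightarrow> Dom C g = Cod C f \<Longrightarrow> x \<in> PPt (Dom C f) \<Longrightarrow> act (g \<cdot> f) x = act g (act f x)"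
  by (cases x) simp_all

lemma act_ident [simp]: "x \<in> PPt A \<Longrightarrow> act (ident C A) x = x"
  by (cases x) simp_all

lemma act_inv [simp]:
  "isomorphism C f \<Longrightarrow> x \<in> PPt (Dom C f) \<Longrightarrow> act (inv_arrow C f) (act f x) = x"
  using isomorphism_arr[of f] by (cases x) simp_all

text \<open>\<open>None\<close> has to belong to the set: paired with it, the points of one factor
  give the points of the summands \<open>H\<close> and \<open>K\<close> of
  \<open>par C H K\<close>.\<close>

definition determines :: "'m option set \<Rightarrow> 'o \<Rightarrow> bool" where
  "determines X H \<longleftrightarrow> None \<in> X \<and> X \<subseteq> PPt H \<and> resolves H {p. Some p \<in> X} (Hom C H (unitO C))"

lemma determinesI:
  assumes "resolves H P Q" "\<And>p. p \<in> P \<Longrightarrow> Some p \<in> X" "X \<subseteq> PPt H" "None \<in> X"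
  shows "determines X H"
proof -
  have "resolves H {p. Some p \<in> X} (Hom C H (unitO C))"
    by (rule resolves_mono[OF assms(1)]) (use assms in \<open>force simp: resolves_def\<close>)+
  then show ?thesis using assms by (simp add: determines_def)
qed

lemma determines_PPt: "generated H \<Longrightarrow> determines (PPt H) H"
  by (rule determinesI) auto

lemma determines_generated: "determines X H \<Longrightarrow> generated H"
  using generatedI by (auto simp: determines_def)

lemma determines_eqI:
  assumes "determines X H" "f \<in> Hom C H Z" "g \<in> Hom C H Z" "\<And>x. x \<in> X \<Longrightarrow> act f x = act g x"
  shows "f = g"
  by (rule resolves_epi[of H "{p. Some p \<in> X}" "Hom C H (unitO C)" f Z])
    (use assms in \<open>force simp: determines_def\<close>)+

text \<open>If \<open>f\<close> and \<open>g\<close> exchange two determining families index by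
  index, both composites fix a determining set. An inverse is thus verified on points, without
  computing any composite.\<close>

lemma determines_isoI:
  assumes "determines (\<phi> ` I) A" "determines (\<psi> ` I) B"
    and "f \<in> Hom C A B" "g \<in> Hom C B A"
    and "\<And>i. i \<in> I \<Longrightarrow> act f (\<phi> i) = \<psi> i" "\<And>i. i \<in> I \<Longrightarrow> act g (\<psi> i) = \<phi> i"
  shows "isomorphism C f"
proof (rule isomorphismI)
  have AB: "A \<in> Obj C" "B \<in> Obj C" and \<phi>: "\<And>i. i \<in> I \<Longrightarrow> \<phi> i \<in> PPt A" and \<psi>: "\<And>i. i \<in> I \<Longrightarrow> \<psi> i \<in> PPt B"
    using assms(1,2) by (auto simp: determines_def resolves_def)
  show "g \<cdot> f = ident C (Dom C f)"
    by (rule determines_eqI[OF assms(1), of _ A]) (use assms(3-) AB \<phi> in auto)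
  show "f \<cdot> g = ident C (Cod C f)"
    by (rule determines_eqI[OF assms(2), of _ B]) (use assms(3-) AB \<psi> in auto)
qed (use assms(3,4) in simp_all)

text \<open>The arrows into 1 stay existential, since only the points serve as test
  arguments.\<close>

lemma resolves_tensor_points:
  assumes "resolves H P Q" "resolves K P' Q'"
  shows "\<exists>Q''. resolves (H \<boxtimes> K) ((\<lambda>(p, q). p \<star> q) ` (P \<times> P')) Q''"
proof -
  have "(\<lambda>(p, q). p \<star> q) ` (P \<times> P') =
      {tensor_arrow C p p' \<cdot> inv_arrow C (tensor_lunit C (unitO C)) | p p'. p \<in> P \<and> p' \<in> P'}"
    by (auto simp: point_tensor_def)
  then show ?thesis
    using resolves_tensor[OF assms, of "tensor_lunit C (unitO C)" "inv_arrow C (tensor_lunit C (unitO C))"]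
    by auto
qed

text \<open>The pairs other than \<open>(None, None)\<close> run through test points of the three
  summands: two present entries for the tensor, one for \<open>H\<close> or for
  \<open>K\<close>.\<close>

lemma determines_par:
  assumes "determines X H" "determines Y K"
  shows "determines ((\<lambda>(x, y). par_point H K x y) ` (X \<times> Y)) (par C H K)"
proof -
  let ?P = "{p. Some p \<in> X}" and ?P' = "{p. Some p \<in> Y}"
  have HK: "H \<in> Obj C" "K \<in> Obj C" and XY: "X \<subseteq> PPt H" "Y \<subseteq> PPt K" "None \<in> X" "None \<in> Y"
    and rH: "resolves H ?P (Hom C H (unitO C))" and rK: "resolves K ?P' (Hom C K (unitO C))"
    using assms by (auto simp: determines_def resolves_def)
  obtain Q where "resolves (H \<boxtimes> K) ((\<lambda>(p, q). p \<star> q) ` (?P \<times> ?P')) Q"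
    using resolves_tensor_points[OF rH rK] by auto
  from resolves_biprod[OF this resolves_biprod[OF rH rK]]
  show ?thesis unfolding par_def[symmetric]
  proof (rule determinesI, goal_cases)
    case (1 p)
    have im: "par_point H K x y \<in> (\<lambda>(x, y). par_point H K x y) ` (X \<times> Y)" if "x \<in> X" "y \<in> Y" for x y
      using that by auto
    from 1 consider
        a b where "p = injl C (H \<boxtimes> K) (H \<boxplus> K) \<cdot> (a \<star> b)" "Some a \<in> X" "Some b \<in> Y"
      | a where "p = injr C (H \<boxtimes> K) (H \<boxplus> K) \<cdot> injl C H K \<cdot> a" "Some a \<in> X"
      | b where "p = injr C (H \<boxtimes> K) (H \<boxplus> K) \<cdot> injr C H K \<cdot> b" "Some b \<in> Y"
      by auto
    then show ?case
      by cases (use im[of "Some _" "Some _"] im[of "Some _" None] im[of None "Some _"] XY in simp_all)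
  next
    case 2
    show ?case using HK by (auto dest!: subsetD[OF XY(1)] subsetD[OF XY(2)])
  next
    case 3
    then show ?case using XY by (intro image_eqI[where x = "(None, None)"]) auto
  qed
qed

lemma generated_par [simp]: "generated H \<Longrightarrow> generated K \<Longrightarrow> generated (par C H K)"
  by (rule determines_generated[OF determines_par[OF determines_PPt determines_PPt]])

section \<open>The product \<open>par\<close> on arrows, its symmetry and its unitors\<close>

lemma par_arrow_arr [simp]:
  assumes "f \<in> Arr C" "g \<in> Arr C"
  shows "par_arrow C f g \<in> Arr C" "Dom C (par_arrow C f g) = par C (Dom C f) (Dom C g)"
    "Cod C (par_arrow C f g) = par C (Cod C f) (Cod C g)"
  using assms by (simp_all add: par_arrow_def par_def)

lemma par_arrow_ident [simp]:
  "A \<in> Obj C \<Longrightarrow> B \<in> Obj C \<Longrightarrow> par_arrow C (ident C A) (ident C B) = ident C (par C A B)"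
  by (simp add: par_arrow_def par_def)

lemma par_arrow_comp:
  assumes "f \<in> Arr C" "f' \<in> Arr C" "g \<in> Arr C" "g' \<in> Arr C" "Dom C f' = Cod C f" "Dom C g' = Cod C g"
  shows "par_arrow C f' g' \<cdot> par_arrow C f g = par_arrow C (f' \<cdot> f) (g' \<cdot> g)"
  using assms by (simp add: par_arrow_def biprod_arrow_comp)

lemma iso_par_arrow [simp]:
  "isomorphism C f \<Longrightarrow> isomorphism C g \<Longrightarrow> isomorphism C (par_arrow C f g)"
  by (simp add: par_arrow_def)

lemma act_par_arrow [simp]:
  assumes "f \<in> Arr C" "g \<in> Arr C" "Dom C f = H" "Dom C g = K" "x \<in> PPt H" "y \<in> PPt K"
  shows "act (par_arrow C f g) (par_point H K x y) = par_point (Cod C f) (Cod C g) (act f x) (act g y)"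
proof -
  have "H \<in> Obj C" "K \<in> Obj C" using assms by auto
  then show ?thesis using assms by (cases x; cases y) (simp_all add: par_arrow_def)
qed

lemma par_symm_arr [simp]:
  assumes "H \<in> Obj C" "K \<in> Obj C"
  shows "par_symm C H K \<in> Arr C" "Dom C (par_symm C H K) = par C H K" "Cod C (par_symm C H K) = par C K H"
  using assms by (simp_all add: par_symm_def par_def biprod_symm_def)

lemma act_par_symm [simp]:
  assumes "H \<in> Obj C" "K \<in> Obj C" "x \<in> PPt H" "y \<in> PPt K"
  shows "act (par_symm C H K) (par_point H K x y) = par_point K H y x"
  using assms by (cases x; cases y) (simp_all add: par_symm_def biprod_symm_def inj_comp_pairing)

lemma par_unit_arr [simp]:
  assumes "H \<in> Obj C"
  shows "par_lunit C H \<in> Arr C" "Dom C (par_lunit C H) = par C (zeroO C) H" "Cod C (par_lunit C H) = H"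
    "par_runit C H \<in> Arr C" "Dom C (par_runit C H) = par C H (zeroO C)" "Cod C (par_runit C H) = H"
  using assms by (simp_all add: par_lunit_def par_runit_def par_def)

lemma act_par_unit [simp]:
  assumes "H \<in> Obj C" "x \<in> PPt H"
  shows "act (par_lunit C H) (par_point (zeroO C) H None x) = x"
    "act (par_runit C H) (par_point H (zeroO C) x None) = x"
  using assms by (cases x; simp add: par_lunit_def par_runit_def)+

lemma determines_zeroO: "determines {None} (zeroO C)"
  by (rule determinesI[OF resolves_zeroO]) auto

text \<open>The only partial point of 0 is \<open>None\<close>, so the partial points of
  \<open>par C (zeroO C) H\<close> are indexed by those of \<open>H\<close>, and the injection of
  \<open>H\<close> acts inversely to the unitor.\<close>

lemma iso_par_lunit [simp]:
  assumes "generated H"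
  shows "isomorphism C (par_lunit C H)"
proof -
  have H: "H \<in> Obj C" by (rule generated_Obj[OF assms])
  show ?thesis
  proof (rule determines_isoI)
    show "determines ((\<lambda>(x, y). par_point (zeroO C) H x y) ` ({None} \<times> PPt H)) (par C (zeroO C) H)"
      by (rule determines_par[OF determines_zeroO determines_PPt[OF assms]])
    show "determines (snd ` ({None} \<times> PPt H)) H"
      using determines_PPt[OF assms] by simp
    show "injr C (zeroO C \<boxtimes> H) (zeroO C \<boxplus> H) \<cdot> injr C (zeroO C) H \<in> Hom C H (par C (zeroO C) H)"
      using H by (simp add: par_def)
  next
    fix i :: "'m option \<times> 'm option" assume "i \<in> {None} \<times> PPt H"
    then show "act (injr C (zeroO C \<boxtimes> H) (zeroO C \<boxplus> H) \<cdot> injr C (zeroO C) H) (snd i) =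
        (case i of (x, y) \<Rightarrow> par_point (zeroO C) H x y)"
      using H by (cases "snd i") auto
  qed (use H in auto)
qed

lemma iso_par_runit [simp]:
  assumes "generated H"
  shows "isomorphism C (par_runit C H)"
proof -
  have H: "H \<in> Obj C" by (rule generated_Obj[OF assms])
  show ?thesis
  proof (rule determines_isoI)
    show "determines ((\<lambda>(x, y). par_point H (zeroO C) x y) ` (PPt H \<times> {None})) (par C H (zeroO C))"
      by (rule determines_par[OF determines_PPt[OF assms] determines_zeroO])
    show "determines (fst ` (PPt H \<times> {None})) H"
      using determines_PPt[OF assms] by simp
    show "injr C (H \<boxtimes> zeroO C) (H \<boxplus> zeroO C) \<cdot> injl C H (zeroO C) \<in> Hom C H (par C H (zeroO C))"
      using H by (simp add: par_def)
  next
    fix i :: "'m option \<times> 'm option" assume "i \<in> PPt H \<times> {None}"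
    then show "act (injr C (H \<boxtimes> zeroO C) (H \<boxplus> zeroO C) \<cdot> injl C H (zeroO C)) (fst i) =
        (case i of (x, y) \<Rightarrow> par_point H (zeroO C) x y)"
      using H by (cases "fst i") auto
  qed (use H in auto)
qed

end

section \<open>The associator of the combined product\<close>

context distributive_semiadditive_category
begin

text \<open>The first summand is a parameter because the two expansions bracket the triple tensor
  differently.\<close>

definition seven :: "'o \<Rightarrow> 'o \<Rightarrow> 'o \<Rightarrow> 'o \<Rightarrow> 'o" where
  "seven T H K L = T \<boxplus> (H \<boxtimes> K) \<boxplus> (H \<boxtimes> L) \<boxplus> (K \<boxtimes> L) \<boxplus> H \<boxplus> K \<boxplus> L"

definition tuple7 :: "'m \<Rightarrow> 'm \<Rightarrow> 'm \<Rightarrow> 'm \<Rightarrow> 'm \<Rightarrow> 'm \<Rightarrow> 'm \<Rightarrow> 'm" where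
  "tuple7 f1 f2 f3 f4 f5 f6 f7 =
    pairing C f1 (pairing C f2 (pairing C f3 (pairing C f4 (pairing C f5 (pairing C f6 f7)))))"

lemma tuple7_arr:
  assumes "f1 \<in> Hom C X A1" "f2 \<in> Hom C X A2" "f3 \<in> Hom C X A3" "f4 \<in> Hom C X A4"
    "f5 \<in> Hom C X A5" "f6 \<in> Hom C X A6" "f7 \<in> Hom C X A7"
  shows "tuple7 f1 f2 f3 f4 f5 f6 f7 \<in> Hom C X (A1 \<boxplus> A2 \<boxplus> A3 \<boxplus> A4 \<boxplus> A5 \<boxplus> A6 \<boxplus> A7)"
  using assms by (simp add: tuple7_def)

lemma tuple7_comp:
  assumes "f1 \<in> Hom C X A1" "f2 \<in> Hom C X A2" "f3 \<in> Hom C X A3" "f4 \<in> Hom C X A4"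
    "f5 \<in> Hom C X A5" "f6 \<in> Hom C X A6" "f7 \<in> Hom C X A7" "h \<in> Hom C Y X"
  shows "tuple7 f1 f2 f3 f4 f5 f6 f7 \<cdot> h =
    tuple7 (f1 \<cdot> h) (f2 \<cdot> h) (f3 \<cdot> h) (f4 \<cdot> h) (f5 \<cdot> h) (f6 \<cdot> h) (f7 \<cdot> h)"
  using assms by (simp add: tuple7_def)

text \<open>The common normal form of three partial points: the set of present arguments selects one
  of the seven summands, and \<open>t\<close> fixes the bracketing when all three are
  present.\<close>

definition seven_point :: "('m \<Rightarrow> 'm \<Rightarrow> 'm \<Rightarrow> 'm) \<Rightarrow> 'o \<Rightarrow> 'o \<Rightarrow> 'o \<Rightarrow> 'o \<Rightarrow>
    'm option \<Rightarrow> 'm option \<Rightarrow> 'm option \<Rightarrow> 'm option" where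
  "seven_point t T H K L x y z =
    (let z1 = zero_arrow C (unitO C) T; z2 = zero_arrow C (unitO C) (H \<boxtimes> K);
         z3 = zero_arrow C (unitO C) (H \<boxtimes> L); z4 = zero_arrow C (unitO C) (K \<boxtimes> L);
         z5 = zero_arrow C (unitO C) H; z6 = zero_arrow C (unitO C) K; z7 = zero_arrow C (unitO C) L
     in case (x, y, z) of
          (Some a, Some b, Some c) \<Rightarrow> Some (tuple7 (t a b c) z2 z3 z4 z5 z6 z7)
        | (Some a, Some b, None) \<Rightarrow> Some (tuple7 z1 (a \<star> b) z3 z4 z5 z6 z7)
        | (Some a, None, Some c) \<Rightarrow> Some (tuple7 z1 z2 (a \<star> c) z4 z5 z6 z7)
        | (None, Some b, Some c) \<Rightarrow> Some (tuple7 z1 z2 z3 (b \<star> c) z5 z6 z7)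
        | (Some a, None, None) \<Rightarrow> Some (tuple7 z1 z2 z3 z4 a z6 z7)
        | (None, Some b, None) \<Rightarrow> Some (tuple7 z1 z2 z3 z4 z5 b z7)
        | (None, None, Some c) \<Rightarrow> Some (tuple7 z1 z2 z3 z4 z5 z6 c)
        | (None, None, None) \<Rightarrow> None)"

lemma seven_point_PPt:
  assumes "H \<in> Obj C" "K \<in> Obj C" "L \<in> Obj C" "T \<in> Obj C"
    and "\<And>a b c. a \<in> Pt H \<Longrightarrow> b \<in> Pt K \<Longrightarrow> c \<in> Pt L \<Longrightarrow> t a b c \<in> Pt T"
    and "x \<in> PPt H" "y \<in> PPt K" "z \<in> PPt L"
  shows "seven_point t T H K L x y z \<in> PPt (seven T H K L)"
proof -
  have "tuple7 f1 f2 f3 f4 f5 f6 f7 \<in> Arr C \<and> Dom C (tuple7 f1 f2 f3 f4 f5 f6 f7) = unitO C \<and>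
      Cod C (tuple7 f1 f2 f3 f4 f5 f6 f7) = seven T H K L"
    if "f1 \<in> Pt T" "f2 \<in> Pt (H \<boxtimes> K)" "f3 \<in> Pt (H \<boxtimes> L)" "f4 \<in> Pt (K \<boxtimes> L)"
      "f5 \<in> Pt H" "f6 \<in> Pt K" "f7 \<in> Pt L" for f1 f2 f3 f4 f5 f6 f7
    using tuple7_arr[OF that] by (simp add: seven_def)
  then show ?thesis
    using assms by (cases x; cases y; cases z) (simp_all add: seven_point_def)
qed

text \<open>A point of one summand in two guises: the chain of injections that resolutions produce
  and copairings evaluate, and the tuple with zeros that the expansions produce.\<close>

lemma inj_chain_tuple7:
  assumes "H \<in> Obj C" "K \<in> Obj C" "L \<in> Obj C" "T \<in> Obj C" "p \<in> Arr C" "Dom C p = unitO C"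
  defines "s1 \<equiv> (H \<boxtimes> K) \<boxplus> (H \<boxtimes> L) \<boxplus> (K \<boxtimes> L) \<boxplus> H \<boxplus> K \<boxplus> L"
    and "s2 \<equiv> (H \<boxtimes> L) \<boxplus> (K \<boxtimes> L) \<boxplus> H \<boxplus> K \<boxplus> L"
    and "s3 \<equiv> (K \<boxtimes> L) \<boxplus> H \<boxplus> K \<boxplus> L"
    and "z1 \<equiv> zero_arrow C (unitO C) T" and "z2 \<equiv> zero_arrow C (unitO C) (H \<boxtimes> K)"
    and "z3 \<equiv> zero_arrow C (unitO C) (H \<boxtimes> L)" and "z4 \<equiv> zero_arrow C (unitO C) (K \<boxtimes> L)"
    and "z5 \<equiv> zero_arrow C (unitO C) H" and "z6 \<equiv> zero_arrow C (unitO C) K"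
    and "z7 \<equiv> zero_arrow C (unitO C) L"
  shows "Cod C p = T \<Longrightarrow> injl C T s1 \<cdot> p = tuple7 p z2 z3 z4 z5 z6 z7"
    "Cod C p = H \<boxtimes> K \<Longrightarrow> injr C T s1 \<cdot> injl C (H \<boxtimes> K) s2 \<cdot> p = tuple7 z1 p z3 z4 z5 z6 z7"
    "Cod C p = H \<boxtimes> L \<Longrightarrow> injr C T s1 \<cdot> injr C (H \<boxtimes> K) s2 \<cdot> injl C (H \<boxtimes> L) s3 \<cdot> p =
      tuple7 z1 z2 p z4 z5 z6 z7"
    "Cod C p = K \<boxtimes> L \<Longrightarrow> injr C T s1 \<cdot> injr C (H \<boxtimes> K) s2 \<cdot> injr C (H \<boxtimes> L) s3 \<cdot>
      injl C (K \<boxtimes> L) (H \<boxplus> K \<boxplus> L) \<cdot> p = tuple7 z1 z2 z3 p z5 z6 z7"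
    "Cod C p = H \<Longrightarrow> injr C T s1 \<cdot> injr C (H \<boxtimes> K) s2 \<cdot> injr C (H \<boxtimes> L) s3 \<cdot>
      injr C (K \<boxtimes> L) (H \<boxplus> K \<boxplus> L) \<cdot> injl C H (K \<boxplus> L) \<cdot> p = tuple7 z1 z2 z3 z4 p z6 z7"
    "Cod C p = K \<Longrightarrow> injr C T s1 \<cdot> injr C (H \<boxtimes> K) s2 \<cdot> injr C (H \<boxtimes> L) s3 \<cdot>
      injr C (K \<boxtimes> L) (H \<boxplus> K \<boxplus> L) \<cdot> injr C H (K \<boxplus> L) \<cdot> injl C K L \<cdot> p = tuple7 z1 z2 z3 z4 z5 p z7"
    "Cod C p = L \<Longrightarrow> injr C T s1 \<cdot> injr C (H \<boxtimes> K) s2 \<cdot> injr C (H \<boxtimes> L) s3 \<cdot>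
      injr C (K \<boxtimes> L) (H \<boxplus> K \<boxplus> L) \<cdot> injr C H (K \<boxplus> L) \<cdot> injr C K L \<cdot> p = tuple7 z1 z2 z3 z4 z5 z6 p"
  using assms(1-6) by (simp_all add: tuple7_def inj_comp_pairing s1_def s2_def s3_def z1_def z2_def
    z3_def z4_def z5_def z6_def z7_def)

text \<open>Each summand receives its test points from exactly one pattern of present
  arguments.\<close>

lemma determines_seven:
  assumes "generated H" "generated K" "generated L"
    and "resolves T ((\<lambda>(a, b, c). t a b c) ` (Pt H \<times> Pt K \<times> Pt L)) Q"
  shows "determines ((\<lambda>(x, y, z). seven_point t T H K L x y z) ` (PPt H \<times> PPt K \<times> PPt L)) (seven T H K L)"
proof -
  let ?S = "(\<lambda>(x, y, z). seven_point t T H K L x y z) ` (PPt H \<times> PPt K \<times> PPt L)"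
  have im: "seven_point t T H K L x y z \<in> ?S" if "x \<in> PPt H" "y \<in> PPt K" "z \<in> PPt L" for x y z
    using that by (intro image_eqI[where x = "(x, y, z)"]) auto
  have objs: "H \<in> Obj C" "K \<in> Obj C" "L \<in> Obj C" "T \<in> Obj C"
    and t: "\<And>a b c. a \<in> Pt H \<Longrightarrow> b \<in> Pt K \<Longrightarrow> c \<in> Pt L \<Longrightarrow> t a b c \<in> Pt T"
    using assms by (fastforce simp: resolves_def)+
  obtain Q1 Q2 Q3 where
    "resolves (H \<boxtimes> K) ((\<lambda>(p, q). p \<star> q) ` (Pt H \<times> Pt K)) Q1"
    "resolves (H \<boxtimes> L) ((\<lambda>(p, q). p \<star> q) ` (Pt H \<times> Pt L)) Q2"
    "resolves (K \<boxtimes> L) ((\<lambda>(p, q). p \<star> q) ` (Pt K \<times> Pt L)) Q3"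
    using resolves_tensor_points assms(1-3) by meson
  note res = resolves_biprod[OF assms(4) resolves_biprod[OF this(1) resolves_biprod[OF this(2)
    resolves_biprod[OF this(3) resolves_biprod[OF assms(1) resolves_biprod[OF assms(2,3)]]]]]]
  show ?thesis unfolding seven_def
  proof (rule determinesI[OF res], goal_cases)
    case (1 p)
    then show ?case
      apply (elim UnE imageE)
            apply (use im[of "Some _" "Some _" "Some _"] objs t in \<open>force simp: seven_point_def inj_chain_tuple7\<close>)
           apply (use im[of "Some _" "Some _" None] objs in \<open>force simp: seven_point_def inj_chain_tuple7\<close>)
          apply (use im[of "Some _" None "Some _"] objs in \<open>force simp: seven_point_def inj_chain_tuple7\<close>)
         apply (use im[of None "Some _" "Some _"] objs in \<open>force simp: seven_point_def inj_chain_tuple7\<close>)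
        apply (use im[of "Some _" None None] objs in \<open>force simp: seven_point_def inj_chain_tuple7\<close>)
       apply (use im[of None "Some _" None] objs in \<open>force simp: seven_point_def inj_chain_tuple7\<close>)
      apply (use im[of None None "Some _"] objs in \<open>force simp: seven_point_def inj_chain_tuple7\<close>)
      done
  next
    case 2
    show ?case using seven_point_PPt[OF objs t] by (auto simp: seven_def)
  next
    case 3
    show ?case using im[of None None None] by (simp add: seven_point_def)
  qed
qed

section \<open>The two expansions and their inverses\<close>

lemma expand_left_tuple7:
  "expand_left C H K L =
    tuple7 (tensor_arrow C (prjl C (H \<boxtimes> K) (H \<boxplus> K)) (ident C L) \<cdot> prjl C (par C H K \<boxtimes> L) (par C H K \<boxplus> L))
     (prjl C (H \<boxtimes> K) (H \<boxplus> K) \<cdot> prjl C (par C H K) L \<cdot> prjr C (par C H K \<boxtimes> L) (par C H K \<boxplus> L))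
     (tensor_arrow C (prjl C H K \<cdot> prjr C (H \<boxtimes> K) (H \<boxplus> K)) (ident C L) \<cdot> prjl C (par C H K \<boxtimes> L) (par C H K \<boxplus> L))
     (tensor_arrow C (prjr C H K \<cdot> prjr C (H \<boxtimes> K) (H \<boxplus> K)) (ident C L) \<cdot> prjl C (par C H K \<boxtimes> L) (par C H K \<boxplus> L))
     ((prjl C H K \<cdot> prjr C (H \<boxtimes> K) (H \<boxplus> K)) \<cdot> prjl C (par C H K) L \<cdot> prjr C (par C H K \<boxtimes> L) (par C H K \<boxplus> L))
     ((prjr C H K \<cdot> prjr C (H \<boxtimes> K) (H \<boxplus> K)) \<cdot> prjl C (par C H K) L \<cdot> prjr C (par C H K \<boxtimes> L) (par C H K \<boxplus> L))
     (prjr C (par C H K) L \<cdot> prjr C (par C H K \<boxtimes> L) (par C H K \<boxplus> L))"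
  by (simp only: expand_left_def Let_def tuple7_def)

lemma expand_right_tuple7:
  "expand_right C H K L =
    tuple7 (tensor_arrow C (ident C H) (prjl C (K \<boxtimes> L) (K \<boxplus> L)) \<cdot> prjl C (H \<boxtimes> par C K L) (H \<boxplus> par C K L))
     (tensor_arrow C (ident C H) (prjl C K L \<cdot> prjr C (K \<boxtimes> L) (K \<boxplus> L)) \<cdot> prjl C (H \<boxtimes> par C K L) (H \<boxplus> par C K L))
     (tensor_arrow C (ident C H) (prjr C K L \<cdot> prjr C (K \<boxtimes> L) (K \<boxplus> L)) \<cdot> prjl C (H \<boxtimes> par C K L) (H \<boxplus> par C K L))
     (prjl C (K \<boxtimes> L) (K \<boxplus> L) \<cdot> prjr C H (par C K L) \<cdot> prjr C (H \<boxtimes> par C K L) (H \<boxplus> par C K L))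
     (prjl C H (par C K L) \<cdot> prjr C (H \<boxtimes> par C K L) (H \<boxplus> par C K L))
     ((prjl C K L \<cdot> prjr C (K \<boxtimes> L) (K \<boxplus> L)) \<cdot> prjr C H (par C K L) \<cdot> prjr C (H \<boxtimes> par C K L) (H \<boxplus> par C K L))
     ((prjr C K L \<cdot> prjr C (K \<boxtimes> L) (K \<boxplus> L)) \<cdot> prjr C H (par C K L) \<cdot> prjr C (H \<boxtimes> par C K L) (H \<boxplus> par C K L))"
  by (simp only: expand_right_def Let_def tuple7_def)

lemma expand_left_arr [simp]:
  assumes "H \<in> Obj C" "K \<in> Obj C" "L \<in> Obj C"
  shows "expand_left C H K L \<in> Arr C" "Dom C (expand_left C H K L) = par C (par C H K) L"
    "Cod C (expand_left C H K L) = seven ((H \<boxtimes> K) \<boxtimes> L) H K L"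
proof -
  have "expand_left C H K L \<in> Hom C (par C (par C H K) L) (seven ((H \<boxtimes> K) \<boxtimes> L) H K L)"
    unfolding expand_left_tuple7 seven_def
    by (rule tuple7_arr) (use assms in \<open>simp_all add: par_def\<close>)
  then show "expand_left C H K L \<in> Arr C" "Dom C (expand_left C H K L) = par C (par C H K) L"
    "Cod C (expand_left C H K L) = seven ((H \<boxtimes> K) \<boxtimes> L) H K L" by simp_all
qed

lemma expand_right_arr [simp]:
  assumes "H \<in> Obj C" "K \<in> Obj C" "L \<in> Obj C"
  shows "expand_right C H K L \<in> Arr C" "Dom C (expand_right C H K L) = par C H (par C K L)"
    "Cod C (expand_right C H K L) = seven (H \<boxtimes> K \<boxtimes> L) H K L"
proof -
  have "expand_right C H K L \<in> Hom C (par C H (par C K L)) (seven (H \<boxtimes> K \<boxtimes> L) H K L)"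
    unfolding expand_right_tuple7 seven_def
    by (rule tuple7_arr) (use assms in \<open>simp_all add: par_def\<close>)
  then show "expand_right C H K L \<in> Arr C" "Dom C (expand_right C H K L) = par C H (par C K L)"
    "Cod C (expand_right C H K L) = seven (H \<boxtimes> K \<boxtimes> L) H K L" by simp_all
qed

text \<open>A partial point sits in one summand at each level of nesting, so all but one of the
  seven components pair a projection with the wrong injection and vanish.\<close>

lemma act_expand_left:
  assumes "H \<in> Obj C" "K \<in> Obj C" "L \<in> Obj C" "x \<in> PPt H" "y \<in> PPt K" "z \<in> PPt L"
  shows "act (expand_left C H K L) (par_point (par C H K) L (par_point H K x y) z) =
    seven_point (\<lambda>a b c. (a \<star> b) \<star> c) ((H \<boxtimes> K) \<boxtimes> L) H K L x y z"
proof -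
  have "par_point (par C H K) L (par_point H K x y) z \<in> PPt (par C (par C H K) L)"
    using assms by simp
  moreover have "expand_left C H K L \<cdot> p = tuple7
     (tensor_arrow C (prjl C (H \<boxtimes> K) (H \<boxplus> K)) (ident C L) \<cdot> prjl C (par C H K \<boxtimes> L) (par C H K \<boxplus> L) \<cdot> p)
     (prjl C (H \<boxtimes> K) (H \<boxplus> K) \<cdot> prjl C (par C H K) L \<cdot> prjr C (par C H K \<boxtimes> L) (par C H K \<boxplus> L) \<cdot> p)
     (tensor_arrow C (prjl C H K \<cdot> prjr C (H \<boxtimes> K) (H \<boxplus> K)) (ident C L) \<cdot> prjl C (par C H K \<boxtimes> L) (par C H K \<boxplus> L) \<cdot> p)
     (tensor_arrow C (prjr C H K \<cdot> prjr C (H \<boxtimes> K) (H \<boxplus> K)) (ident C L) \<cdot> prjl C (par C H K \<boxtimes> L) (par C H K \<boxplus> L) \<cdot> p)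
     (prjl C H K \<cdot> prjr C (H \<boxtimes> K) (H \<boxplus> K) \<cdot> prjl C (par C H K) L \<cdot> prjr C (par C H K \<boxtimes> L) (par C H K \<boxplus> L) \<cdot> p)
     (prjr C H K \<cdot> prjr C (H \<boxtimes> K) (H \<boxplus> K) \<cdot> prjl C (par C H K) L \<cdot> prjr C (par C H K \<boxtimes> L) (par C H K \<boxplus> L) \<cdot> p)
     (prjr C (par C H K) L \<cdot> prjr C (par C H K \<boxtimes> L) (par C H K \<boxplus> L) \<cdot> p)"
    if "p \<in> Pt (par C (par C H K) L)" for p
    unfolding expand_left_tuple7
    by (subst tuple7_comp) (use assms that in \<open>simp_all add: par_def\<close>)
  ultimately show ?thesis
    using assms(4-6) assms(1-3)
    by (cases x; cases y; cases z) (simp_all add: seven_point_def par_def)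
qed

lemma act_expand_right:
  assumes "H \<in> Obj C" "K \<in> Obj C" "L \<in> Obj C" "x \<in> PPt H" "y \<in> PPt K" "z \<in> PPt L"
  shows "act (expand_right C H K L) (par_point H (par C K L) x (par_point K L y z)) =
    seven_point (\<lambda>a b c. a \<star> b \<star> c) (H \<boxtimes> K \<boxtimes> L) H K L x y z"
proof -
  have "par_point H (par C K L) x (par_point K L y z) \<in> PPt (par C H (par C K L))"
    using assms by simp
  moreover have "expand_right C H K L \<cdot> p = tuple7
     (tensor_arrow C (ident C H) (prjl C (K \<boxtimes> L) (K \<boxplus> L)) \<cdot> prjl C (H \<boxtimes> par C K L) (H \<boxplus> par C K L) \<cdot> p)
     (tensor_arrow C (ident C H) (prjl C K L \<cdot> prjr C (K \<boxtimes> L) (K \<boxplus> L)) \<cdot> prjl C (H \<boxtimes> par C K L) (H \<boxplus> par C K L) \<cdot> p)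
     (tensor_arrow C (ident C H) (prjr C K L \<cdot> prjr C (K \<boxtimes> L) (K \<boxplus> L)) \<cdot> prjl C (H \<boxtimes> par C K L) (H \<boxplus> par C K L) \<cdot> p)
     (prjl C (K \<boxtimes> L) (K \<boxplus> L) \<cdot> prjr C H (par C K L) \<cdot> prjr C (H \<boxtimes> par C K L) (H \<boxplus> par C K L) \<cdot> p)
     (prjl C H (par C K L) \<cdot> prjr C (H \<boxtimes> par C K L) (H \<boxplus> par C K L) \<cdot> p)
     (prjl C K L \<cdot> prjr C (K \<boxtimes> L) (K \<boxplus> L) \<cdot> prjr C H (par C K L) \<cdot> prjr C (H \<boxtimes> par C K L) (H \<boxplus> par C K L) \<cdot> p)
     (prjr C K L \<cdot> prjr C (K \<boxtimes> L) (K \<boxplus> L) \<cdot> prjr C H (par C K L) \<cdot> prjr C (H \<boxtimes> par C K L) (H \<boxplus> par C K L) \<cdot> p)"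
    if "p \<in> Pt (par C H (par C K L))" for p
    unfolding expand_right_tuple7
    by (subst tuple7_comp) (use assms that in \<open>simp_all add: par_def\<close>)
  ultimately show ?thesis
    using assms(4-6) assms(1-3)
    by (cases x; cases y; cases z) (simp_all add: seven_point_def par_def)
qed

text \<open>Gives a candidate inverse of an expansion summand by summand, in place of a composite of
  inverse distributivity isomorphisms.\<close>

definition cotuple7 :: "'m \<Rightarrow> 'm \<Rightarrow> 'm \<Rightarrow> 'm \<Rightarrow> 'm \<Rightarrow> 'm \<Rightarrow> 'm \<Rightarrow> 'm" where
  "cotuple7 f1 f2 f3 f4 f5 f6 f7 =
    copairing C f1 (copairing C f2 (copairing C f3 (copairing C f4 (copairing C f5 (copairing C f6 f7)))))"

lemma cotuple7_arr:
  assumes "f1 \<in> Hom C A1 X" "f2 \<in> Hom C A2 X" "f3 \<in> Hom C A3 X" "f4 \<in> Hom C A4 X"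
    "f5 \<in> Hom C A5 X" "f6 \<in> Hom C A6 X" "f7 \<in> Hom C A7 X"
  shows "cotuple7 f1 f2 f3 f4 f5 f6 f7 \<in> Hom C (A1 \<boxplus> A2 \<boxplus> A3 \<boxplus> A4 \<boxplus> A5 \<boxplus> A6 \<boxplus> A7) X"
  using assms by (simp add: cotuple7_def)

lemma act_cotuple7:
  assumes "generated H" "generated K" "generated L" "T \<in> Obj C"
    and t: "\<And>a b c. a \<in> Pt H \<Longrightarrow> b \<in> Pt K \<Longrightarrow> c \<in> Pt L \<Longrightarrow> t a b c \<in> Pt T"
    and f: "f1 \<in> Hom C T X" "f2 \<in> Hom C (H \<boxtimes> K) X" "f3 \<in> Hom C (H \<boxtimes> L) X" "f4 \<in> Hom C (K \<boxtimes> L) X"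
      "f5 \<in> Hom C H X" "f6 \<in> Hom C K X" "f7 \<in> Hom C L X"
    and xyz: "x \<in> PPt H" "y \<in> PPt K" "z \<in> PPt L"
  shows "act (cotuple7 f1 f2 f3 f4 f5 f6 f7) (seven_point t T H K L x y z) =
    (case (x, y, z) of
          (Some a, Some b, Some c) \<Rightarrow> Some (f1 \<cdot> t a b c)
        | (Some a, Some b, None) \<Rightarrow> Some (f2 \<cdot> (a \<star> b))
        | (Some a, None, Some c) \<Rightarrow> Some (f3 \<cdot> (a \<star> c))
        | (None, Some b, Some c) \<Rightarrow> Some (f4 \<cdot> (b \<star> c))
        | (Some a, None, None) \<Rightarrow> Some (f5 \<cdot> a)
        | (None, Some b, None) \<Rightarrow> Some (f6 \<cdot> b)
        | (None, None, Some c) \<Rightarrow> Some (f7 \<cdot> c)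
        | (None, None, None) \<Rightarrow> None)"
proof -
  have objs: "H \<in> Obj C" "K \<in> Obj C" "L \<in> Obj C" using assms(1-3) generated_Obj by auto
  show ?thesis using f xyz objs assms(4) t
    by (cases x; cases y; cases z)
      (simp_all add: seven_point_def cotuple7_def flip: inj_chain_tuple7)
qed

text \<open>The expansion and \<open>?J\<close> exchange the bracketed partial points with their
  normal forms, triple by triple, and both families are determining.\<close>

lemma iso_expand_left [simp]:
  assumes gen: "generated H" "generated K" "generated L"
  shows "isomorphism C (expand_left C H K L)"
proof -
  have objs: "H \<in> Obj C" "K \<in> Obj C" "L \<in> Obj C" using gen generated_Obj by auto
  let ?P = "par C H K"
  \<comment> \<open>The components follow the order HKL, HK, HL, KL, H, K, L. Those involving
    \<open>L\<close> with another factor enter through the outer tensor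
    \<open>?P \<boxtimes> L\<close>, while HK lies inside the summand \<open>?P\<close>.\<close>
  let ?J = "cotuple7
    (injl C (?P \<boxtimes> L) (?P \<boxplus> L) \<cdot> tensor_arrow C (injl C (H \<boxtimes> K) (H \<boxplus> K)) (ident C L))
    (injr C (?P \<boxtimes> L) (?P \<boxplus> L) \<cdot> injl C ?P L \<cdot> injl C (H \<boxtimes> K) (H \<boxplus> K))
    (injl C (?P \<boxtimes> L) (?P \<boxplus> L) \<cdot> tensor_arrow C (injr C (H \<boxtimes> K) (H \<boxplus> K) \<cdot> injl C H K) (ident C L))
    (injl C (?P \<boxtimes> L) (?P \<boxplus> L) \<cdot> tensor_arrow C (injr C (H \<boxtimes> K) (H \<boxplus> K) \<cdot> injr C H K) (ident C L))
    (injr C (?P \<boxtimes> L) (?P \<boxplus> L) \<cdot> injl C ?P L \<cdot> injr C (H \<boxtimes> K) (H \<boxplus> K) \<cdot> injl C H K)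
    (injr C (?P \<boxtimes> L) (?P \<boxplus> L) \<cdot> injl C ?P L \<cdot> injr C (H \<boxtimes> K) (H \<boxplus> K) \<cdot> injr C H K)
    (injr C (?P \<boxtimes> L) (?P \<boxplus> L) \<cdot> injr C ?P L)"
  show ?thesis
  proof (rule determines_isoI)
    show "determines ((\<lambda>(x, y, z). par_point ?P L (par_point H K x y) z) ` (PPt H \<times> PPt K \<times> PPt L))
      (par C ?P L)"
      using determines_par[OF determines_par[OF determines_PPt[OF gen(1)] determines_PPt[OF gen(2)]]
          determines_PPt[OF gen(3)]]
      by (rule back_subst[of "\<lambda>S. determines S (par C ?P L)"]) force
    obtain Q1 Q2 where 1: "resolves (H \<boxtimes> K) ((\<lambda>(p, q). p \<star> q) ` (Pt H \<times> Pt K)) Q1"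
      and 2: "resolves ((H \<boxtimes> K) \<boxtimes> L) ((\<lambda>(p, q). p \<star> q) ` ((\<lambda>(p, q). p \<star> q) ` (Pt H \<times> Pt K) \<times> Pt L)) Q2"
      using resolves_tensor_points gen by meson
    have "(\<lambda>(p, q). p \<star> q) ` ((\<lambda>(p, q). p \<star> q) ` (Pt H \<times> Pt K) \<times> Pt L) =
      (\<lambda>(a, b, c). (a \<star> b) \<star> c) ` (Pt H \<times> Pt K \<times> Pt L)" by force
    then show "determines ((\<lambda>(x, y, z). seven_point (\<lambda>a b c. (a \<star> b) \<star> c) ((H \<boxtimes> K) \<boxtimes> L) H K L x y z) `
        (PPt H \<times> PPt K \<times> PPt L)) (seven ((H \<boxtimes> K) \<boxtimes> L) H K L)"
      using 2 by (intro determines_seven[OF gen]) simp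
    show "?J \<in> Hom C (seven ((H \<boxtimes> K) \<boxtimes> L) H K L) (par C ?P L)"
      unfolding seven_def by (rule cotuple7_arr) (use objs in \<open>simp_all add: par_def\<close>)
    show "expand_left C H K L \<in> Hom C (par C ?P L) (seven ((H \<boxtimes> K) \<boxtimes> L) H K L)"
      using objs by simp
  next
    fix i :: "'m option \<times> 'm option \<times> 'm option"
    assume i: "i \<in> PPt H \<times> PPt K \<times> PPt L"
    then show "act (expand_left C H K L) (case i of (x, y, z) \<Rightarrow> par_point ?P L (par_point H K x y) z) =
        (case i of (x, y, z) \<Rightarrow> seven_point (\<lambda>a b c. (a \<star> b) \<star> c) ((H \<boxtimes> K) \<boxtimes> L) H K L x y z)"
      using objs by (auto simp: act_expand_left)
    obtain x y z where xyz: "i = (x, y, z)" by (cases i)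
    have "act ?J (seven_point (\<lambda>a b c. (a \<star> b) \<star> c) ((H \<boxtimes> K) \<boxtimes> L) H K L x y z) =
        par_point ?P L (par_point H K x y) z"
      apply (subst act_cotuple7[OF gen, where X = "par C ?P L"])
      using objs i xyz apply (simp_all add: par_def)
      apply (cases x; cases y; cases z; simp add: par_def)
      done
    then show "act ?J (case i of (x, y, z) \<Rightarrow> seven_point (\<lambda>a b c. (a \<star> b) \<star> c) ((H \<boxtimes> K) \<boxtimes> L) H K L x y z) =
        (case i of (x, y, z) \<Rightarrow> par_point ?P L (par_point H K x y) z)"
      by (simp add: xyz)
  qed
qed

text \<open>As on the left, with the roles shifted: now HK and HL come from the outer tensor, and KL
  lies inside the summand \<open>?P\<close>.\<close>

lemma iso_expand_right [simp]:
  assumes gen: "generated H" "generated K" "generated L"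
  shows "isomorphism C (expand_right C H K L)"
proof -
  have objs: "H \<in> Obj C" "K \<in> Obj C" "L \<in> Obj C" using gen generated_Obj by auto
  let ?P = "par C K L"
  let ?J = "cotuple7
    (injl C (H \<boxtimes> ?P) (H \<boxplus> ?P) \<cdot> tensor_arrow C (ident C H) (injl C (K \<boxtimes> L) (K \<boxplus> L)))
    (injl C (H \<boxtimes> ?P) (H \<boxplus> ?P) \<cdot> tensor_arrow C (ident C H) (injr C (K \<boxtimes> L) (K \<boxplus> L) \<cdot> injl C K L))
    (injl C (H \<boxtimes> ?P) (H \<boxplus> ?P) \<cdot> tensor_arrow C (ident C H) (injr C (K \<boxtimes> L) (K \<boxplus> L) \<cdot> injr C K L))
    (injr C (H \<boxtimes> ?P) (H \<boxplus> ?P) \<cdot> injr C H ?P \<cdot> injl C (K \<boxtimes> L) (K \<boxplus> L))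
    (injr C (H \<boxtimes> ?P) (H \<boxplus> ?P) \<cdot> injl C H ?P)
    (injr C (H \<boxtimes> ?P) (H \<boxplus> ?P) \<cdot> injr C H ?P \<cdot> injr C (K \<boxtimes> L) (K \<boxplus> L) \<cdot> injl C K L)
    (injr C (H \<boxtimes> ?P) (H \<boxplus> ?P) \<cdot> injr C H ?P \<cdot> injr C (K \<boxtimes> L) (K \<boxplus> L) \<cdot> injr C K L)"
  show ?thesis
  proof (rule determines_isoI)
    show "determines ((\<lambda>(x, y, z). par_point H ?P x (par_point K L y z)) ` (PPt H \<times> PPt K \<times> PPt L))
      (par C H ?P)"
      using determines_par[OF determines_PPt[OF gen(1)]
          determines_par[OF determines_PPt[OF gen(2)] determines_PPt[OF gen(3)]]]
      by (rule back_subst[of "\<lambda>S. determines S (par C H ?P)"]) force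
    obtain Q1 Q2 where 1: "resolves (K \<boxtimes> L) ((\<lambda>(p, q). p \<star> q) ` (Pt K \<times> Pt L)) Q1"
      and 2: "resolves (H \<boxtimes> K \<boxtimes> L) ((\<lambda>(p, q). p \<star> q) ` (Pt H \<times> (\<lambda>(p, q). p \<star> q) ` (Pt K \<times> Pt L))) Q2"
      using resolves_tensor_points gen by meson
    have "(\<lambda>(p, q). p \<star> q) ` (Pt H \<times> (\<lambda>(p, q). p \<star> q) ` (Pt K \<times> Pt L)) =
      (\<lambda>(a, b, c). a \<star> b \<star> c) ` (Pt H \<times> Pt K \<times> Pt L)" by force
    then show "determines ((\<lambda>(x, y, z). seven_point (\<lambda>a b c. a \<star> b \<star> c) (H \<boxtimes> K \<boxtimes> L) H K L x y z) `
        (PPt H \<times> PPt K \<times> PPt L)) (seven (H \<boxtimes> K \<boxtimes> L) H K L)"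
      using 2 by (intro determines_seven[OF gen]) simp
    show "?J \<in> Hom C (seven (H \<boxtimes> K \<boxtimes> L) H K L) (par C H ?P)"
      unfolding seven_def by (rule cotuple7_arr) (use objs in \<open>simp_all add: par_def\<close>)
    show "expand_right C H K L \<in> Hom C (par C H ?P) (seven (H \<boxtimes> K \<boxtimes> L) H K L)"
      using objs by simp
  next
    fix i :: "'m option \<times> 'm option \<times> 'm option"
    assume i: "i \<in> PPt H \<times> PPt K \<times> PPt L"
    then show "act (expand_right C H K L) (case i of (x, y, z) \<Rightarrow> par_point H ?P x (par_point K L y z)) =
        (case i of (x, y, z) \<Rightarrow> seven_point (\<lambda>a b c. a \<star> b \<star> c) (H \<boxtimes> K \<boxtimes> L) H K L x y z)"
      using objs by (auto simp: act_expand_right)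
    obtain x y z where xyz: "i = (x, y, z)" by (cases i)
    have "act ?J (seven_point (\<lambda>a b c. a \<star> b \<star> c) (H \<boxtimes> K \<boxtimes> L) H K L x y z) =
        par_point H ?P x (par_point K L y z)"
      apply (subst act_cotuple7[OF gen, where X = "par C H ?P"])
      using objs i xyz apply (simp_all add: par_def)
      apply (cases x; cases y; cases z; simp add: par_def)
      done
    then show "act ?J (case i of (x, y, z) \<Rightarrow> seven_point (\<lambda>a b c. a \<star> b \<star> c) (H \<boxtimes> K \<boxtimes> L) H K L x y z) =
        (case i of (x, y, z) \<Rightarrow> par_point H ?P x (par_point K L y z))"
      by (simp add: xyz)
  qed
qed

lemma biprod_arrow_tuple7:
  assumes "f1 \<in> Pt A1" "f2 \<in> Pt A2" "f3 \<in> Pt A3" "f4 \<in> Pt A4" "f5 \<in> Pt A5" "f6 \<in> Pt A6" "f7 \<in> Pt A7"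
    and "g \<in> Hom C A1 B"
  shows "biprod_arrow C g (ident C (A2 \<boxplus> A3 \<boxplus> A4 \<boxplus> A5 \<boxplus> A6 \<boxplus> A7)) \<cdot> tuple7 f1 f2 f3 f4 f5 f6 f7 =
    tuple7 (g \<cdot> f1) f2 f3 f4 f5 f6 f7"
proof -
  have "A2 \<in> Obj C" "A3 \<in> Obj C" "A4 \<in> Obj C" "A5 \<in> Obj C" "A6 \<in> Obj C" "A7 \<in> Obj C"
    using assms by auto
  then show ?thesis using assms by (simp add: tuple7_def)
qed

lemma seven_component_iso:
  assumes "H \<in> Obj C" "K \<in> Obj C" "L \<in> Obj C"
  defines "a \<equiv> biprod_arrow C (tensor_assoc C H K L)
    (ident C ((H \<boxtimes> K) \<boxplus> (H \<boxtimes> L) \<boxplus> (K \<boxtimes> L) \<boxplus> H \<boxplus> K \<boxplus> L))"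
  shows "isomorphism C a" "Dom C a = seven ((H \<boxtimes> K) \<boxtimes> L) H K L" "Cod C a = seven (H \<boxtimes> K \<boxtimes> L) H K L"
    and "x \<in> PPt H \<Longrightarrow> y \<in> PPt K \<Longrightarrow> z \<in> PPt L \<Longrightarrow>
      act a (seven_point (\<lambda>a b c. (a \<star> b) \<star> c) ((H \<boxtimes> K) \<boxtimes> L) H K L x y z) =
      seven_point (\<lambda>a b c. a \<star> b \<star> c) (H \<boxtimes> K \<boxtimes> L) H K L x y z"
proof -
  show "isomorphism C a" "Dom C a = seven ((H \<boxtimes> K) \<boxtimes> L) H K L" "Cod C a = seven (H \<boxtimes> K \<boxtimes> L) H K L"
    using assms by (simp_all add: seven_def)
  show "act a (seven_point (\<lambda>a b c. (a \<star> b) \<star> c) ((H \<boxtimes> K) \<boxtimes> L) H K L x y z) =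
      seven_point (\<lambda>a b c. a \<star> b \<star> c) (H \<boxtimes> K \<boxtimes> L) H K L x y z"
    if "x \<in> PPt H" "y \<in> PPt K" "z \<in> PPt L"
    using assms(1-3) that
    by (cases x; cases y; cases z) (simp_all add: a_def seven_point_def biprod_arrow_tuple7)
qed

section \<open>The associator and its action on partial points\<close>

lemma iso_par_assoc [simp]:
  assumes "generated H" "generated K" "generated L"
  shows "isomorphism C (par_assoc C H K L)"
  unfolding par_assoc_def
  using assms seven_component_iso[of H K L] by (simp add: generated_Obj isomorphism_arr)

lemma par_assoc_arr [simp]:
  assumes "generated H" "generated K" "generated L"
  shows "par_assoc C H K L \<in> Arr C" "Dom C (par_assoc C H K L) = par C (par C H K) L"
    "Cod C (par_assoc C H K L) = par C H (par C K L)"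
  unfolding par_assoc_def
  using assms seven_component_iso(1-3)[of H K L] by (simp_all add: generated_Obj isomorphism_arr)

text \<open>Both bracketings have the same normal form up to the associator of the tensor on the
  first summand. Every later equation about \<open>par_assoc\<close> is derived from this
  rule.\<close>

lemma act_par_assoc [simp]:
  assumes "generated H" "generated K" "generated L" "x \<in> PPt H" "y \<in> PPt K" "z \<in> PPt L"
  shows "act (par_assoc C H K L) (par_point (par C H K) L (par_point H K x y) z) =
    par_point H (par C K L) x (par_point K L y z)"
proof -
  have objs: "H \<in> Obj C" "K \<in> Obj C" "L \<in> Obj C" using assms generated_Obj by auto
  note s = seven_component_iso[OF objs]
  have "act (par_assoc C H K L) (par_point (par C H K) L (par_point H K x y) z) =
      act (inv_arrow C (expand_right C H K L)) (act (expand_right C H K L)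
        (par_point H (par C K L) x (par_point K L y z)))"
    unfolding par_assoc_def using assms objs s isomorphism_arr[OF s(1)]
    by (simp add: act_expand_left act_expand_right seven_point_PPt)
  then show ?thesis using assms objs by simp
qed

end

section \<open>Points of lists of wires\<close>

context distributive_semiadditive_category
begin

abbreviation csem :: "colour \<Rightarrow> 'o" where "csem \<equiv> colour_sem C"
abbreviation osem :: "colour list \<Rightarrow> 'o" where "osem \<equiv> obj_sem C"

lemma generated_colour_sem [simp]: "generated (csem A)"
proof (induction A)
  case Zero
  show ?case using generatedI[OF resolves_zeroO] by simp
next
  case One
  show ?case using generatedI[OF resolves_unitO] by simp
next
  case (Oplus A B)
  then show ?case using generatedI[OF resolves_biprod] by simp
next
  case (Otimes A B)
  then show ?case using generatedI resolves_tensor_points by (metis colour_sem.simps(4))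
qed

lemma colour_sem_Obj [simp]: "csem A \<in> Obj C"
  by (rule generated_Obj) simp

lemma obj_sem_snoc: "obj_sem C (X @ [B]) = (if X = [] then csem B else par C (osem X) (csem B))"
  by (cases X) simp_all

lemma generated_obj_sem [simp]: "generated (osem X)"
  by (induction X rule: rev_induct)
    (simp_all add: obj_sem_snoc generatedI[OF resolves_zeroO] del: obj_sem.simps(2))

lemma obj_sem_Obj [simp]: "osem X \<in> Obj C"
  by (rule generated_Obj) simp

text \<open>The recursion runs from the right end because \<open>obj_sem\<close> nests to the left.
  One wire is a separate case: \<open>[A]\<close> denotes the object of \<open>A\<close> itself and
  not its product with the unit 0.\<close>

function list_point :: "colour list \<Rightarrow> 'm option list \<Rightarrow> 'm option" where
  "list_point X xs =
    (if X = [] then None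
     else if butlast X = [] then last xs
     else par_point (osem (butlast X)) (csem (last X)) (list_point (butlast X) (butlast xs)) (last xs))"
  by pat_completeness auto
termination by (relation "measure (\<lambda>(X, xs). length X)") auto

declare list_point.simps [simp del]

lemma list_point_Nil [simp]: "list_point [] xs = None"
  by (simp add: list_point.simps)

lemma list_point_single [simp]: "list_point [A] [x] = x"
  by (simp add: list_point.simps)

lemma list_point_snoc:
  "list_point (X @ [B]) (xs @ [y]) =
    (if X = [] then y else par_point (osem X) (csem B) (list_point X xs) y)"
  by (subst list_point.simps) simp

lemma list_point_pair [simp]: "list_point [A, B] [x, y] = par_point (csem A) (csem B) x y"
  using list_point_snoc[of "[A]" B "[x]" y] by simp

abbreviation points :: "colour list \<Rightarrow> 'm option list \<Rightarrow> bool" where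
  "points \<equiv> list_all2 (\<lambda>A x. x \<in> PPt (csem A))"

lemma points_snocE:
  assumes "points (X @ [B]) xs"
  obtains xs' y where "xs = xs' @ [y]" "points X xs'" "y \<in> PPt (csem B)"
  using assms by (auto simp: list_all2_append1 list_all2_Cons1)

lemma list_point_PPt [simp]: "points X xs \<Longrightarrow> list_point X xs \<in> PPt (osem X)"
proof (induction X arbitrary: xs rule: rev_induct)
  case (snoc B X)
  then show ?case by (auto elim!: points_snocE simp: list_point_snoc obj_sem_snoc)
qed simp

text \<open>By \<open>determines_par\<close>, appending a wire multiplies the test points by the
  partial points of that wire.\<close>

lemma determines_list_point: "determines (list_point X ` {xs. points X xs}) (osem X)"
proof (induction X rule: rev_induct)
  case Nil
  then show ?case using determines_zeroO by (simp add: image_constant_conv)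
next
  case (snoc B X)
  show ?case
  proof (cases "X = []")
    case True
    have "list_point [B] ` {xs. points [B] xs} = PPt (csem B)"
      by (force simp: list_all2_Cons1)
    then show ?thesis using True determines_PPt by simp
  next
    case False
    have "(\<lambda>(x, y). par_point (osem X) (csem B) x y) ` (list_point X ` {xs. points X xs} \<times> PPt (csem B)) =
        list_point (X @ [B]) ` {xs. points (X @ [B]) xs}" (is "?l = ?r")
    proof
      show "?l \<subseteq> ?r"
      proof clarify
        fix xs y assume "points X xs" "y \<in> PPt (csem B)"
        then show "par_point (osem X) (csem B) (list_point X xs) y \<in> ?r"
          using False list_point_snoc[of X B xs y] by (intro image_eqI[of _ _ "xs @ [y]"])
            (simp_all add: list_all2_appendI)
      qed
      show "?r \<subseteq> ?l"
      proof clarify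
        fix xs assume "points (X @ [B]) xs"
        then obtain xs' y where "xs = xs' @ [y]" "points X xs'" "y \<in> PPt (csem B)"
          by (rule points_snocE)
        then show "list_point (X @ [B]) xs \<in> ?l"
          using False by (intro image_eqI[of _ _ "(list_point X xs', y)"]) (simp_all add: list_point_snoc)
      qed
    qed
    then show ?thesis
      using determines_par[OF snoc determines_PPt[OF generated_colour_sem[of B]]] False
      by (simp add: obj_sem_snoc)
  qed
qed

section \<open>The isomorphisms \<open>join\<close>\<close>

lemma list_point_par_eqI:
  assumes "f \<in> Hom C (par C (osem X) (osem Y)) Z" "g \<in> Hom C (par C (osem X) (osem Y)) Z"
    and "\<And>xs ys. points X xs \<Longrightarrow> points Y ys \<Longrightarrow>
      act f (par_point (osem X) (osem Y) (list_point X xs) (list_point Y ys)) =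
      act g (par_point (osem X) (osem Y) (list_point X xs) (list_point Y ys))"
  shows "f = g"
  by (rule determines_eqI[OF determines_par[OF determines_list_point determines_list_point] assms(1,2)])
    (use assms(3) in auto)

text \<open>On points \<open>join\<close> is concatenation. Invertibility, endpoints and action are
  proved together, since peeling off the last wire of \<open>Y\<close> uses all of them for the
  shorter list.\<close>

lemma join_spec:
  "isomorphism C (join C X Y) \<and> Dom C (join C X Y) = par C (osem X) (osem Y) \<and>
   Cod C (join C X Y) = osem (X @ Y) \<and>
   (\<forall>xs ys. points X xs \<longrightarrow> points Y ys \<longrightarrow>
     act (join C X Y) (par_point (osem X) (osem Y) (list_point X xs) (list_point Y ys)) =
     list_point (X @ Y) (xs @ ys))"
proof (cases "X = []")
  case True
  then show ?thesis by (auto simp: join.simps)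
next
  case X: False
  show ?thesis
  proof (induction Y rule: rev_induct)
    case Nil
    then show ?case using X by (auto simp: join.simps)
  next
    case (snoc B Y)
    show ?case
    proof (cases "Y = []")
      case True
      then show ?thesis
        using X by (auto simp: join.simps obj_sem_snoc list_point_snoc list_all2_Cons1)
    next
      case False
      have join: "join C X (Y @ [B]) = par_arrow C (join C X Y) (ident C (csem B)) \<cdot>
          inv_arrow C (par_assoc C (osem X) (osem Y) (csem B))"
        using X False by (subst join.simps) simp
      have arr: "join C X Y \<in> Arr C" using snoc isomorphism_arr by blast
      have "act (join C X (Y @ [B])) (par_point (osem X) (osem (Y @ [B])) (list_point X xs) (list_point (Y @ [B]) ys)) =
          list_point (X @ Y @ [B]) (xs @ ys)" if xs: "points X xs" and ys: "points (Y @ [B]) ys" for xs ys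
      proof -
        obtain ys' y where y: "ys = ys' @ [y]" "points Y ys'" "y \<in> PPt (csem B)"
          using ys by (rule points_snocE)
        let ?a = "par_assoc C (osem X) (osem Y) (csem B)"
        let ?p = "par_point (par C (osem X) (osem Y)) (csem B)
          (par_point (osem X) (osem Y) (list_point X xs) (list_point Y ys')) y"
        \<comment> \<open>The inverse associator is evaluated by presenting its argument as the
          image of the left-bracketed point \<open>?p\<close>.\<close>
        have "act (inv_arrow C ?a) (act ?a ?p) = ?p"
          by (rule act_inv) (use xs y in simp_all)
        then have "act (join C X (Y @ [B])) (act ?a ?p) = act (par_arrow C (join C X Y) (ident C (csem B))) ?p"
          unfolding join using xs y arr snoc by simp
        also have "\<dots> = list_point (X @ Y @ [B]) (xs @ ys)"
          using xs y arr snoc X list_point_snoc[of "X @ Y" B "xs @ ys'" y] by simp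
        finally show ?thesis using xs y False by (simp add: obj_sem_snoc list_point_snoc)
      qed
      then show ?thesis
        using snoc arr X False obj_sem_snoc[of "X @ Y" B] by (simp add: join obj_sem_snoc)
    qed
  qed
qed

lemma join_arr [simp]:
  "isomorphism C (join C X Y)" "join C X Y \<in> Arr C" "Dom C (join C X Y) = par C (osem X) (osem Y)"
  "Cod C (join C X Y) = osem (X @ Y)"
  using join_spec[of X Y] isomorphism_arr by blast+

lemma act_join [simp]:
  "points X xs \<Longrightarrow> points Y ys \<Longrightarrow>
    act (join C X Y) (par_point (osem X) (osem Y) (list_point X xs) (list_point Y ys)) =
    list_point (X @ Y) (xs @ ys)"
  using join_spec[of X Y] by blast

lemma act_inv_join [simp]:
  assumes "points X xs" "points Y ys"
  shows "act (inv_arrow C (join C X Y)) (list_point (X @ Y) (xs @ ys)) =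
    par_point (osem X) (osem Y) (list_point X xs) (list_point Y ys)"
  using assms act_inv[of "join C X Y" "par_point (osem X) (osem Y) (list_point X xs) (list_point Y ys)"]
  by simp

text \<open>Both sides concatenate three lists of partial points, so associativity of append takes
  the place of a coherence theorem for \<open>par\<close>.\<close>

lemma join_coherence:
  "join C (X @ Y) Z \<cdot> par_arrow C (join C X Y) (ident C (osem Z)) =
   join C X (Y @ Z) \<cdot> par_arrow C (ident C (osem X)) (join C Y Z) \<cdot> par_assoc C (osem X) (osem Y) (osem Z)"
proof (rule determines_eqI)
  show "determines ((\<lambda>(p, z). par_point (par C (osem X) (osem Y)) (osem Z) p z) `
     ((\<lambda>(x, y). par_point (osem X) (osem Y) x y) `
       (list_point X ` {xs. points X xs} \<times> list_point Y ` {xs. points Y xs}) \<times>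
       list_point Z ` {xs. points Z xs})) (par C (par C (osem X) (osem Y)) (osem Z))"
    by (intro determines_par determines_list_point)
qed (auto simp: list_all2_appendI)

section \<open>Naturality and symmetry laws of \<open>par\<close>\<close>

lemma par_assoc_natural:
  assumes "generated (Dom C f)" "generated (Dom C g)" "generated (Dom C h)"
    "generated (Cod C f)" "generated (Cod C g)" "generated (Cod C h)"
    and arr: "f \<in> Arr C" "g \<in> Arr C" "h \<in> Arr C"
  shows "par_assoc C (Cod C f) (Cod C g) (Cod C h) \<cdot> par_arrow C (par_arrow C f g) h =
    par_arrow C f (par_arrow C g h) \<cdot> par_assoc C (Dom C f) (Dom C g) (Dom C h)"
proof (rule determines_eqI)
  show "determines ((\<lambda>(p, z). par_point (par C (Dom C f) (Dom C g)) (Dom C h) p z) `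
     ((\<lambda>(x, y). par_point (Dom C f) (Dom C g) x y) ` (PPt (Dom C f) \<times> PPt (Dom C g)) \<times> PPt (Dom C h)))
     (par C (par C (Dom C f) (Dom C g)) (Dom C h))"
    by (intro determines_par determines_PPt assms)
qed (use assms in auto)

lemma par_symm_natural:
  assumes "generated (Dom C f)" "generated (Dom C g)" "f \<in> Arr C" "g \<in> Arr C"
  shows "par_symm C (Cod C f) (Cod C g) \<cdot> par_arrow C f g = par_arrow C g f \<cdot> par_symm C (Dom C f) (Dom C g)"
  by (rule determines_eqI[OF determines_par[OF determines_PPt[OF assms(1)] determines_PPt[OF assms(2)]]])
    (use assms in auto)

lemma par_symm_inverse:
  assumes "generated A" "generated B"
  shows "par_symm C B A \<cdot> par_symm C A B = ident C (par C A B)"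
  by (rule determines_eqI[OF determines_par[OF determines_PPt[OF assms(1)] determines_PPt[OF assms(2)]]])
    (use assms in \<open>auto simp: generated_Obj\<close>)

lemma par_unit_natural:
  assumes "f \<in> Arr C"
  shows "par_lunit C (Cod C f) \<cdot> par_arrow C (ident C (zeroO C)) f = f \<cdot> par_lunit C (Dom C f)"
    "par_runit C (Cod C f) \<cdot> par_arrow C f (ident C (zeroO C)) = f \<cdot> par_runit C (Dom C f)"
  using assms by (simp_all add: par_lunit_def par_runit_def par_arrow_def)

section \<open>Canonical isomorphisms and adapters\<close>

lemma canonical_iso_arr:
  "canonical_iso C A B f \<Longrightarrow> isomorphism C f \<and> Dom C f = csem A \<and> Cod C f = csem B"
proof (induction rule: canonical_iso.induct)
  case (oplus_runit A)
  have "injl C (csem A) (zeroO C) \<cdot> prjl C (csem A) (zeroO C) = ident C (csem A \<boxplus> zeroO C)"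
    by (rule pairing_eqI[of _ _ "csem A" "zeroO C"]) (auto intro: eq_to_zero)
  then have "isomorphism C (biprod_runit C (csem A))"
    by (intro isomorphismI[of _ "injl C (csem A) (zeroO C)"]) (simp_all add: biprod_runit_def)
  then show ?case by (simp add: biprod_runit_def)
next
  case (oplus_lunit A)
  have "injr C (zeroO C) (csem A) \<cdot> prjr C (zeroO C) (csem A) = ident C (zeroO C \<boxplus> csem A)"
    by (rule pairing_eqI[of _ _ "zeroO C" "csem A"]) (auto intro: eq_to_zero)
  then have "isomorphism C (biprod_lunit C (csem A))"
    by (intro isomorphismI[of _ "injr C (zeroO C) (csem A)"]) (simp_all add: biprod_lunit_def)
  then show ?case by (simp add: biprod_lunit_def)
next
  case (oplus_assoc A B D)
  let ?A = "csem A" and ?B = "csem B" and ?D = "csem D"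
  let ?g = "pairing C (pairing C (prjl C ?A (?B \<boxplus> ?D)) (prjl C ?B ?D \<cdot> prjr C ?A (?B \<boxplus> ?D)))
    (prjr C ?B ?D \<cdot> prjr C ?A (?B \<boxplus> ?D))"
  have "isomorphism C (biprod_assoc C ?A ?B ?D)"
  proof (rule isomorphismI[of _ ?g])
    show "?g \<cdot> biprod_assoc C ?A ?B ?D = ident C (Dom C (biprod_assoc C ?A ?B ?D))"
      by (rule pairing_eqI[of _ _ "?A \<boxplus> ?B" ?D], simp_all add: biprod_assoc_def)
        (rule pairing_eqI[of _ _ ?A ?B], simp_all)
    show "biprod_assoc C ?A ?B ?D \<cdot> ?g = ident C (Cod C (biprod_assoc C ?A ?B ?D))"
      by (rule pairing_eqI[of _ _ ?A "?B \<boxplus> ?D"], simp_all add: biprod_assoc_def)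
        (rule pairing_eqI[of _ _ ?B ?D], simp_all)
  qed (simp_all add: biprod_assoc_def)
  then show ?case by (simp add: biprod_assoc_def)
qed (auto simp: isomorphism_arr)

lemma canonical_iso_exists: "A \<approx> B \<Longrightarrow> \<exists>f. canonical_iso C A B f"
  by (induction rule: colour_equiv.induct) (blast intro: canonical_iso.intros)+

text \<open>Every derivation of \<open>A \<approx> B\<close> yields an invertible arrow with these
  endpoints, so these properties hold whichever arrow the choice operator returns.\<close>

lemma adapter_sem_iso:
  assumes "A \<approx> B"
  shows "isomorphism C (adapter_sem C A B)" "adapter_sem C A B \<in> Arr C"
    "Dom C (adapter_sem C A B) = csem A" "Cod C (adapter_sem C A B) = csem B"
proof -
  have "canonical_iso C A B (adapter_sem C A B)"
    unfolding adapter_sem_def using canonical_iso_exists[OF assms] by (rule someI_ex)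
  from canonical_iso_arr[OF this]
  show "isomorphism C (adapter_sem C A B)" "adapter_sem C A B \<in> Arr C"
    "Dom C (adapter_sem C A B) = csem A" "Cod C (adapter_sem C A B) = csem B"
    using isomorphism_arr by auto
qed

end

section \<open>Soundness of the semantics\<close>

lemma wire_swap_simps [simp]:
  fixes A :: colour and Y :: "colour list"
  defines "w \<equiv> wire_swap A Y :: 'r diagram"
  shows "wf_diagram R w" "src w = A # Y" "tgt w = Y @ [A]"
  unfolding w_def by (induction Y) simp_all

lemma block_swap_simps [simp]:
  fixes X Y :: "colour list"
  defines "w \<equiv> block_swap X Y :: 'r diagram"
  shows "wf_diagram R w" "src w = X @ Y" "tgt w = Y @ X"
  unfolding w_def by (induction X) simp_all

locale ftp_semantics = distributive_semiadditive_category C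
  for C :: "('o, 'm, 'y) bimonoidal_category_scheme" (structure) +
  fixes R :: "('r, 'x) ring_scheme" and scal :: "'r \<Rightarrow> 'm"
  assumes scal_iso: "scal \<in> semiring_iso R (endo_semiring C)"
begin

abbreviation sem :: "'r diagram \<Rightarrow> 'm" where "sem \<equiv> term_sem C scal"

lemma scal_arr [simp]:
  assumes "s \<in> carrier R"
  shows "scal s \<in> Arr C" "Dom C (scal s) = unitO C" "Cod C (scal s) = unitO C"
proof -
  have "scal \<in> carrier R \<rightarrow> Hom C (unitO C) (unitO C)"
    using scal_iso by (simp add: semiring_iso_def ring_iso_def ring_hom_def endo_semiring_def)
  then show "scal s \<in> Arr C" "Dom C (scal s) = unitO C" "Cod C (scal s) = unitO C"
    using assms by (auto simp: Pi_iff)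
qed

lemma scal_surj:
  assumes "k \<in> Hom C (unitO C) (unitO C)"
  obtains s where "s \<in> carrier R" "scal s = k"
proof -
  have "bij_betw scal (carrier R) (Hom C (unitO C) (unitO C))"
    using scal_iso by (simp add: semiring_iso_def ring_iso_def endo_semiring_def)
  then show ?thesis using assms that by (metis bij_betw_imp_surj_on imageE)
qed

section \<open>Typing of the semantics and routing of points\<close>

lemma sem_Hom: "wf_diagram R d \<Longrightarrow> sem d \<in> Hom C (osem (src d)) (osem (tgt d))"
proof (induction d)
  case (Scalar s A)
  then show ?case by (simp add: scalar_mult_def)
qed (simp_all add: adapter_sem_iso, simp_all add: par_def)

lemma sem_arr [simp]:
  assumes "wf_diagram R d"
  shows "sem d \<in> Arr C" "Dom C (sem d) = osem (src d)" "Cod C (sem d) = osem (tgt d)"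
  using sem_Hom[OF assms] by simp_all

text \<open>A relation asserted input by input, because a diagram need not send list points to list
  points: copying a wire, for instance, produces a sum of two of them.\<close>

definition routes :: "'r diagram \<Rightarrow> 'm option list \<Rightarrow> 'm option list \<Rightarrow> bool" where
  "routes d xs ys \<longleftrightarrow> wf_diagram R d \<and> points (src d) xs \<and> points (tgt d) ys \<and>
     act (sem d) (list_point (src d) xs) = list_point (tgt d) ys"

lemma routes_Wires: "points X xs \<Longrightarrow> routes (Wires X) xs xs"
  by (simp add: routes_def)

lemma routes_Swap: "points [A, B] [x, y] \<Longrightarrow> routes (Swap A B) [x, y] [y, x]"
  by (simp add: routes_def)

lemma routes_Comp: "routes e ys zs \<Longrightarrow> routes d xs ys \<Longrightarrow> src e = tgt d \<Longrightarrow> routes (Comp e d) xs zs"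
  by (auto simp: routes_def)

lemma act_sem_Par:
  assumes "wf_diagram R d" "wf_diagram R e" "points (src d) xs" "points (src e) ys"
  shows "act (sem (Par d e)) (list_point (src d @ src e) (xs @ ys)) =
    act (join C (tgt d) (tgt e)) (par_point (osem (tgt d)) (osem (tgt e))
      (act (sem d) (list_point (src d) xs)) (act (sem e) (list_point (src e) ys)))"
  using assms by (simp add: list_all2_appendI)

lemma routes_Par: "routes d xs xs' \<Longrightarrow> routes e ys ys' \<Longrightarrow> routes (Par d e) (xs @ ys) (xs' @ ys')"
  using act_sem_Par[of d e xs ys] unfolding routes_def by (simp add: list_all2_appendI)

lemma routes_wire_swap:
  assumes "points (A # Y) (x # ys)"
  shows "routes (wire_swap A Y) (x # ys) (ys @ [x])"
  using assms
proof (induction Y arbitrary: ys)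
  case Nil
  then show ?case using routes_Wires[of "[A]" "[x]"] by simp
next
  case (Cons B Y)
  then obtain y ys' where ys: "ys = y # ys'" "y \<in> PPt (csem B)" "points Y ys'" "x \<in> PPt (csem A)"
    by (auto simp: list_all2_Cons1)
  have "routes (Par (Swap A B) (Wires Y)) ([x, y] @ ys') ([y, x] @ ys')"
    using ys by (intro routes_Par routes_Swap routes_Wires) simp_all
  moreover have "routes (Par (Wires [B]) (wire_swap A Y)) ([y] @ x # ys') ([y] @ ys' @ [x])"
    using ys by (intro routes_Par routes_Wires Cons.IH) simp_all
  ultimately show ?case using ys routes_Comp by fastforce
qed

lemma routes_block_swap:
  assumes "points X xs" "points Y ys"
  shows "routes (block_swap X Y) (xs @ ys) (ys @ xs)"
  using assms
proof (induction X arbitrary: xs)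
  case Nil
  then show ?case using routes_Wires[of Y ys] by simp
next
  case (Cons A X)
  then obtain x xs' where xs: "xs = x # xs'" "x \<in> PPt (csem A)" "points X xs'"
    by (auto simp: list_all2_Cons1)
  have "routes (Par (Wires [A]) (block_swap X Y)) ([x] @ xs' @ ys) ([x] @ ys @ xs')"
    using xs Cons by (intro routes_Par routes_Wires Cons.IH) simp_all
  moreover have "routes (Par (wire_swap A Y) (Wires X)) ((x # ys) @ xs') ((ys @ [x]) @ xs')"
    using xs Cons by (intro routes_Par routes_Wires routes_wire_swap) simp_all
  ultimately show ?case using xs routes_Comp by fastforce
qed

text \<open>Up to \<open>join\<close>, the swap assembled from adjacent transpositions is a single
  symmetry of \<open>par\<close>: both exchange the two lists of partial points.\<close>

lemma sem_block_swap:
  "sem (block_swap X Y) \<cdot> join C X Y = join C Y X \<cdot> par_symm C (osem X) (osem Y)"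
proof (rule list_point_par_eqI)
  fix xs ys assume xy: "points X xs" "points Y ys"
  then show "act (sem (block_swap X Y) \<cdot> join C X Y) (par_point (osem X) (osem Y) (list_point X xs) (list_point Y ys)) =
    act (join C Y X \<cdot> par_symm C (osem X) (osem Y)) (par_point (osem X) (osem Y) (list_point X xs) (list_point Y ys))"
    using routes_block_swap[OF xy] by (simp add: routes_def)
qed simp_all

text \<open>After precomposition with the canonical isomorphism \<open>?s\<close> from the
  left-bracketed triple, \<open>join_coherence\<close> at source and target and naturality of the
  associator in between give the equality; then \<open>?s\<close> is cancelled.\<close>

lemma sem_par_assoc:
  assumes "wf_diagram R c" "wf_diagram R d" "wf_diagram R e"
  shows "sem (Par (Par c d) e) = sem (Par c (Par d e))"
proof -
  let ?s = "join C (src c @ src d) (src e) \<cdot> par_arrow C (join C (src c) (src d)) (ident C (osem (src e)))"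
  let ?a = "par_assoc C (osem (src c)) (osem (src d)) (osem (src e))"
  let ?b = "par_assoc C (osem (tgt c)) (osem (tgt d)) (osem (tgt e))"
  have s: "?s = join C (src c) (src d @ src e) \<cdot> par_arrow C (ident C (osem (src c))) (join C (src d) (src e)) \<cdot> ?a"
    by (rule join_coherence)
  have nat: "?b \<cdot> par_arrow C (par_arrow C (sem c) (sem d)) (sem e) =
      par_arrow C (sem c) (par_arrow C (sem d) (sem e)) \<cdot> ?a"
    using assms par_assoc_natural[of "sem c" "sem d" "sem e"] by simp
  have L: "sem (Par (Par c d) e) \<cdot> ?s =
      (join C (tgt c @ tgt d) (tgt e) \<cdot> par_arrow C (join C (tgt c) (tgt d)) (ident C (osem (tgt e)))) \<cdot>
      par_arrow C (par_arrow C (sem c) (sem d)) (sem e)"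
    using assms by (simp add: par_arrow_comp)
  have de: "par_arrow C (sem c) (sem (Par d e)) \<cdot> par_arrow C (ident C (osem (src c))) (join C (src d) (src e)) =
      par_arrow C (ident C (osem (tgt c))) (join C (tgt d) (tgt e)) \<cdot>
      par_arrow C (sem c) (par_arrow C (sem d) (sem e))"
    using assms by (simp add: par_arrow_comp)
  have "sem (Par c (Par d e)) \<cdot> ?s = join C (tgt c) (tgt d @ tgt e) \<cdot>
      (par_arrow C (sem c) (sem (Par d e)) \<cdot> par_arrow C (ident C (osem (src c))) (join C (src d) (src e))) \<cdot> ?a"
    unfolding s using assms by simp
  then have R: "sem (Par c (Par d e)) \<cdot> ?s =
      join C (tgt c) (tgt d @ tgt e) \<cdot> par_arrow C (ident C (osem (tgt c))) (join C (tgt d) (tgt e)) \<cdot>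
      (par_arrow C (sem c) (par_arrow C (sem d) (sem e)) \<cdot> ?a)"
    unfolding de using assms by simp
  have "sem (Par (Par c d) e) \<cdot> ?s = sem (Par c (Par d e)) \<cdot> ?s"
    unfolding L R unfolding join_coherence nat[symmetric] using assms by simp
  then show ?thesis
    by (rule iso_epi) (use assms in simp_all)
qed

text \<open>Precomposed with \<open>join\<close>, both block swaps become symmetries, and the claim
  reduces to naturality of \<open>par_symm\<close>.\<close>

lemma sem_swap_natural:
  assumes "wf_diagram R d" "wf_diagram R e"
  shows "sem (Comp (block_swap (tgt d) (tgt e)) (Par d e)) = sem (Comp (Par e d) (block_swap (src d) (src e)))"
proof -
  have nat: "par_symm C (osem (tgt d)) (osem (tgt e)) \<cdot> par_arrow C (sem d) (sem e) =
      par_arrow C (sem e) (sem d) \<cdot> par_symm C (osem (src d)) (osem (src e))"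
    using assms par_symm_natural[of "sem d" "sem e"] by simp
  have "sem (Comp (block_swap (tgt d) (tgt e)) (Par d e)) \<cdot> join C (src d) (src e) =
      (sem (block_swap (tgt d) (tgt e)) \<cdot> join C (tgt d) (tgt e)) \<cdot> par_arrow C (sem d) (sem e)"
    using assms by simp
  also have "\<dots> = join C (tgt e) (tgt d) \<cdot> par_arrow C (sem e) (sem d) \<cdot> par_symm C (osem (src d)) (osem (src e))"
    unfolding sem_block_swap using assms by (simp add: nat)
  also have "\<dots> = sem (Comp (Par e d) (block_swap (src d) (src e))) \<cdot> join C (src d) (src e)"
    using assms sem_block_swap by simp
  finally show ?thesis
    by (rule iso_epi) (use assms in simp_all)
qed

lemma sem_par_unit:
  assumes "wf_diagram R d"
  shows "sem (Par (Wires []) d) = sem d" "sem (Par d (Wires [])) = sem d"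
proof -
  have l: "join C [] X = par_lunit C (osem X)" for X by (simp add: join.simps)
  have r: "join C X [] = par_runit C (osem X)" for X
  proof (cases "X = []")
    case True
    \<comment> \<open>For two empty lists \<open>join\<close> is defined by the left unitor, which
      agrees with the right one at 0 because its target is terminal.\<close>
    then show ?thesis by (auto simp: join.simps intro: eq_to_zero)
  qed (simp add: join.simps)
  have "sem (Par (Wires []) d) = (par_lunit C (osem (tgt d)) \<cdot> par_arrow C (ident C (zeroO C)) (sem d)) \<cdot>
      inv_arrow C (par_lunit C (osem (src d)))"
    using assms by (simp add: l)
  then show "sem (Par (Wires []) d) = sem d"
    using assms par_unit_natural(1)[of "sem d"] by (simp del: term_sem.simps comp_assoc) simp
  have "sem (Par d (Wires [])) = (par_runit C (osem (tgt d)) \<cdot> par_arrow C (sem d) (ident C (zeroO C))) \<cdot>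
      inv_arrow C (par_runit C (osem (src d)))"
    using assms by (simp add: r)
  then show "sem (Par d (Wires [])) = sem d"
    using assms par_unit_natural(2)[of "sem d"] by (simp del: term_sem.simps comp_assoc) simp
qed

text \<open>Well-formedness and endpoints are part of the induction because the semantic laws hold
  for composable arrows.\<close>

lemma prop_equiv_sound:
  "prop_equiv R d e \<Longrightarrow>
    wf_diagram R d \<and> wf_diagram R e \<and> src d = src e \<and> tgt d = tgt e \<and> sem d = sem e"
proof (induction rule: prop_equiv.induct)
  case (comp_ident_left d)
  then show ?case by simp
next
  case (par_assoc c d e)
  then show ?case using sem_par_assoc by simp
next
  case (par_unit_left d)
  then show ?case using sem_par_unit by simp
next
  case (par_unit_right d)
  then show ?case using sem_par_unit by simp
next
  case (interchange d e d' e')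
  then show ?case
    by (simp flip: par_arrow_comp)
next
  case (swap_inverse B A)
  then show ?case by (simp add: par_symm_inverse)
next
  case (swap_natural d e)
  then show ?case using sem_swap_natural by simp
qed simp_all

text \<open>Soundness makes the image of an equivalence class a singleton, so
  \<open>the_elem\<close> returns the semantics of any representative.\<close>

lemma diagram_sem_realises:
  assumes "wf_diagram R d" "src d = X" "tgt d = Y"
  shows "\<exists>D \<in> FTP R X Y. diagram_sem C scal D = sem d"
proof
  let ?r = "{(d, e). prop_equiv R d e}"
  have "sem ` (?r `` {d}) = {sem d}"
  proof
    show "sem ` (?r `` {d}) \<subseteq> {sem d}"
      by (auto dest: prop_equiv_sound)
    have "d \<in> ?r `` {d}" using prop_equiv.refl[OF assms(1)] by simp
    then show "{sem d} \<subseteq> sem ` (?r `` {d})" by blast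
  qed
  then show "diagram_sem C scal (?r `` {d}) = sem d"
    by (simp add: diagram_sem_def)
  show "?r `` {d} \<in> FTP R X Y"
    unfolding FTP_def using assms by (intro quotientI) simp
qed

end

section \<open>Fullness\<close>

text \<open>The left nesting copies that of \<open>obj_sem\<close>, so list and fused colour denote
  the same object on the nose.\<close>

primrec fuse :: "colour list \<Rightarrow> colour" where
  "fuse [] = Zero"
| "fuse (A # X) = foldl (\<lambda>A B. Oplus (Otimes A B) (Oplus A B)) A X"

lemma fuse_snoc: "fuse (X @ [B]) = (if X = [] then B else Oplus (Otimes (fuse X) B) (Oplus (fuse X) B))"
  by (cases X) simp_all

context ftp_semantics
begin

lemma colour_sem_fuse: "csem (fuse X) = osem X"
  by (induction X rule: rev_induct) (simp_all add: fuse_snoc obj_sem_snoc par_def)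

text \<open>Fullness is developed for terms; the passage to classes of terms is made once, by
  \<open>diagram_sem_realises\<close>.\<close>

definition realised :: "colour list \<Rightarrow> colour list \<Rightarrow> 'm \<Rightarrow> bool" where
  "realised X Y f \<longleftrightarrow> (\<exists>d. wf_diagram R d \<and> src d = X \<and> tgt d = Y \<and> sem d = f)"

lemma realisedI: "wf_diagram R d \<Longrightarrow> src d = X \<Longrightarrow> tgt d = Y \<Longrightarrow> sem d = f \<Longrightarrow> realised X Y f"
  unfolding realised_def by blast

lemma realised_arr:
  assumes "realised X Y f"
  shows "f \<in> Arr C" "Dom C f = osem X" "Cod C f = osem Y"
  using assms sem_arr unfolding realised_def by blast+

section \<open>Arrows between single colours denoted by small diagrams\<close>

lemma realised_comp: "realised Y Z g \<Longrightarrow> realised X Y f \<Longrightarrow> realised X Z (g \<cdot> f)"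
  unfolding realised_def by (metis src.simps(13) tgt.simps(13) wf_diagram.simps(13) term_sem.simps(13))

lemma join_single: "X \<noteq> [] \<Longrightarrow> join C X [B] = ident C (par C (osem X) (csem B))"
  by (simp add: join.simps obj_sem_snoc)

lemma realised_par_arrow:
  assumes "realised [A] [A'] f" "realised [B] [B'] g"
  shows "realised [A, B] [A', B'] (par_arrow C f g)"
proof -
  obtain d e where d: "wf_diagram R d" "src d = [A]" "tgt d = [A']" "sem d = f"
    and e: "wf_diagram R e" "src e = [B]" "tgt e = [B']" "sem e = g"
    using assms unfolding realised_def by blast
  have "sem (Par d e) = par_arrow C f g"
    using d e assms by (simp add: join_single realised_arr)
  then show ?thesis using d e by (intro realisedI[of "Par d e"]) simp_all
qed

lemma realised_ident: "realised X X (ident C (osem X))"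
  by (rule realisedI[of "Wires X"]) simp_all

text \<open>Mirrored Tensor before and Tensor after the juxtaposition cut out the tensor summand of
  \<open>par_arrow C f g\<close>.\<close>

lemma realised_tensor:
  assumes "realised [A] [A'] f" "realised [B] [B'] g"
  shows "realised [Otimes A B] [Otimes A' B'] (tensor_arrow C f g)"
proof -
  have "realised [A', B'] [Otimes A' B'] (prjl C (csem A' \<boxtimes> csem B') (csem A' \<boxplus> csem B'))"
    by (rule realisedI[of "Tensor A' B'"]) simp_all
  moreover have "realised [Otimes A B] [A, B] (injl C (csem A \<boxtimes> csem B) (csem A \<boxplus> csem B))"
    by (rule realisedI[of "TensorM A B"]) simp_all
  ultimately have "realised [Otimes A B] [Otimes A' B']
      (prjl C (csem A' \<boxtimes> csem B') (csem A' \<boxplus> csem B') \<cdot> par_arrow C f g \<cdot>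
       injl C (csem A \<boxtimes> csem B) (csem A \<boxplus> csem B))"
    using realised_comp realised_par_arrow[OF assms] by blast
  then show ?thesis
    using realised_arr[OF assms(1)] realised_arr[OF assms(2)] by (simp add: par_arrow_def)
qed

text \<open>Copy, apply \<open>f\<close> and \<open>g\<close> side by side, contract: on the
  biproduct summand this is the definition of the sum.\<close>

lemma realised_add:
  assumes "realised [A] [B] f" "realised [A] [B] g"
  shows "realised [A] [B] (add_arrow C f g)"
proof -
  let ?c = "codiagonal C (csem B) \<cdot> prjr C (csem B \<boxtimes> csem B) (csem B \<boxplus> csem B)"
  let ?d = "injr C (csem A \<boxtimes> csem A) (csem A \<boxplus> csem A) \<cdot> diagonal C (csem A)"
  have "realised [B, B] [B] ?c" by (rule realisedI[of "Contr B"]) simp_all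
  moreover have "realised [A] [A, A] ?d" by (rule realisedI[of "ContrM A"]) simp_all
  ultimately have "realised [A] [B] (?c \<cdot> par_arrow C f g \<cdot> ?d)"
    using realised_comp realised_par_arrow[OF assms] by blast
  moreover have "?c \<cdot> par_arrow C f g \<cdot> ?d = add_arrow C f g"
    using realised_arr[OF assms(1)] realised_arr[OF assms(2)]
    by (simp add: par_arrow_def add_arrow_def)
  ultimately show ?thesis by simp
qed

lemma realised_zero: "realised [A] [B] (zero_arrow C (csem A) (csem B))"
  by (rule realisedI[of "Comp (Null B) (NullM A)"]) simp_all

text \<open>The semantics of a juxtaposition contains an inverse \<open>join\<close>, which is an
  inverse unitor when one of the sources is empty.\<close>

lemma inv_par_unit:
  assumes "generated H"
  shows "inv_arrow C (par_lunit C H) = injr C (zeroO C \<boxtimes> H) (zeroO C \<boxplus> H) \<cdot> injr C (zeroO C) H"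
    "inv_arrow C (par_runit C H) = injr C (H \<boxtimes> zeroO C) (H \<boxplus> zeroO C) \<cdot> injl C H (zeroO C)"
proof -
  have H: "H \<in> Obj C" using assms generated_Obj by blast
  show "inv_arrow C (par_lunit C H) = injr C (zeroO C \<boxtimes> H) (zeroO C \<boxplus> H) \<cdot> injr C (zeroO C) H"
    by (rule iso_mono[of "par_lunit C H"]; use assms H in \<open>simp add: par_def\<close>; simp add: H par_lunit_def)
  show "inv_arrow C (par_runit C H) = injr C (H \<boxtimes> zeroO C) (H \<boxplus> zeroO C) \<cdot> injl C H (zeroO C)"
    by (rule iso_mono[of "par_runit C H"]; use assms H in \<open>simp add: par_def\<close>; simp add: H par_runit_def)
qed

text \<open>Split with mirrored Plus and end the unwanted wire with mirrored Null. The injections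
  below arise dually from Null and Plus.\<close>

lemma realised_prj:
  shows "realised [Oplus A B] [A] (prjl C (csem A) (csem B))"
    "realised [Oplus A B] [B] (prjr C (csem A) (csem B))"
proof -
  have "sem (Comp (Par (Wires [A]) (NullM B)) (PlusM A B)) = prjl C (csem A) (csem B)"
    by (simp add: join_single join.simps[of _ _ "[]"] par_runit_def par_arrow_def par_def)
  then show "realised [Oplus A B] [A] (prjl C (csem A) (csem B))"
    by (intro realisedI[of "Comp (Par (Wires [A]) (NullM B)) (PlusM A B)"]) simp_all
  have "sem (Comp (Par (NullM A) (Wires [B])) (PlusM A B)) = prjr C (csem A) (csem B)"
    by (simp add: join_single join.simps[of _ "[]"] par_lunit_def par_arrow_def par_def)
  then show "realised [Oplus A B] [B] (prjr C (csem A) (csem B))"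
    by (intro realisedI[of "Comp (Par (NullM A) (Wires [B])) (PlusM A B)"]) simp_all
qed

lemma realised_inj:
  shows "realised [A] [Oplus A B] (injl C (csem A) (csem B))"
    "realised [B] [Oplus A B] (injr C (csem A) (csem B))"
proof -
  have "sem (Comp (Plus A B) (Par (Wires [A]) (Null B))) = injl C (csem A) (csem B)"
    by (simp add: join_single join.simps[of _ _ "[]"] inv_par_unit par_arrow_def par_def)
  then show "realised [A] [Oplus A B] (injl C (csem A) (csem B))"
    by (intro realisedI[of "Comp (Plus A B) (Par (Wires [A]) (Null B))"]) simp_all
  have "sem (Comp (Plus A B) (Par (Null A) (Wires [B]))) = injr C (csem A) (csem B)"
    by (simp add: join_single join.simps[of _ "[]"] inv_par_unit par_arrow_def par_def)
  then show "realised [B] [Oplus A B] (injr C (csem A) (csem B))"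
    by (intro realisedI[of "Comp (Plus A B) (Par (Null A) (Wires [B]))"]) simp_all
qed

text \<open>Surjectivity of \<open>scal\<close> provides \<open>s\<close>, and
  \<open>lunit_endo\<close> strips the unitors from the semantics of the scalar generator on the
  wire \<open>One\<close>.\<close>

lemma realised_endo:
  assumes "k \<in> Hom C (unitO C) (unitO C)"
  shows "realised [One] [One] k"
proof -
  obtain s where s: "s \<in> carrier R" "scal s = k" using scal_surj[OF assms] .
  have "sem (Scalar s One) = (tensor_lunit C (unitO C) \<cdot> tensor_arrow C k (ident C (unitO C))) \<cdot>
      inv_arrow C (tensor_lunit C (unitO C))"
    using assms s by (simp add: scalar_mult_def)
  also have "\<dots> = k"
    using assms by (subst lunit_endo) simp_all
  finally show ?thesis using s by (intro realisedI[of "Scalar s One"]) simp_all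
qed

text \<open>
  Nothing is used about the adapters between \<open>1 \<otimes> 1\<close> and \<open>1\<close> except that they are invertible: a
  scalar corrects one of them to the inverse of the other.
\<close>

lemma realised_unit_iso:
  obtains w w' where "realised [Otimes One One] [One] w" "realised [One] [Otimes One One] w'"
    "w' \<cdot> w = ident C (unitO C \<boxtimes> unitO C)"
proof -
  let ?u = "adapter_sem C (Otimes One One) One" and ?v = "adapter_sem C One (Otimes One One)"
  have eqv: "Otimes One One \<approx> One" "One \<approx> Otimes One One"
    by (auto intro: colour_equiv.intros)
  note u = adapter_sem_iso[OF eqv(1), simplified] and v = adapter_sem_iso[OF eqv(2), simplified]
  let ?k = "inv_arrow C (?u \<cdot> ?v)"
  have k: "?k \<in> Hom C (unitO C) (unitO C)" using u v by simp
  have "?v \<cdot> ?k = inv_arrow C ?u"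
  proof (rule iso_mono)
    have "?u \<cdot> ?v \<cdot> ?k = (?u \<cdot> ?v) \<cdot> ?k"
      by (rule comp_assoc[symmetric]) (use u v k in simp_all)
    also have "\<dots> = ?u \<cdot> inv_arrow C ?u"
      using u v by (simp del: comp_assoc)
    finally show "?u \<cdot> ?v \<cdot> ?k = ?u \<cdot> inv_arrow C ?u" .
  qed (use u v k in simp_all)
  then have "(?v \<cdot> ?k) \<cdot> ?u = ident C (unitO C \<boxtimes> unitO C)" using u by simp
  moreover have "realised [Otimes One One] [One] ?u"
    by (rule realisedI[of "Adapter (Otimes One One) One"]) (simp_all add: eqv)
  moreover have "realised [One] [Otimes One One] ?v"
    by (rule realisedI[of "Adapter One (Otimes One One)"]) (simp_all add: eqv)
  ultimately show ?thesis
    using that realised_comp[OF _ realised_endo[OF k]] by blast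
qed

text \<open>The resolutions of colours are built again with all points and copoints denoted by
  diagrams. For a tensor, \<open>1 \<otimes> 1\<close> is contracted by the pair from
  \<open>realised_unit_iso\<close> instead of the unitor.\<close>

lemma realised_resolves: "resolves (csem A) {p. realised [One] [A] p} {q. realised [A] [One] q}"
proof (induction A)
  case Zero
  show ?case by (rule resolves_mono[OF resolves_zeroO[folded colour_sem.simps(1)[of C]]])
      (auto simp: realised_arr)
next
  case One
  show ?case by (rule resolves_mono[OF resolves_unitO[folded colour_sem.simps(2)[of C]]])
      (auto simp: realised_arr realised_endo)
next
  case (Oplus A B)
  show ?case
    by (rule resolves_mono[OF resolves_biprod[OF Oplus, folded colour_sem.simps(3)[of C]]])
      (auto simp: realised_arr intro: realised_comp realised_prj realised_inj)
next
  case (Otimes A B)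
  obtain w w' where w: "realised [Otimes One One] [One] w" "realised [One] [Otimes One One] w'"
    "w' \<cdot> w = ident C (unitO C \<boxtimes> unitO C)" by (rule realised_unit_iso)
  have "w \<in> Hom C (unitO C \<boxtimes> unitO C) (unitO C)" "w' \<in> Hom C (unitO C) (unitO C \<boxtimes> unitO C)"
    using realised_arr[OF w(1)] realised_arr[OF w(2)] by simp_all
  from resolves_tensor[OF Otimes this w(3), folded colour_sem.simps(4)[of C]]
  show ?case
    by (rule resolves_mono) (auto simp: realised_arr intro: realised_comp realised_tensor w)
qed

text \<open>The identities of both colours are expanded around \<open>f\<close>: an outer induction
  on the one of \<open>B\<close>, an inner one on that of \<open>A\<close>.\<close>

lemma realised_colours:
  assumes f: "f \<in> Hom C (csem A) (csem B)"
  shows "realised [A] [B] f"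
proof -
  let ?SA = "arrow_span (csem A) (csem A) {p. realised [One] [A] p} {q. realised [A] [One] q}"
  let ?SB = "arrow_span (csem B) (csem B) {p. realised [One] [B] p} {q. realised [B] [One] q}"
  have span: "u \<in> Hom C (csem D) (csem D)"
    if "u \<in> arrow_span (csem D) (csem D) {p. realised [One] [D] p} {q. realised [D] [One] q}" for u D
    using arrow_span_Hom[OF that] realised_resolves[of D] by (simp add: resolves_def)
  \<comment> \<open>One row of the matrix: \<open>p\<close> and \<open>q\<close> are fixed on the
    target side while the source identity is expanded.\<close>
  have one: "realised [A] [B] (p \<cdot> (q \<cdot> f \<cdot> u))"
    if pq: "realised [One] [B] p" "realised [B] [One] q" and u: "u \<in> ?SA" for p q u
    using u
  proof induction
    case zero
    show ?case using f realised_arr[OF pq(1)] realised_arr[OF pq(2)] realised_zero by simp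
  next
    case (comp p' q')
    then have r: "realised [One] [A] p'" "realised [A] [One] q'" by auto
    note arrs = realised_arr[OF r(1)] realised_arr[OF r(2)] realised_arr[OF pq(1)] realised_arr[OF pq(2)]
    \<comment> \<open>The matrix entry is an endomorphism of 1, hence denoted by a scalar.\<close>
    have "realised [One] [One] (q \<cdot> f \<cdot> p')"
      using f arrs by (intro realised_endo) simp
    then have "realised [A] [B] (p \<cdot> (q \<cdot> f \<cdot> p') \<cdot> q')"
      using pq r realised_comp by blast
    then show ?case using f arrs by simp
  next
    case (add u v)
    then show ?case
      using f span[OF add(1)] span[OF add(2)] realised_arr[OF pq(1)] realised_arr[OF pq(2)] realised_add
      by (simp add: comp_add_arrow)
  qed
  have idA: "ident C (csem A) \<in> ?SA" and idB: "ident C (csem B) \<in> ?SB"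
    using realised_resolves by (auto simp: resolves_def)
  have "realised [A] [B] (u \<cdot> f)" if "u \<in> ?SB" for u
    using that
  proof induction
    case zero
    show ?case using f realised_zero by simp
  next
    case (comp p q)
    then show ?case using one[OF _ _ idA, of p q] f realised_arr[of "[One]" "[B]" p] realised_arr[of "[B]" "[One]" q]
      by simp
  next
    case (add u v)
    then show ?case
      using f span[OF add(1)] span[OF add(2)] realised_add by (simp add: add_arrow_comp)
  qed
  from this[OF idB] show ?thesis using f by simp
qed

section \<open>Packing several wires into one colour\<close>

lemma routesI:
  assumes "wf_diagram R d" "points (src d) xs" "points (tgt d) ys"
    "act (sem d) (list_point (src d) xs) = list_point (tgt d) ys"
  shows "routes d xs ys"
  using assms by (simp add: routes_def)

text \<open>Splitting the biproduct and then both of its parts yields wires A, B, A, B. Each partial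
  point travels through only one of the two parts, and contracting the two A wires and the two B
  wires recovers it.\<close>

lemma realised_unpack2:
  "realised [Oplus (Otimes A B) (Oplus A B)] [A, B] (ident C (par C (csem A) (csem B)))"
proof -
  let ?AB = "Otimes A B" and ?ApB = "Oplus A B"
  let ?d = "Comp (Par (Contr A) (Contr B))
    (Comp (Par (Wires [A]) (Par (Swap B A) (Wires [B])))
    (Comp (Par (TensorM A B) (PlusM A B)) (PlusM ?AB ?ApB)))"
  have "routes ?d [par_point (csem A) (csem B) x y] [x, y]"
    if x: "x \<in> PPt (csem A)" and y: "y \<in> PPt (csem B)" for x y
  proof -
    \<comment> \<open>\<open>p\<close> tells that both points are present. Then the pure tensor
      \<open>t\<close> carries them; otherwise \<open>s\<close> carries the at most one present.
      \<open>q p\<close> keeps a point on the tensor route, \<open>q (\<not> p)\<close> on the plus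
      route, and the other route sees \<open>None\<close>.\<close>
    define t s p q where "t = (if x \<noteq> None \<and> y \<noteq> None then Some (the x \<star> the y) else None)"
      and "s = (if x = None then map_option (compose C (injr C (csem A) (csem B))) y
        else if y = None then map_option (compose C (injl C (csem A) (csem B))) x else None)"
      and "p = (x \<noteq> None \<and> y \<noteq> None)" and "q = (\<lambda>b z. if b then z else (None :: 'm option))"
    have 1: "routes (PlusM ?AB ?ApB) [par_point (csem A) (csem B) x y] [t, s]"
      by (cases x; cases y; rule routesI)
        (use x y in \<open>auto simp: t_def s_def par_def\<close>)
    have "routes (TensorM A B) [t] [q p x, q p y]"
      by (cases x; cases y; rule routesI)
        (use x y in \<open>auto simp: t_def p_def q_def\<close>)
    moreover have "routes (PlusM A B) [s] [q (\<not> p) x, q (\<not> p) y]"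
      by (cases x; cases y; rule routesI)
        (use x y in \<open>auto simp: s_def p_def q_def\<close>)
    ultimately have 2: "routes (Par (TensorM A B) (PlusM A B)) ([t] @ [s]) ([q p x, q p y] @ [q (\<not> p) x, q (\<not> p) y])"
      by (rule routes_Par)
    have 3: "routes (Par (Wires [A]) (Par (Swap B A) (Wires [B])))
        ([q p x] @ [q p y, q (\<not> p) x] @ [q (\<not> p) y]) ([q p x] @ [q (\<not> p) x, q p y] @ [q (\<not> p) y])"
      by (intro routes_Par routes_Wires routes_Swap) (use x y in \<open>simp_all add: q_def\<close>)
    have "routes (Contr D) [q p z, q (\<not> p) z] [z]" if "z \<in> PPt (csem D)" for z D
      by (rule routesI) (use that in \<open>cases z; simp add: q_def\<close>)+
    then have 4: "routes (Par (Contr A) (Contr B)) ([q p x, q (\<not> p) x] @ [q p y, q (\<not> p) y]) ([x] @ [y])"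
      using x y by (intro routes_Par) simp_all
    show ?thesis
      by (rule routes_Comp[OF _ routes_Comp[OF _ routes_Comp[OF _ 1]]]) (use 2 3 4 in simp_all)
  qed
  note r = this
  have "sem ?d = ident C (par C (csem A) (csem B))"
  proof (rule determines_eqI[OF determines_par[OF determines_PPt determines_PPt]])
    fix z assume "z \<in> (\<lambda>(x, y). par_point (csem A) (csem B) x y) ` (PPt (csem A) \<times> PPt (csem B))"
    then obtain x y where z: "z = par_point (csem A) (csem B) x y" "x \<in> PPt (csem A)" "y \<in> PPt (csem B)"
      by auto
    show "act (sem ?d) z = act (ident C (par C (csem A) (csem B))) z"
      using r[OF z(2,3)] z unfolding routes_def by (simp del: term_sem.simps)
  next
    show "sem ?d \<in> Hom C (par C (csem A) (csem B)) (par C (csem A) (csem B))"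
      using sem_Hom[of ?d] by (simp add: par_def del: term_sem.simps)
  qed simp_all
  then show ?thesis by (intro realisedI[of ?d]) simp_all
qed

lemma diagonal_point:
  "a \<in> Pt A \<Longrightarrow> diagonal C A \<cdot> a = add_arrow C (injl C A A \<cdot> a) (injr C A A \<cdot> a)"
proof -
  assume a: "a \<in> Pt A"
  then have A: "A \<in> Obj C" by auto
  show ?thesis
    by (rule pairing_eqI[of _ _ A A]) (use a A in \<open>simp_all add: comp_add_arrow diagonal_def\<close>)
qed

text \<open>Copying a point gives a sum, which \<open>routes\<close> cannot follow. Hence the part
  after the copies is isolated as one arrow \<open>F\<close>, evaluated on pure points, and extended
  to the sums by additivity.\<close>

lemma realised_pack2:
  "realised [A, B] [Oplus (Otimes A B) (Oplus A B)] (ident C (par C (csem A) (csem B)))"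
proof -
  let ?AB = "Otimes A B" and ?ApB = "Oplus A B"
  let ?H = "csem A" and ?K = "csem B"
  let ?g = "Comp (Plus ?AB ?ApB) (Par (Tensor A B) (Plus A B))"
  let ?s = "Par (Wires [A]) (Par (Swap A B) (Wires [B]))"
  let ?d = "Comp (Comp ?g ?s) (Par (ContrM A) (ContrM B))"
  \<comment> \<open>The inner \<open>join\<close> is absorbed so that the source is the product of
    the two pairs of copies. The first copies go to Tensor, the second ones to Plus.\<close>
  let ?F = "sem (Comp ?g ?s) \<cdot> join C [A, A] [B, B]"
  have F: "?F \<in> Hom C (par C (par C ?H ?H) (par C ?K ?K)) (par C ?H ?K)"
    using sem_Hom[of "Comp ?g ?s"] join_arr[of "[A, A]" "[B, B]"]
    by (simp add: par_def del: term_sem.simps)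
  have ev: "act ?F (par_point (par C ?H ?H) (par C ?K ?K) (par_point ?H ?H x1 x2) (par_point ?K ?K y1 y2)) =
      act (prjr C (csem ?AB \<boxtimes> csem ?ApB) (csem ?AB \<boxplus> csem ?ApB)) (par_point (csem ?AB) (csem ?ApB)
        (act (prjl C (?H \<boxtimes> ?K) (?H \<boxplus> ?K)) (par_point ?H ?K x1 y1))
        (act (prjr C (?H \<boxtimes> ?K) (?H \<boxplus> ?K)) (par_point ?H ?K x2 y2)))"
    if x: "x1 \<in> PPt ?H" "x2 \<in> PPt ?H" and y: "y1 \<in> PPt ?K" "y2 \<in> PPt ?K" for x1 x2 y1 y2
  proof -
    have r: "routes ?s ([x1] @ [x2, y1] @ [y2]) ([x1] @ [y1, x2] @ [y2])"
      by (intro routes_Par routes_Wires routes_Swap) (use x y in simp_all)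
    have "act ?F (par_point (osem [A, A]) (osem [B, B]) (list_point [A, A] [x1, x2]) (list_point [B, B] [y1, y2])) =
        act (sem (Comp ?g ?s)) (act (join C [A, A] [B, B])
          (par_point (osem [A, A]) (osem [B, B]) (list_point [A, A] [x1, x2]) (list_point [B, B] [y1, y2])))"
      by (rule act_comp) (use x y in \<open>simp_all del: term_sem.simps list_point_pair obj_sem.simps\<close>)
    also have "\<dots> = act (sem (Comp ?g ?s)) (list_point [A, A, B, B] [x1, x2, y1, y2])"
      using x y by (subst act_join) simp_all
    also have "\<dots> = act (sem ?g) (act (sem ?s) (list_point [A, A, B, B] [x1, x2, y1, y2]))"
      unfolding term_sem.simps(13)[of _ _ ?g]
      by (rule act_comp) (use x y in \<open>simp_all del: term_sem.simps obj_sem.simps\<close>)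
    also have "\<dots> = act (sem ?g) (list_point [A, B, A, B] [x1, y1, x2, y2])"
      using r by (simp add: routes_def del: term_sem.simps)
    also have "\<dots> = act (sem (Plus ?AB ?ApB)) (act (sem (Par (Tensor A B) (Plus A B)))
        (list_point ([A, B] @ [A, B]) ([x1, y1] @ [x2, y2])))"
      unfolding term_sem.simps(13)[of _ _ "Plus ?AB ?ApB"]
      by (subst act_comp) (use x y in \<open>simp_all del: term_sem.simps obj_sem.simps\<close>)
    also have "\<dots> = act (sem (Plus ?AB ?ApB)) (par_point (csem ?AB) (csem ?ApB)
        (act (sem (Tensor A B)) (par_point ?H ?K x1 y1)) (act (sem (Plus A B)) (par_point ?H ?K x2 y2)))"
    proof -
      have "act (sem (Tensor A B)) (par_point ?H ?K x1 y1) \<in> PPt (?H \<boxtimes> ?K)"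
        "act (sem (Plus A B)) (par_point ?H ?K x2 y2) \<in> PPt (?H \<boxplus> ?K)"
        using act_PPt[of "sem (Tensor A B)" "par_point ?H ?K x1 y1"] par_point_PPt[of ?H ?K x1 y1]
          act_PPt[of "sem (Plus A B)" "par_point ?H ?K x2 y2"] par_point_PPt[of ?H ?K x2 y2] x y
        by (simp_all add: par_def del: term_sem.simps par_point_PPt)
      then show ?thesis
        using act_sem_Par[of "Tensor A B" "Plus A B" "[x1, y1]" "[x2, y2]"] x y
        by (simp add: join_single del: term_sem.simps)
    qed
    finally show ?thesis by simp
  qed
  define F where "F = ?F"
  note ev = ev[folded F_def]
  have FH: "F \<in> Arr C" "Dom C F = par C (par C ?H ?H) (par C ?K ?K)" "Cod C F = par C ?H ?K"
    using F unfolding F_def by simp_all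
  let ?cA = "injr C (?H \<boxtimes> ?H) (?H \<boxplus> ?H) \<cdot> diagonal C ?H" and ?cB = "injr C (?K \<boxtimes> ?K) (?K \<boxplus> ?K) \<cdot> diagonal C ?K"
  have sem_d: "sem ?d = F \<cdot> par_arrow C ?cA ?cB"
  proof -
    have "sem ?d = sem (Comp ?g ?s) \<cdot> sem (Par (ContrM A) (ContrM B))" by simp
    also have "sem (Par (ContrM A) (ContrM B)) = join C [A, A] [B, B] \<cdot> par_arrow C ?cA ?cB"
      by (simp add: join_single par_def)
    finally show ?thesis
      unfolding F_def by (subst comp_assoc) (simp_all add: par_def del: term_sem.simps)
  qed
  \<comment> \<open>A copied point is the sum of the point on the first copy and the point on the
    second.\<close>
  have copy: "?cA \<cdot> a = add_arrow C (injr C (?H \<boxtimes> ?H) (?H \<boxplus> ?H) \<cdot> injl C ?H ?H \<cdot> a)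
      (injr C (?H \<boxtimes> ?H) (?H \<boxplus> ?H) \<cdot> injr C ?H ?H \<cdot> a)" if "a \<in> Pt ?H" for a
    using that by (simp add: diagonal_point comp_add_arrow)
  have "sem ?d = ident C (par C ?H ?K)"
  proof (rule determines_eqI[OF determines_par[OF determines_PPt determines_PPt]])
    fix z assume "z \<in> (\<lambda>(x, y). par_point ?H ?K x y) ` (PPt ?H \<times> PPt ?K)"
    then obtain x y where z: "z = par_point ?H ?K x y" "x \<in> PPt ?H" "y \<in> PPt ?K"
      by auto
    have "act (sem ?d) z = act F (par_point (par C ?H ?H) (par C ?K ?K) (act ?cA x) (act ?cB y))"
    proof -
      define cA cB where "cA = ?cA" and "cB = ?cB"
      have "cA \<in> Arr C" "Dom C cA = ?H" "Cod C cA = par C ?H ?H"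
        "cB \<in> Arr C" "Dom C cB = ?K" "Cod C cB = par C ?K ?K"
        by (simp_all add: cA_def cB_def par_def)
      then have "act (F \<cdot> par_arrow C cA cB) z = act F (par_point (par C ?H ?H) (par C ?K ?K) (act cA x) (act cB y))"
        using z FH by simp
      then show ?thesis unfolding sem_d cA_def cB_def .
    qed
    also have "\<dots> = z"
    proof (cases x)
      case None
      show ?thesis
      proof (cases y)
        case None
        then show ?thesis using \<open>x = None\<close> z by simp
      next
        case (Some b)
        then have b: "b \<in> Pt ?K" using z by simp
        \<comment> \<open>With one point present, the term on the first copy dies in Tensor and the
          term on the second passes through Plus.\<close>
        show ?thesis
          using b \<open>x = None\<close> Some z FH ev[of None None "Some b" None] ev[of None None None "Some b"]
          by (simp add: diagonal_point comp_add_arrow par_def)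
      qed
    next
      case (Some a)
      then have a: "a \<in> Pt ?H" using z by simp
      show ?thesis
      proof (cases y)
        case None
        then show ?thesis
          using a Some z FH ev[of "Some a" None None None] ev[of None "Some a" None None]
          by (simp add: diagonal_point comp_add_arrow par_def)
      next
        case y: (Some b)
        then have b: "b \<in> Pt ?K" using z by simp
        show ?thesis
          \<comment> \<open>Of the four terms only the one with both points on first copies
            survives. Two points on second copies are killed by Plus, and a mixed choice sends a
            lone point into Tensor.\<close>
          using a b Some y z FH ev[of "Some a" None "Some b" None] ev[of "Some a" None None "Some b"]
            ev[of None "Some a" "Some b" None] ev[of None "Some a" None "Some b"]
          by (simp add: diagonal_point comp_add_arrow point_tensor_add par_def)
      qed
    qed
    finally show "act (sem ?d) z = act (ident C (par C ?H ?K)) z"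
      using z by simp
  next
    show "sem ?d \<in> Hom C (par C ?H ?K) (par C ?H ?K)"
      using sem_Hom[of ?d] by (simp add: par_def del: term_sem.simps)
  qed simp_all
  then show ?thesis by (intro realisedI[of ?d]) simp_all
qed

text \<open>Since both ends denote the same object, identities suffice. A new wire is joined to the
  fused colour by \<open>realised_pack2\<close> and separated by
  \<open>realised_unpack2\<close>.\<close>

lemma realised_fuse:
  "realised X [fuse X] (ident C (osem X)) \<and> realised [fuse X] X (ident C (osem X))"
proof (induction X rule: rev_induct)
  case Nil
  \<comment> \<open>Null at \<open>Zero\<close> denotes a zero arrow on 0, which is its
    identity.\<close>
  have "realised [] [Zero] (ident C (zeroO C))" by (rule realisedI[of "Null Zero"]) simp_all
  moreover have "realised [Zero] [] (ident C (zeroO C))" by (rule realisedI[of "NullM Zero"]) simp_all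
  ultimately show ?case by simp
next
  case (snoc B X)
  show ?case
  proof (cases "X = []")
    case True
    then show ?thesis using realised_ident[of "[B]"] by simp
  next
    case False
    obtain d e where d: "wf_diagram R d" "src d = X" "tgt d = [fuse X]" "sem d = ident C (osem X)"
      and e: "wf_diagram R e" "src e = [fuse X]" "tgt e = X" "sem e = ident C (osem X)"
      using snoc unfolding realised_def by blast
    let ?i = "ident C (par C (osem X) (csem B))"
    have "realised (X @ [B]) [fuse X, B] ?i"
      by (rule realisedI[of "Par d (Wires [B])"])
        (use d False in \<open>simp_all add: join_single colour_sem_fuse\<close>)
    moreover have "realised [fuse X, B] (X @ [B]) ?i"
      by (rule realisedI[of "Par e (Wires [B])"])
        (use e False in \<open>simp_all add: join_single colour_sem_fuse\<close>)
    moreover have "realised [fuse X, B] [fuse (X @ [B])] ?i" "realised [fuse (X @ [B])] [fuse X, B] ?i"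
      using False realised_pack2[of "fuse X" B] realised_unpack2[of "fuse X" B]
      by (simp_all add: fuse_snoc colour_sem_fuse)
    moreover have "?i \<cdot> ?i = ident C (osem (X @ [B]))"
      using False by (simp add: obj_sem_snoc)
    ultimately show ?thesis by (metis realised_comp)
  qed
qed

text \<open>By \<open>colour_sem_fuse\<close>, \<open>f\<close> is also an arrow between the fused
  colours; the diagrams added on either side denote identities and leave it unchanged.\<close>

theorem fullness:
  assumes f: "f \<in> Hom C (osem X) (osem Y)"
  shows "realised X Y f"
proof -
  have "realised [fuse X] [fuse Y] f"
    using f by (intro realised_colours) (simp add: colour_sem_fuse)
  then have "realised X Y (ident C (osem Y) \<cdot> f \<cdot> ident C (osem X))"
    using realised_fuse realised_comp by blast
  then show ?thesis using f by simp
qed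

end

theorem mainTheorem1:
  fixes R :: "('r, 'x) ring_scheme"
    and H :: "('o, 'm, 'y) bimonoidal_category_scheme"
    and scal :: "'r \<Rightarrow> 'm"
    and X Y :: "colour list"
    and f :: 'm
  assumes "semiring R" and "comm_monoid R"
    and "distributive_semiadditive_category H"
    and "scal \<in> semiring_iso R (endo_semiring H)"
    and "f \<in> Hom H (obj_sem H X) (obj_sem H Y)"
  shows "\<exists>d \<in> FTP R X Y. diagram_sem H scal d = f"
proof -
  interpret distributive_semiadditive_category H by (rule assms(3))
  interpret ftp_semantics H R scal by unfold_locales (rule assms(4))
  show ?thesis
    using fullness[OF assms(5)] diagram_sem_realises unfolding realised_def by blast
qed

end
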